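(* Fix an integer $M\ge 1$ and a transmit power $P>0$. In the three-transmitter $M\times 2M$ MIMO interference channel with $K$ users per transmitter described in the context, let the user be selected by either of the two opportunistic interference alignment schemes OIA1 or OIA2, and let $\mathcal{R}_{[K]}$ be the resulting average achievable rate at the selected user. Then, as the number of users goes to infinity with $P$ fixed, the achievable rate becomes the ergodic capacity of the interference-free $M\times M$ point-to-point MIMO system: $$\lim_{K\to\infty}\mathcal{R}_{[K]}=\mathbb{E}\left[\log_2\left|\mathbf{I}_M+\frac{P}{M}\hat{\mathbf{H}}\hat{\mathbf{H}}^{*}\right|\right],$$ where $\hat{\mathbf{H}}$ is a random $M\times M$ matrix with i.i.d. circularly symmetric complex Gaussian entries of zero mean and unit variance.
   Context: Notation: $\mathbf{X}^*$ is the conjugate transpose, $|\mathbf{X}|$ the determinant, $\lambda_n(\mathbf{X})$ the $n$th largest eigenvalue of a Hermitian matrix $\mathbf{X}$, and $\mathbf{v}_n(\mathbf{X})$ a corresponding unit eigenvector (the eigenvectors chosen orthonormal). Channel model (viewed from the first transmitter; the other transmitters are statistically identical): for each user $k\in\{1,\dots,K\}$ there are three matrices $\mathbf{H}_{k,1},\mathbf{H}_{k,2},\mathbf{H}_{k,3}\in\mathbb{C}^{2M\times M}$; $\mathbf{H}_{k,1}$ is the desired channel and $\mathbf{H}_{k,2},\mathbf{H}_{k,3}$ are the interfering channels. All entries of all these matrices are i.i.d. circularly symmetric complex Gaussian with zero mean and unit variance. Noise has identity covariance and each transmitter sends $M$ streams with equal power $P/M$. If user $k$ uses a postprocessing matrix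 $\mathbf{F}_k\in\mathbb{C}^{M\times 2M}$ with $\mathbf{F}_k\mathbf{F}_k^*=\mathbf{I}_M$, its achievable rate is $R_k=R_k^+-R_k^-$ with $$R_k^+=\log_2\Big|\mathbf{I}_M+\tfrac{P}{M}\sum_{i=1}^3\mathbf{F}_k\mathbf{H}_{k,i}\mathbf{H}_{k,i}^*\mathbf{F}_k^*\Big|,\qquad R_k^-=\log_2\Big|\mathbf{I}_M+\tfrac{P}{M}\sum_{i=2}^3\mathbf{F}_k\mathbf{H}_{k,i}\mathbf{H}_{k,i}^*\mathbf{F}_k^*\Big|.$$ OIA schemes: put $\mathbf{B}_k=\mathbf{H}_{k,2}\mathbf{H}_{k,2}^*+\mathbf{H}_{k,3}\mathbf{H}_{k,3}^*$. In both schemes the postprocessing matrix is $\mathbf{F}_k=[\mathbf{v}_{M+1}(\mathbf{B}_k),\dots,\mathbf{v}_{2M}(\mathbf{B}_k)]^*$. OIA1 selects the user $k^\star=\arg\min_k\prod_{m=M+1}^{2M}\big(1+\frac{P}{M}\lambda_m(\mathbf{B}_k)\big)$. OIA2 selects the user $k^\star=\arg\min_k d_c^2(\tilde{\mathbf{H}}_{k,2},\tilde{\mathbf{H}}_{k,3})$, where $\tilde{\mathbf{H}}_{k,i}\in\mathbb{C}^{2M\times M}$ is any matrix with orthonormal columns spanning the column space of $\mathbf{H}_{k,i}$, and $d_c^2(\mathbf{A},\mathbf{B})=M-\mathrm{tr}(\mathbf{A}^*\mathbf{B}\mathbf{B}^*\mathbf{A})$ is the squared chordal distance between the column spaces. The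 average achievable rate is $\mathcal{R}_{[K]}=\mathbb{E}[R_{k^\star}]$. *)

theory Defs
  imports
    "HOL-Probability.Probability"
    "Jordan_Normal_Form.Schur_Decomposition"
    "Jordan_Normal_Form.VS_Connect"
begin

unbundle no vec_syntax
no_notation Inner_Product.real_inner_class.inner (infix "\<bullet>" 70)
hide_const (open) Determinants.det

definition (in prob_space) std_complex_gaussian :: "('a \<Rightarrow> complex) \<Rightarrow> bool" where
  "std_complex_gaussian X \<longleftrightarrow>
     indep_var borel (\<lambda>\<omega>. Re (X \<omega>)) borel (\<lambda>\<omega>. Im (X \<omega>)) \<and>
     distributed M lborel (\<lambda>\<omega>. Re (X \<omega>)) (normal_density 0 (sqrt (1 / 2))) \<and>
     distributed M lborel (\<lambda>\<omega>. Im (X \<omega>)) (normal_density 0 (sqrt (1 / 2)))"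

definition (in prob_space) iid_complex_gaussian :: "('i \<Rightarrow> 'a \<Rightarrow> complex) \<Rightarrow> 'i set \<Rightarrow> bool" where
  "iid_complex_gaussian X I \<longleftrightarrow>
     indep_vars (\<lambda>_. borel) X I \<and> (\<forall>i\<in>I. std_complex_gaussian (X i))"

definition mat_trace :: "'a::comm_monoid_add mat \<Rightarrow> 'a" where
  "mat_trace A = (\<Sum>i<dim_row A. A $$ (i, i))"

(* The n-th largest eigenvalue (n = 1, 2, ...), counted with multiplicity. It is meant for
   Hermitian matrices, whose eigenvalues are real, so that Re loses nothing. *)
definition nth_eigenvalue :: "nat \<Rightarrow> complex mat \<Rightarrow> real" where
  "nth_eigenvalue n X =
     rev (sorted_list_of_multiset (image_mset Re (proots (char_poly X)))) ! (n - 1)"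

(* v assigns to every Hermitian d x d matrix X an orthonormal system v 1 X, ..., v d X, where
   v n X is an eigenvector for the n-th largest eigenvalue. Eigenvectors are only determined up
   to unitary rotations in the eigenspaces. The last conjunct excludes choices that are
   not Borel measurable in the d * d entries of X, for which expectations are undefined. *)
definition eigenvector_choice :: "nat \<Rightarrow> (nat \<Rightarrow> complex mat \<Rightarrow> complex vec) \<Rightarrow> bool" where
  "eigenvector_choice d v \<longleftrightarrow>
     (\<forall>X \<in> carrier_mat d d. mat_adjoint X = X \<longrightarrow>
        (\<forall>n \<in> {1..d}. v n X \<in> carrier_vec d \<and>
           X *\<^sub>v v n X = complex_of_real (nth_eigenvalue n X) \<cdot>\<^sub>v v n X) \<and>
        (\<forall>m \<in> {1..d}. \<forall>n \<in> {1..d}. v m X \<bullet>c v n X = (if m = n then 1 else 0))) \<and>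
     (\<forall>n \<in> {1..d}. \<forall>i<d.
        (\<lambda>a. v n (mat d d a) $ i) \<in> borel_measurable (Pi\<^sub>M ({..<d} \<times> {..<d}) (\<lambda>_. borel)))"

definition orthonormal_basis_mat :: "complex mat \<Rightarrow> complex mat \<Rightarrow> bool" where
  "orthonormal_basis_mat X U \<longleftrightarrow>
     U \<in> carrier_mat (dim_row X) (dim_col X) \<and>
     mat_adjoint U * U = 1\<^sub>m (dim_col X) \<and>
     vec_space.col_space (dim_row X) U =
       vec_space.col_space (dim_row X) X"

definition sq_chordal_dist :: "complex mat \<Rightarrow> complex mat \<Rightarrow> real" where
  "sq_chordal_dist A B =
     real (dim_col A) - Re (mat_trace (mat_adjoint A * B * mat_adjoint B * A))"

(* The squared chordal distance of the column spaces does not depend on the orthonormal bases U, V.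
   Such bases exist iff X and Y have full column rank; otherwise (a null event for Gaussian
   matrices) the value is a fixed unspecified real. *)
definition sq_chordal_dist_col :: "complex mat \<Rightarrow> complex mat \<Rightarrow> real" where
  "sq_chordal_dist_col X Y =
     (THE d. \<exists>U V. orthonormal_basis_mat X U \<and> orthonormal_basis_mat Y V \<and>
        d = sq_chordal_dist U V)"

(* The determinant is real in all uses: the argument is Hermitian. *)
definition log2_det :: "complex mat \<Rightarrow> real" where
  "log2_det A = log 2 (Re (det A))"

(* In the following, Hk 1 is the desired channel of a user, Hk 2 and Hk 3 are its interfering
   channels. *)
definition interference_cov :: "(nat \<Rightarrow> complex mat) \<Rightarrow> complex mat" where
  "interference_cov Hk = Hk 2 * mat_adjoint (Hk 2) + Hk 3 * mat_adjoint (Hk 3)"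

definition received_cov :: "complex mat \<Rightarrow> complex mat \<Rightarrow> complex mat" where
  "received_cov F X = F * X * mat_adjoint X * mat_adjoint F"

definition rate_plus :: "nat \<Rightarrow> real \<Rightarrow> complex mat \<Rightarrow> (nat \<Rightarrow> complex mat) \<Rightarrow> real" where
  "rate_plus M P F Hk = log2_det (1\<^sub>m M + complex_of_real (P / real M) \<cdot>\<^sub>m
     (received_cov F (Hk 1) + received_cov F (Hk 2) + received_cov F (Hk 3)))"

definition rate_minus :: "nat \<Rightarrow> real \<Rightarrow> complex mat \<Rightarrow> (nat \<Rightarrow> complex mat) \<Rightarrow> real" where
  "rate_minus M P F Hk = log2_det (1\<^sub>m M + complex_of_real (P / real M) \<cdot>\<^sub>m
     (received_cov F (Hk 2) + received_cov F (Hk 3)))"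

definition user_rate :: "nat \<Rightarrow> real \<Rightarrow> complex mat \<Rightarrow> (nat \<Rightarrow> complex mat) \<Rightarrow> real" where
  "user_rate M P F Hk = rate_plus M P F Hk - rate_minus M P F Hk"

definition postprocessing ::
    "nat \<Rightarrow> (nat \<Rightarrow> complex mat \<Rightarrow> complex vec) \<Rightarrow> (nat \<Rightarrow> complex mat) \<Rightarrow> complex mat" where
  "postprocessing M v Hk =
     mat_adjoint (mat_of_cols (2 * M) (map (\<lambda>n. v n (interference_cov Hk)) [M + 1..<2 * M + 1]))"

datatype oia_scheme = OIA1 | OIA2

fun selection_metric :: "oia_scheme \<Rightarrow> nat \<Rightarrow> real \<Rightarrow> (nat \<Rightarrow> complex mat) \<Rightarrow> real" where
  "selection_metric OIA1 M P Hk =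
     (\<Prod>m = M + 1..2 * M. 1 + P / real M * nth_eigenvalue m (interference_cov Hk))"
| "selection_metric OIA2 M P Hk = sq_chordal_dist_col (Hk 2) (Hk 3)"

(* H k i is the i-th channel matrix of user k = 1, 2, ...; the K users are 1, ..., K. *)
definition selected_user ::
    "oia_scheme \<Rightarrow> nat \<Rightarrow> real \<Rightarrow> nat \<Rightarrow> (nat \<Rightarrow> nat \<Rightarrow> complex mat) \<Rightarrow> nat" where
  "selected_user s M P K H = arg_min_on (\<lambda>k. selection_metric s M P (H k)) {1..K}"

definition (in prob_space) average_rate ::
    "oia_scheme \<Rightarrow> (nat \<Rightarrow> complex mat \<Rightarrow> complex vec) \<Rightarrow> nat \<Rightarrow> real \<Rightarrow>
     (nat \<Rightarrow> nat \<Rightarrow> 'a \<Rightarrow> complex mat) \<Rightarrow> nat \<Rightarrow> real" where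
  "average_rate s v M' P H K = expectation (\<lambda>\<omega>.
     let Hs = (\<lambda>k i. H k i \<omega>);
         k = selected_user s M' P K Hs
     in user_rate M' P (postprocessing M' v (Hs k)) (Hs k))"

end

theory Submission
  imports Defs "Jordan_Normal_Form.DL_Rank"
begin

text \<open>
  Write \<open>c = P / M\<close>, let \<open>F\<close> be the postprocessing matrix, \<open>Z = F * Hk 1\<close>, and let \<open>L\<close> be
  the diagonal matrix of the \<open>M\<close> smallest eigenvalues of the interference covariance. As
  \<open>det (X + diag d)\<close> is a polynomial in \<open>d\<close>, affine in each entry and with nonnegative coefficients,
  if \<open>X\<close> is positive semidefinite, the rate lies between \<open>log det (1 + c Z Z*) - log det (1 + c L)\<close>
  and \<open>log det (1 + c Z Z*)\<close>.

  The selection and \<open>F\<close> depend only on the interfering channels, so they are independent of \<open>Hk 1\<close>.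
  As the rows of \<open>F\<close> are orthonormal, \<open>Z\<close> at the selected user is an \<open>M * M\<close> Gaussian matrix by
  unitary invariance, and the upper bound has the claimed limit as its expectation for every \<open>K\<close>.

  It remains to show that the expected loss \<open>log det (1 + c L)\<close> at the selected user vanishes. For OIA1
  the loss is a minimum of independent integrable variables that are arbitrarily small with positive
  probability. For OIA2 the eigenvalues in \<open>L\<close> are at most \<open>d * |Hk 3|^2\<close>, where \<open>d\<close> is the minimal
  squared chordal distance and \<open>|Hk 3|\<close> the Frobenius norm. As \<open>d\<close> does not change if \<open>Hk 3\<close> is
  scaled, the factor \<open>|Hk 3|^2 \<le> 2 exp (3/4 |Hk 3|^2)\<close> costs only a constant, since the weight turns
  the Gaussian density into that of a scaled Gaussian.
\<close>

section \<open>Determinants of positive semidefinite perturbations\<close>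

text \<open>The limit needs convergence in mean, and the obstacle is OIA2: its selection controls
  the chordal distance \<open>d\<close> but not the norm of \<open>Hk 3\<close>, and the largest
  norm among \<open>K\<close> users is not bounded by an integrable variable independent of
  \<open>K\<close>. The exponential weight decouples the two factors. Its exponent 3/4 turns
  \<open>exp (- |z|^2)\<close> into \<open>exp (- |z / 2|^2)\<close>, so weighting amounts to
  doubling the entries of \<open>Hk 3\<close> and costs a factor 4 for each of its
  \<open>2 M^2\<close> entries, whatever \<open>K\<close> is; what remains is the mean of the
  bounded variable \<open>d\<close> at the selected user. All estimates take place on one product
  space that carries infinitely many users. Independence is used there in the form of resampling:
  one block of coordinates is integrated out while the others stay fixed. Integrals are nonnegative
  ones until the final sandwich, so integrability is settled in one place.\<close>

lemma dim_mat_adjoint [simp]: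
  "dim_row (mat_adjoint A) = dim_col A" "dim_col (mat_adjoint A) = dim_row A"
  by (simp_all add: mat_adjoint_def)

lemma mat_adjoint_carrier [simp, intro]:
  "A \<in> carrier_mat n m \<Longrightarrow> mat_adjoint A \<in> carrier_mat m n"
  by auto

lemma index_mat_adjoint [simp]:
  fixes A :: "complex mat"
  shows "i < dim_col A \<Longrightarrow> j < dim_row A \<Longrightarrow> mat_adjoint A $$ (i, j) = cnj (A $$ (j, i))"
  by (simp add: mat_adjoint_def mat_of_rows_def)

lemma mat_adjoint_adjoint [simp]: "mat_adjoint (mat_adjoint A) = (A :: complex mat)"
  by (rule eq_matI) auto

lemma mat_adjoint_mult:
  fixes A B :: "complex mat"
  assumes "A \<in> carrier_mat n m" "B \<in> carrier_mat m k"
  shows "mat_adjoint (A * B) = mat_adjoint B * mat_adjoint A"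
  using assms by (intro eq_matI) (auto simp: scalar_prod_def mult.commute intro!: sum.cong)

lemma mat_adjoint_add:
  fixes A B :: "complex mat"
  assumes "A \<in> carrier_mat n m" "B \<in> carrier_mat n m"
  shows "mat_adjoint (A + B) = mat_adjoint A + mat_adjoint B"
  using assms by (intro eq_matI) auto

definition sqnorm :: "complex vec \<Rightarrow> real" where
  "sqnorm v = (\<Sum>i<dim_vec v. (cmod (v $ i))\<^sup>2)"

lemma sqnorm_nonneg [simp]: "0 \<le> sqnorm v"
  by (simp add: sqnorm_def sum_nonneg)

lemma cscalar_prod_self: "v \<bullet>c v = complex_of_real (sqnorm v)"
  by (simp add: sqnorm_def scalar_prod_def complex_norm_square atLeast0LessThan del: of_real_power)

lemma sqnorm_eq_0: "sqnorm v = 0 \<longleftrightarrow> v = 0\<^sub>v (dim_vec v)"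
proof -
  have "v = 0\<^sub>v (dim_vec v) \<longleftrightarrow> (\<forall>i<dim_vec v. v $ i = 0)"
    by (metis eq_vecI index_zero_vec)
  then show ?thesis by (auto simp: sqnorm_def sum_nonneg_eq_0_iff)
qed

lemma cscalar_prod_adjoint:
  fixes A :: "complex mat"
  assumes A: "A \<in> carrier_mat n m" and x: "x \<in> carrier_vec m" and y: "y \<in> carrier_vec n"
  shows "(A *\<^sub>v x) \<bullet>c y = x \<bullet>c (mat_adjoint A *\<^sub>v y)"
proof -
  have "(A *\<^sub>v x) \<bullet>c y = (\<Sum>i<n. \<Sum>j<m. A $$ (i, j) * x $ j * cnj (y $ i))"
    using assms by (simp add: scalar_prod_def atLeast0LessThan sum_distrib_right)
  also have "\<dots> = (\<Sum>j<m. \<Sum>i<n. A $$ (i, j) * x $ j * cnj (y $ i))"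
    by (rule sum.swap)
  also have "\<dots> = x \<bullet>c (mat_adjoint A *\<^sub>v y)"
    using assms by (simp add: scalar_prod_def atLeast0LessThan sum_distrib_left mult_ac)
  finally show ?thesis .
qed

lemma gram_quadratic_form:
  fixes A :: "complex mat"
  assumes A: "A \<in> carrier_mat n m" and x: "x \<in> carrier_vec n"
  shows "(A * mat_adjoint A *\<^sub>v x) \<bullet>c x = complex_of_real (sqnorm (mat_adjoint A *\<^sub>v x))"
proof -
  have "(A * mat_adjoint A *\<^sub>v x) \<bullet>c x = (A *\<^sub>v (mat_adjoint A *\<^sub>v x)) \<bullet>c x"
    using assms by (subst assoc_mult_mat_vec[of _ n m _ n]) auto
  also have "\<dots> = (mat_adjoint A *\<^sub>v x) \<bullet>c (mat_adjoint A *\<^sub>v x)"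
    using assms by (intro cscalar_prod_adjoint mult_mat_vec_carrier[OF mat_adjoint_carrier]) auto
  finally show ?thesis by (simp add: cscalar_prod_self)
qed

lemma prod_list_complex_ge_power:
  fixes as :: "complex list"
  assumes "0 \<le> t" "\<And>a. a \<in> set as \<Longrightarrow> Im a = 0 \<and> t \<le> Re a"
  shows "Im (prod_list as) = 0 \<and> t ^ length as \<le> Re (prod_list as)"
  using assms(2)
proof (induction as)
  case (Cons a as)
  have "Im a = 0" "t \<le> Re a" using Cons.prems by auto
  moreover have "Im (prod_list as) = 0" "t ^ length as \<le> Re (prod_list as)" using Cons by auto
  moreover have "0 \<le> t ^ length as" using assms by simp
  ultimately show ?case using assms(1) by (simp add: mult_mono)
qed simp

text \<open>The characteristic polynomial splits over the complex numbers, so the determinant is the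
  product of its roots with multiplicity. Each root is a Rayleigh quotient at an eigenvector, hence
  real and at least \<open>t\<close>; no diagonalization is involved.\<close>

lemma det_ge_power:
  fixes A :: "complex mat"
  assumes A: "A \<in> carrier_mat n n" and t: "0 \<le> t"
    and quad: "\<And>x. x \<in> carrier_vec n \<Longrightarrow>
      Im ((A *\<^sub>v x) \<bullet>c x) = 0 \<and> t * sqnorm x \<le> Re ((A *\<^sub>v x) \<bullet>c x)"
  shows "Im (det A) = 0 \<and> t ^ n \<le> Re (det A)"
proof -
  obtain as where as: "char_poly A = (\<Prod>a\<leftarrow>as. [:- a, 1:])" "length as = n"
    using char_poly_factorized[OF A] by blast
  have neg: "- char_matrix A 0 = (-1) \<cdot>\<^sub>m A"
    using A by (intro eq_matI) (auto simp: char_matrix_def)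
  have "poly (char_poly A) 0 = (-1) ^ n * det A"
    using char_poly_matrix[OF A, of 0] A neg by simp
  moreover have "poly (char_poly A) 0 = (\<Prod>a\<leftarrow>as. - a)"
    by (simp add: as poly_prod_list o_def)
  moreover have "(\<Prod>a\<leftarrow>as. - a) = (-1) ^ length as * prod_list as" for as :: "complex list"
    by (induction as) auto
  ultimately have det: "det A = prod_list as"
    using as(2) by auto
  have "Im a = 0 \<and> t \<le> Re a" if a: "a \<in> set as" for a
  proof -
    have "poly (char_poly A) a = 0"
      using a by (auto simp: as poly_prod_list prod_list_zero_iff)
    then have "eigenvalue A a"
      using eigenvalue_root_char_poly[OF A] by simp
    then obtain x where x: "x \<in> carrier_vec n" "x \<noteq> 0\<^sub>v n" "A *\<^sub>v x = a \<cdot>\<^sub>v x"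
      using A by (auto simp: eigenvalue_def eigenvector_def)
    have "(A *\<^sub>v x) \<bullet>c x = a * complex_of_real (sqnorm x)"
      using x by (simp add: cscalar_prod_self)
    moreover have "sqnorm x > 0"
      using x sqnorm_eq_0[of x] sqnorm_nonneg[of x] by (auto simp: less_le)
    ultimately show ?thesis
      using quad[OF x(1)] by auto
  qed
  from prod_list_complex_ge_power[OF t, of as, OF this] show ?thesis
    by (simp add: det as)
qed

definition add_diag :: "complex mat \<Rightarrow> (nat \<Rightarrow> real) \<Rightarrow> complex mat" where
  "add_diag X d = mat (dim_row X) (dim_col X)
     (\<lambda>(r, c). X $$ (r, c) + (if r = c then complex_of_real (d r) else 0))"

lemma add_diag_carrier [simp]: "X \<in> carrier_mat n n \<Longrightarrow> add_diag X d \<in> carrier_mat n n"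
  by (auto simp: add_diag_def)

text \<open>Laplace expansion along row \<open>i\<close>: the entry \<open>d i\<close> occurs only
  at position \<open>(i, i)\<close>, and the cofactors of that row do not contain it.\<close>

lemma det_add_diag_upd:
  assumes X: "X \<in> carrier_mat n n" and i: "i < n"
  shows "det (add_diag X (d(i := t))) =
    det (add_diag X (d(i := 0))) + complex_of_real t * cofactor (add_diag X d) i i"
proof -
  have cof: "cofactor (add_diag X (d(i := s))) i j = cofactor (add_diag X d) i j" for s j
    unfolding cofactor_def
    by (intro arg_cong2[where f = "(*)"] refl arg_cong[where f = det] eq_matI)
       (use X i in \<open>auto simp: mat_delete_def add_diag_def\<close>)
  have "det (add_diag X (d(i := s))) =
      (\<Sum>j<n. X $$ (i, j) * cofactor (add_diag X d) i j) + complex_of_real s * cofactor (add_diag X d) i i" for s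
  proof -
    have "det (add_diag X (d(i := s))) = (\<Sum>j<n. add_diag X (d(i := s)) $$ (i, j) * cofactor (add_diag X d) i j)"
      using laplace_expansion_row[OF add_diag_carrier[OF X] i, of "d(i := s)"] by (simp only: cof)
    also have "\<dots> = (\<Sum>j<n. X $$ (i, j) * cofactor (add_diag X d) i j +
        (if j = i then complex_of_real s * cofactor (add_diag X d) i i else 0))"
      using X i by (intro sum.cong) (auto simp: add_diag_def algebra_simps)
    finally show ?thesis using i by (simp add: sum.distrib)
  qed
  from this[of t] this[of 0] show ?thesis by simp
qed

text \<open>Over the complex numbers a real-valued quadratic form forces the matrix to be Hermitian,
  so this is positive semidefiniteness in the usual sense, in the form that
  \<open>det_ge_power\<close> consumes.\<close>

definition psd :: "nat \<Rightarrow> complex mat \<Rightarrow> bool" where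
  "psd n A \<longleftrightarrow> A \<in> carrier_mat n n \<and>
     (\<forall>x \<in> carrier_vec n. Im ((A *\<^sub>v x) \<bullet>c x) = 0 \<and> 0 \<le> Re ((A *\<^sub>v x) \<bullet>c x))"

lemma add_diag_quadratic_form:
  assumes X: "X \<in> carrier_mat n n" and x: "x \<in> carrier_vec n"
  shows "(add_diag X d *\<^sub>v x) \<bullet>c x =
    (X *\<^sub>v x) \<bullet>c x + complex_of_real (\<Sum>i<n. d i * (cmod (x $ i))\<^sup>2)"
proof -
  have "(add_diag X d *\<^sub>v x) $ i = (X *\<^sub>v x) $ i + complex_of_real (d i) * x $ i" if "i < n" for i
  proof -
    show ?thesis
      using X x that by (simp add: add_diag_def scalar_prod_def atLeast0LessThan distrib_right
        sum.distrib if_distrib[of "\<lambda>z. z * _"] cong: if_cong)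
  qed
  then have "(add_diag X d *\<^sub>v x) \<bullet>c x =
      (\<Sum>i<n. ((X *\<^sub>v x) $ i + complex_of_real (d i) * x $ i) * cnj (x $ i))"
    using X x by (simp add: scalar_prod_def[of _ "conjugate x"] atLeast0LessThan add_diag_def)
  also have "\<dots> = (X *\<^sub>v x) \<bullet>c x + (\<Sum>i<n. complex_of_real (d i) * (x $ i * cnj (x $ i)))"
    using X x by (simp add: scalar_prod_def[of _ "conjugate x"] atLeast0LessThan algebra_simps sum.distrib)
  finally show ?thesis by (simp add: complex_norm_square del: of_real_power)
qed

lemma psd_det_add_diag_nonneg:
  assumes X: "psd n X" and d: "\<And>i. i < n \<Longrightarrow> 0 \<le> d i"
  shows "Im (det (add_diag X d)) = 0" "0 \<le> Re (det (add_diag X d))"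
proof -
  have "Im (det (add_diag X d)) = 0 \<and> 0 ^ n \<le> Re (det (add_diag X d))"
  proof (rule det_ge_power)
    fix x :: "complex vec" assume x: "x \<in> carrier_vec n"
    have "0 \<le> (\<Sum>i<n. d i * (cmod (x $ i))\<^sup>2)" using d by (intro sum_nonneg) auto
    then show "Im ((add_diag X d *\<^sub>v x) \<bullet>c x) = 0 \<and> 0 * sqnorm x \<le> Re ((add_diag X d *\<^sub>v x) \<bullet>c x)"
      using X x by (subst (1 2) add_diag_quadratic_form[of _ n]) (auto simp: psd_def)
  qed (use X in \<open>auto simp: psd_def\<close>)
  then show "Im (det (add_diag X d)) = 0" "0 \<le> Re (det (add_diag X d))"
    using zero_le_power[of "0 :: real" n] by (blast intro: order_trans order_refl)+
qed

lemma psd_det_add_one_ge_1: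
  assumes X: "psd n X"
  shows "1 \<le> Re (det (add_diag X (\<lambda>_. 1)))"
proof -
  have "Im (det (add_diag X (\<lambda>_. 1))) = 0 \<and> 1 ^ n \<le> Re (det (add_diag X (\<lambda>_. 1)))"
  proof (rule det_ge_power)
    fix x :: "complex vec" assume x: "x \<in> carrier_vec n"
    then show "Im ((add_diag X (\<lambda>_. 1) *\<^sub>v x) \<bullet>c x) = 0 \<and>
        1 * sqnorm x \<le> Re ((add_diag X (\<lambda>_. 1) *\<^sub>v x) \<bullet>c x)"
      using X by (subst (1 2) add_diag_quadratic_form[of _ n]) (auto simp: psd_def sqnorm_def)
  qed (use X in \<open>auto simp: psd_def\<close>)
  then show ?thesis by simp
qed

text \<open>As a function of the diagonal, \<open>det (X + diag d)\<close> is affine in each entry,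
  with nonnegative coefficients.\<close>

lemma psd_det_add_diag_upd:
  assumes X: "psd n X" and d: "\<And>i. i < n \<Longrightarrow> 0 \<le> d i" and i: "i < n" and t: "1 \<le> t"
  shows "Re (det (add_diag X (d(i := 1)))) \<le> Re (det (add_diag X (d(i := t))))"
    and "Re (det (add_diag X (d(i := t)))) \<le> t * Re (det (add_diag X (d(i := 1))))"
proof -
  define f where "f s = Re (det (add_diag X (d(i := s))))" for s
  define q where "q = Re (cofactor (add_diag X d) i i)"
  have Xc: "X \<in> carrier_mat n n" using X by (simp add: psd_def)
  have f: "f s = f 0 + s * q" for s
    unfolding f_def q_def by (subst det_add_diag_upd[OF Xc i]) simp
  have nonneg: "0 \<le> f s" if "0 \<le> s" for s
    unfolding f_def using d that by (intro psd_det_add_diag_nonneg[OF X]) auto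
  have q: "0 \<le> q"
  proof (rule ccontr)
    assume "\<not> 0 \<le> q"
    \<comment> \<open>With a negative slope the affine \<open>f\<close> would reach -1 at this
      nonnegative point, against \<open>nonneg\<close>.\<close>
    then have "f ((f 0 + 1) / (- q)) = - 1" by (subst f) (simp add: field_simps)
    moreover have "0 \<le> (f 0 + 1) / (- q)"
      using nonneg[of 0] \<open>\<not> 0 \<le> q\<close> by (intro divide_nonneg_pos) auto
    ultimately show False using nonneg by fastforce
  qed
  have "1 * q \<le> t * q" using t q by (intro mult_right_mono) auto
  then have "f 1 \<le> f t" unfolding f[of 1] f[of t] by simp
  then show "Re (det (add_diag X (d(i := 1)))) \<le> Re (det (add_diag X (d(i := t))))"
    by (simp add: f_def)
  have "1 * f 0 \<le> t * f 0" using t nonneg[of 0] by (intro mult_right_mono) auto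
  then have "f t \<le> t * f 1" unfolding f[of 1] f[of t] by (simp add: algebra_simps)
  then show "Re (det (add_diag X (d(i := t)))) \<le> t * Re (det (add_diag X (d(i := 1))))"
    by (simp add: f_def)
qed

text \<open>The ones on the diagonal are replaced by \<open>d 0\<close>, \<open>d 1\<close> and so
  on, one at a time; by the previous lemma each replacement multiplies the determinant by a factor
  between 1 and \<open>d k\<close>.\<close>

lemma psd_det_add_diag_bounds:
  assumes X: "psd n X" and d: "\<And>i. i < n \<Longrightarrow> 1 \<le> d i"
  shows "Re (det (add_diag X (\<lambda>_. 1))) \<le> Re (det (add_diag X d))"
    and "Re (det (add_diag X d)) \<le> (\<Prod>i<n. d i) * Re (det (add_diag X (\<lambda>_. 1)))"
proof -
  let ?f = "\<lambda>k. Re (det (add_diag X (\<lambda>i. if i < k then d i else 1)))"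
  have "?f 0 \<le> ?f k \<and> ?f k \<le> (\<Prod>i<k. d i) * ?f 0" if "k \<le> n" for k
    using that
  proof (induction k)
    case (Suc k)
    define e where "e = (\<lambda>i. if i < k then d i else 1)"
    have e: "(\<lambda>i. if i < Suc k then d i else 1) = e(k := d k)" "e(k := 1) = e"
      by (auto simp: e_def fun_eq_iff less_Suc_eq)
    have pos: "0 \<le> e i" if "i < n" for i using d[OF that] by (auto simp: e_def)
    have k: "k < n" "1 \<le> d k" using Suc.prems d by auto
    have IH: "?f 0 \<le> ?f k" "?f k \<le> (\<Prod>i<k. d i) * ?f 0" using Suc by auto
    have step: "?f k \<le> ?f (Suc k)" "?f (Suc k) \<le> d k * ?f k"
      using psd_det_add_diag_upd[where d = e, OF X pos k] unfolding e(1) unfolding e(2) by (simp_all add: e_def)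
    have "d k * ?f k \<le> d k * ((\<Prod>i<k. d i) * ?f 0)"
      using IH(2) k by (intro mult_left_mono) auto
    then have "?f (Suc k) \<le> d k * ((\<Prod>i<k. d i) * ?f 0)" using step(2) by linarith
    also have "\<dots> = (\<Prod>i<Suc k. d i) * ?f 0" by simp
    finally have "?f (Suc k) \<le> (\<Prod>i<Suc k. d i) * ?f 0" .
    moreover have "?f 0 \<le> ?f (Suc k)" using IH(1) step(1) by linarith
    ultimately show ?case by blast
  qed simp
  moreover have "add_diag X (\<lambda>i. if i < n then d i else 1) = add_diag X d"
    using X by (intro eq_matI) (auto simp: add_diag_def psd_def)
  ultimately show "Re (det (add_diag X (\<lambda>_. 1))) \<le> Re (det (add_diag X d))"
    "Re (det (add_diag X d)) \<le> (\<Prod>i<n. d i) * Re (det (add_diag X (\<lambda>_. 1)))"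
    by (auto dest!: meta_spec[of _ n])
qed

lemma sqnorm_mult_mat_vec_le:
  fixes A :: "complex mat"
  assumes A: "A \<in> carrier_mat n m" and x: "x \<in> carrier_vec m"
  shows "sqnorm (A *\<^sub>v x) \<le> (\<Sum>i<n. \<Sum>j<m. (cmod (A $$ (i, j)))\<^sup>2) * sqnorm x"
proof -
  have "(cmod ((A *\<^sub>v x) $ i))\<^sup>2 \<le> (\<Sum>j<m. (cmod (A $$ (i, j)))\<^sup>2) * sqnorm x" if i: "i < n" for i
  proof -
    have "cmod ((A *\<^sub>v x) $ i) \<le> (\<Sum>j<m. cmod (A $$ (i, j)) * cmod (x $ j))"
      using A x i by (auto simp: scalar_prod_def atLeast0LessThan norm_mult intro!: sum_norm_le)
    then have "(cmod ((A *\<^sub>v x) $ i))\<^sup>2 \<le> (\<Sum>j<m. cmod (A $$ (i, j)) * cmod (x $ j))\<^sup>2"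
      by (intro power_mono) auto
    also have "\<dots> \<le> (\<Sum>j<m. (cmod (A $$ (i, j)))\<^sup>2) * (\<Sum>j<m. (cmod (x $ j))\<^sup>2)"
      by (rule Cauchy_Schwarz_ineq_sum)
    finally show ?thesis using x by (simp add: sqnorm_def)
  qed
  then show ?thesis
    using A unfolding sqnorm_def[of "A *\<^sub>v x"] sum_distrib_right by (auto intro!: sum_mono)
qed

section \<open>Column spaces and the chordal distance\<close>

definition frob :: "complex mat \<Rightarrow> real" where
  "frob A = (\<Sum>i<dim_row A. \<Sum>j<dim_col A. (cmod (A $$ (i, j)))\<^sup>2)"

text \<open>Premises on \<open>dim_row\<close> and \<open>dim_col\<close> mention only the matrices
  themselves, so in this form the laws of matrix algebra work as conditional rewrite rules; carrier
  premises would leave dimension variables open.\<close>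

lemma assoc_mult_mat_dim:
  "dim_col A = dim_row B \<Longrightarrow> dim_col B = dim_row C \<Longrightarrow> A * B * C = A * (B * C)"
  for A B C :: "'a :: semiring_0 mat"
  using assoc_mult_mat[of A "dim_row A" "dim_col A" B "dim_col B" C "dim_col C"]
  by (metis carrier_matI)

lemma assoc_mult_mat_vec_dim:
  "dim_col A = dim_row B \<Longrightarrow> dim_col B = dim_vec x \<Longrightarrow> A * B *\<^sub>v x = A *\<^sub>v (B *\<^sub>v x)"
  for A B :: "'a :: semiring_0 mat"
  using assoc_mult_mat_vec[of A "dim_row A" "dim_col A" B "dim_col B" x]
  by (metis carrier_matI carrier_vecI)

lemma mat_adjoint_mult_dim:
  "dim_col A = dim_row B \<Longrightarrow> mat_adjoint (A * B) = mat_adjoint B * mat_adjoint (A :: complex mat)"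
  using mat_adjoint_mult[of A "dim_row A" "dim_col A" B "dim_col B"] by (metis carrier_matI)

lemma smult_mult_mat_dim:
  "dim_col A = dim_row B \<Longrightarrow> (k \<cdot>\<^sub>m A) * B = k \<cdot>\<^sub>m (A * B)"
  for A B :: "'a :: comm_semiring_0 mat"
  using mult_smult_assoc_mat[of A "dim_row A" "dim_col A" B "dim_col B"] by (metis carrier_matI)

lemma mult_smult_mat_dim:
  "dim_col A = dim_row B \<Longrightarrow> A * (k \<cdot>\<^sub>m B) = k \<cdot>\<^sub>m (A * B)"
  for A B :: "'a :: comm_semiring_0 mat"
  using mult_smult_distrib[of A "dim_row A" "dim_col A" B "dim_col B"] by (metis carrier_matI)

lemma minus_mult_mat_dim:
  "dim_row A = dim_row B \<Longrightarrow> dim_col A = dim_col B \<Longrightarrow> dim_col B = dim_row C \<Longrightarrow>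
    (A - B) * C = A * C - B * C"
  for A B C :: "'a :: ring mat"
  using minus_mult_distrib_mat[of A "dim_row A" "dim_col A" B C "dim_col C"] by (metis carrier_matI)

lemma mult_minus_mat_dim:
  "dim_col A = dim_row B \<Longrightarrow> dim_row B = dim_row C \<Longrightarrow> dim_col B = dim_col C \<Longrightarrow>
    A * (B - C) = A * B - A * C"
  for A B C :: "'a :: ring mat"
  using mult_minus_distrib_mat[of A "dim_row A" "dim_col A" B "dim_col B" C] by (metis carrier_matI)

lemma det_mult_dim:
  "dim_row A = dim_col A \<Longrightarrow> dim_col A = dim_row B \<Longrightarrow> dim_row B = dim_col B \<Longrightarrow>
    det (A * B) = det A * det B"
  for A B :: "'a :: comm_ring_1 mat"
  using det_mult[of A "dim_row A" B] by (metis carrier_matI)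

lemma dim_adj_mat [simp]: "dim_row (adj_mat A) = dim_row A" "dim_col (adj_mat A) = dim_col A"
  by (simp_all add: adj_mat_def)

lemma frob_nonneg [simp]: "0 \<le> frob A"
  by (simp add: frob_def sum_nonneg)

lemma frob_adjoint [simp]: "frob (mat_adjoint A) = frob A"
  unfolding frob_def by (subst sum.swap) simp

lemma sqnorm_mult_le_frob:
  "dim_vec x = dim_col A \<Longrightarrow> sqnorm (A *\<^sub>v x) \<le> frob A * sqnorm x"
  using sqnorm_mult_mat_vec_le[of A "dim_row A" "dim_col A" x, OF _ carrier_vecI] by (simp add: frob_def)

lemma mat_trace_mult_comm:
  fixes A B :: "complex mat"
  assumes "A \<in> carrier_mat n m" "B \<in> carrier_mat m n"
  shows "mat_trace (A * B) = mat_trace (B * A)"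
proof -
  have "mat_trace (A * B) = (\<Sum>i<n. \<Sum>j<m. A $$ (i, j) * B $$ (j, i))"
    using assms by (simp add: mat_trace_def scalar_prod_def atLeast0LessThan)
  also have "\<dots> = (\<Sum>j<m. \<Sum>i<n. B $$ (j, i) * A $$ (i, j))"
    by (subst sum.swap) (simp add: mult.commute)
  also have "\<dots> = mat_trace (B * A)"
    using assms by (simp add: mat_trace_def scalar_prod_def atLeast0LessThan)
  finally show ?thesis .
qed

lemma mat_trace_gram:
  "mat_trace (mat_adjoint A * A) = complex_of_real (frob A)"
proof -
  have "mat_trace (mat_adjoint A * A) = (\<Sum>j<dim_col A. \<Sum>i<dim_row A. cnj (A $$ (i, j)) * A $$ (i, j))"
    by (simp add: mat_trace_def scalar_prod_def atLeast0LessThan)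
  also have "\<dots> = (\<Sum>i<dim_row A. \<Sum>j<dim_col A. complex_of_real ((cmod (A $$ (i, j)))\<^sup>2))"
    by (subst sum.swap) (simp add: complex_norm_square mult.commute del: of_real_power)
  finally show ?thesis by (simp add: frob_def)
qed

lemma mat_trace_one: "mat_trace (1\<^sub>m m :: complex mat) = of_nat m"
  by (simp add: mat_trace_def)

lemma mat_trace_minus:
  fixes A B :: "complex mat"
  assumes "dim_row A = dim_row B" "dim_col A = dim_col B" "dim_row B = dim_col B"
  shows "mat_trace (A - B) = mat_trace A - mat_trace B"
  using assms by (simp add: mat_trace_def sum_subtractf)

lemma mat_adjoint_minus:
  fixes A B :: "complex mat"
  assumes "A \<in> carrier_mat n m" "B \<in> carrier_mat n m"
  shows "mat_adjoint (A - B) = mat_adjoint A - mat_adjoint B"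
  using assms by (intro eq_matI) auto

lemma sqnorm_isometry:
  fixes V :: "complex mat"
  assumes V: "V \<in> carrier_mat n m" "mat_adjoint V * V = 1\<^sub>m m" and "dim_vec x = m"
  shows "sqnorm (V *\<^sub>v x) = sqnorm x"
proof -
  have x: "x \<in> carrier_vec m" using assms(3) by (rule carrier_vecI)
  have "(V *\<^sub>v x) \<bullet>c (V *\<^sub>v x) = x \<bullet>c (mat_adjoint V *\<^sub>v (V *\<^sub>v x))"
    using V x by (intro cscalar_prod_adjoint) auto
  also have "mat_adjoint V *\<^sub>v (V *\<^sub>v x) = x"
    using V x by (subst assoc_mult_mat_vec[symmetric, of _ m n _ m]) auto
  finally have "complex_of_real (sqnorm (V *\<^sub>v x)) = complex_of_real (sqnorm x)"
    by (simp only: cscalar_prod_self)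
  then show ?thesis by simp
qed

lemma col_space_eqI:
  fixes A B :: "complex mat"
  assumes "A \<in> carrier_mat n m" "B \<in> carrier_mat n k"
    and "S \<in> carrier_mat k m" "A = B * S" "T \<in> carrier_mat m k" "B = A * T"
  shows "vec_space.col_space n A = vec_space.col_space n B"
proof -
  have sub: "vec_space.col_space n A \<subseteq> vec_space.col_space n B"
    if A: "A \<in> carrier_mat n m" and B: "B \<in> carrier_mat n k" and "S \<in> carrier_mat k m" "A = B * S"
    for A B S :: "complex mat" and m k
  proof
    fix y assume "y \<in> vec_space.col_space n A"
    then obtain x where x: "x \<in> carrier_vec m" "A *\<^sub>v x = y" "y \<in> carrier_vec n"
      using A by (auto simp: vec_space.col_space_eq[OF A])
    have "B *\<^sub>v (S *\<^sub>v x) = B * S *\<^sub>v x"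
      using that(1-3) x(1) by (subst assoc_mult_mat_vec_dim) auto
    then have "B *\<^sub>v (S *\<^sub>v x) = y" by (simp only: that(4)[symmetric] x(2))
    moreover have "S *\<^sub>v x \<in> carrier_vec k" using that x by simp
    ultimately show "y \<in> vec_space.col_space n B"
      unfolding vec_space.col_space_eq[OF B] using B x(3) by auto
  qed
  show ?thesis
    by (rule equalityI[OF sub[OF assms(1-4)] sub[OF assms(2,1,5,6)]])
qed

text \<open>Column \<open>j\<close> of \<open>S\<close> holds coefficients that express column
  \<open>j\<close> of \<open>A\<close> through the columns of \<open>B\<close>.\<close>

lemma col_space_subset_factor:
  fixes A B :: "complex mat"
  assumes A: "A \<in> carrier_mat n m" and B: "B \<in> carrier_mat n k"
    and sub: "vec_space.col_space n A \<subseteq> vec_space.col_space n B"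
  obtains S where "S \<in> carrier_mat k m" "A = B * S"
proof -
  have "\<exists>x \<in> carrier_vec k. B *\<^sub>v x = col A j" if j: "j < m" for j
  proof -
    have "A *\<^sub>v unit_vec m j = col A j"
      using A j by (intro eq_vecI) (auto simp: scalar_prod_right_unit)
    then have "col A j \<in> vec_space.col_space n A"
      using A j by (auto simp: vec_space.col_space_eq[OF A] intro!: bexI[of _ "unit_vec m j"])
    then show ?thesis using sub B by (auto simp: vec_space.col_space_eq[OF B])
  qed
  then obtain f where f: "\<And>j. j < m \<Longrightarrow> f j \<in> carrier_vec k \<and> B *\<^sub>v f j = col A j"
    by metis
  let ?S = "mat k m (\<lambda>(i, j). f j $ i)"
  have "A = B * ?S"
  proof (rule eq_matI)
    fix i j assume ij: "i < dim_row (B * ?S)" "j < dim_col (B * ?S)"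
    then have j: "j < m" "i < n" using B by auto
    have "col ?S j = f j" using f[OF j(1)] j by (intro eq_vecI) auto
    then have "(B * ?S) $$ (i, j) = (B *\<^sub>v f j) $ i" using ij by simp
    then show "A $$ (i, j) = (B * ?S) $$ (i, j)" using f[OF j(1)] A j by simp
  qed (use A B in auto)
  then show thesis by (intro that[of ?S]) auto
qed

section \<open>Orthogonal projections and the squared chordal distance\<close>

abbreviation "full_rank X \<equiv> det (mat_adjoint X * (X :: complex mat)) \<noteq> 0"

text \<open>For full rank this is the orthogonal projection \<open>X (X* X)^-1 X*\<close> onto the
  column space, with the inverse written as adjugate over determinant. Its entries are polynomials
  in the entries of \<open>X\<close> and their conjugates, divided by one determinant, which gives
  measurability and continuity.\<close>

definition colproj :: "complex mat \<Rightarrow> complex mat" where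
  "colproj X = inverse (det (mat_adjoint X * X)) \<cdot>\<^sub>m (X * adj_mat (mat_adjoint X * X) * mat_adjoint X)"

lemma colproj_carrier [simp]: "X \<in> carrier_mat n m \<Longrightarrow> colproj X \<in> carrier_mat n n"
  by (intro carrier_matI) (auto simp: colproj_def)

lemma dim_colproj [simp]: "dim_row (colproj X) = dim_row X" "dim_col (colproj X) = dim_row X"
  by (auto simp: colproj_def)

lemma orthonormal_basis_mat_factors:
  assumes X: "X \<in> carrier_mat n m" and U: "orthonormal_basis_mat X U"
  obtains S T where "S \<in> carrier_mat m m" "U = X * S" "T \<in> carrier_mat m m" "X = U * T"
    "U \<in> carrier_mat n m" "mat_adjoint U * U = 1\<^sub>m m" "U * mat_adjoint U * X = X"
proof -
  have Uc: "U \<in> carrier_mat n m" "mat_adjoint U * U = 1\<^sub>m m"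
    and sp: "vec_space.col_space n U = vec_space.col_space n X"
    using X U by (auto simp: orthonormal_basis_mat_def)
  obtain S where S: "S \<in> carrier_mat m m" "U = X * S"
    using col_space_subset_factor[OF Uc(1) X] sp by blast
  obtain T where T: "T \<in> carrier_mat m m" "X = U * T"
    using col_space_subset_factor[OF X Uc(1)] sp by blast
  have "U * mat_adjoint U * X = U * (mat_adjoint U * U) * T"
    using Uc(1) T by (simp add: assoc_mult_mat_dim)
  also have "\<dots> = X" using Uc T by simp
  finally show thesis by (rule that[OF S T Uc])
qed

text \<open>Writing \<open>U = X * S\<close> turns \<open>det (mat_adjoint U * U) = 1\<close> into a
  product of determinants with \<open>det (mat_adjoint X * X)\<close> as a factor.\<close>

lemma orthonormal_basis_mat_det_gram:
  assumes X: "X \<in> carrier_mat n m" and U: "orthonormal_basis_mat X U"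
  shows "full_rank X"
proof -
  obtain S T where S: "S \<in> carrier_mat m m" "U = X * S" and T: "T \<in> carrier_mat m m" "X = U * T"
    and Uc: "U \<in> carrier_mat n m" "mat_adjoint U * U = 1\<^sub>m m" and UX: "U * mat_adjoint U * X = X"
    by (rule orthonormal_basis_mat_factors[OF X U])
  have "mat_adjoint U * U = mat_adjoint S * (mat_adjoint X * X) * S"
    using X S by (simp add: mat_adjoint_mult_dim assoc_mult_mat_dim)
  then have "det (mat_adjoint S * (mat_adjoint X * X) * S) = 1" by (metis Uc(2) det_one)
  moreover have "det (mat_adjoint S * (mat_adjoint X * X) * S) = det (mat_adjoint S) * det (mat_adjoint X * X) * det S"
    using X S(1) by (simp add: det_mult_dim)
  ultimately show ?thesis by auto
qed

text \<open>Let \<open>P = colproj X\<close> and \<open>Q = U * mat_adjoint U\<close>. Then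
  \<open>P * Q = Q\<close>, because \<open>P\<close> fixes \<open>X\<close> and the columns of
  \<open>Q\<close> are combinations of those of \<open>X\<close>; and \<open>P * Q = P\<close>,
  because taking adjoints in \<open>Q * X = X\<close> gives
  \<open>mat_adjoint X * Q = mat_adjoint X\<close>.\<close>

lemma colproj_eq:
  assumes X: "X \<in> carrier_mat n m" and U: "orthonormal_basis_mat X U"
  shows "U * mat_adjoint U = colproj X"
proof -
  define G A Q c where "G = mat_adjoint X * X" and "A = adj_mat G" and "Q = U * mat_adjoint U"
    and "c = inverse (det G)"
  obtain S T where S: "S \<in> carrier_mat m m" "U = X * S" and T: "T \<in> carrier_mat m m" "X = U * T"
    and Uc: "U \<in> carrier_mat n m" "mat_adjoint U * U = 1\<^sub>m m" and UX: "U * mat_adjoint U * X = X"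
    by (rule orthonormal_basis_mat_factors[OF X U])
  have QX: "Q * X = X" using UX by (simp add: Q_def)
  have G: "G \<in> carrier_mat m m" and A: "A \<in> carrier_mat m m" "A * G = det G \<cdot>\<^sub>m 1\<^sub>m m"
    and Q: "Q \<in> carrier_mat n n"
    using X Uc adj_mat[of G m] carrier_matI[of G m m] carrier_matI[of Q n n]
    by (auto simp: G_def A_def Q_def)
  have P: "colproj X = c \<cdot>\<^sub>m (X * A * mat_adjoint X)"
    by (simp add: colproj_def G_def A_def c_def)
  have "X * A * mat_adjoint X * X = X * (A * G)"
    using X A(1) by (simp add: G_def assoc_mult_mat_dim)
  also have "\<dots> = det G \<cdot>\<^sub>m X" using X A by (simp add: mult_smult_mat_dim)
  finally have "colproj X * X = (c * det G) \<cdot>\<^sub>m X"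
    using X A(1) by (auto simp: P smult_mult_mat_dim intro!: eq_matI)
  then have PX: "colproj X * X = X"
    using orthonormal_basis_mat_det_gram[OF X U] X by (auto simp: c_def G_def intro!: eq_matI)
  have "colproj X * Q = (colproj X * X) * (S * mat_adjoint U)"
    using X S Uc colproj_carrier[OF X] unfolding Q_def
    by (simp add: assoc_mult_mat_dim)
  also have "\<dots> = Q"
    using X S Uc unfolding PX Q_def by (simp add: assoc_mult_mat_dim)
  finally have PQ: "colproj X * Q = Q" .
  have adjQ: "mat_adjoint Q = Q"
    using Uc by (simp add: Q_def mat_adjoint_mult_dim)
  have XQ: "mat_adjoint X * Q = mat_adjoint X"
    using mat_adjoint_mult[OF Q X, unfolded QX adjQ] by (rule sym)
  have "colproj X * Q = c \<cdot>\<^sub>m (X * A * (mat_adjoint X * Q))"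
    using X A(1) Q by (simp add: P smult_mult_mat_dim assoc_mult_mat_dim)
  then have "colproj X * Q = colproj X" by (simp add: XQ P)
  then show ?thesis using PQ by (simp add: Q_def)
qed

text \<open>Gram-Schmidt is applied to the columns; dividing by the lengths \<open>r\<close> then
  normalizes them and keeps the span.\<close>

lemma ex_orthonormal_basis_mat:
  assumes X: "X \<in> carrier_mat n m" and det: "full_rank X"
  shows "\<exists>U. orthonormal_basis_mat X U"
proof -
  interpret cof_vec_space n "TYPE(complex)" .
  have inj: "x = 0\<^sub>v m" if x: "x \<in> carrier_vec m" "X *\<^sub>v x = 0\<^sub>v n" for x
  proof -
    have "(mat_adjoint X * X) *\<^sub>v x = 0\<^sub>v m"
      using X x by (subst assoc_mult_mat_vec[of _ m n _ m]) auto
    moreover have "mat_adjoint X * X \<in> carrier_mat m m" using X by (intro carrier_matI) auto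
    ultimately show ?thesis
      using det det_0_iff_vec_prod_zero[of "mat_adjoint X * X" m] X x by auto
  qed
  \<comment> \<open>\<open>lin_dep\<close> speaks about the set of columns, so repeated columns are
    excluded separately: they would put a difference of unit vectors into the kernel.\<close>
  have dist: "distinct (cols X)"
  proof (rule ccontr)
    assume "\<not> distinct (cols X)"
    then obtain i j where ij: "i < m" "j < m" "i \<noteq> j" "col X i = col X j"
      using X by (auto simp: distinct_conv_nth)
    have "X *\<^sub>v (unit_vec m i - unit_vec m j) = X *\<^sub>v unit_vec m i - X *\<^sub>v unit_vec m j"
      using X by (intro mult_minus_distrib_mat_vec) auto
    also have "\<dots> = col X i - col X j"
      using X ij(1,2) by (intro eq_vecI) (auto simp: scalar_prod_right_unit)
    also have "\<dots> = 0\<^sub>v n" unfolding ij(4) using X by (intro eq_vecI) auto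
    finally have "unit_vec m i - unit_vec m j = (0\<^sub>v m :: complex vec)"
      by (intro inj) auto
    then have "(unit_vec m i - unit_vec m j) $ i = (0 :: complex)" using ij by simp
    then show False using ij by simp
  qed
  have ind: "\<not> lin_dep (set (cols X))"
    using lin_depE[OF X _ dist] inj by metis
  define us where "us = gram_schmidt n (cols X)"
  have us: "span (set (cols X)) = span (set us)" "corthogonal us" "set us \<subseteq> carrier_vec n"
      "length us = m"
    using gram_schmidt_result[OF _ dist ind us_def] X cols_dim[of X] by auto
  have usc: "us ! i \<in> carrier_vec n" if "i < m" for i using us that by (auto dest: nth_mem)
  define r where "r i = sqrt (sqnorm (us ! i))" for i
  have orth: "us ! i \<bullet>c us ! j = 0 \<longleftrightarrow> i \<noteq> j" if "i < m" "j < m" for i j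
    using us(2) that by (simp add: corthogonal_def us(4))
  have r: "r i > 0" if "i < m" for i
    using orth[OF that that] sqnorm_nonneg[of "us ! i"] by (auto simp: r_def cscalar_prod_self less_le)
  define W where "W = mat_of_cols n us"
  have W: "W \<in> carrier_mat n m" unfolding W_def us(4)[symmetric] by (rule mat_of_cols_carrier)
  have Wi: "W $$ (i, j) = us ! j $ i" if "i < n" "j < m" for i j
    using that us by (simp add: W_def mat_of_cols_index)
  define U where "U = mat n m (\<lambda>(i, j). us ! j $ i / complex_of_real (r j))"
  have U: "U \<in> carrier_mat n m" by (simp add: U_def)
  have "col_space W = col_space U"
  proof (rule col_space_eqI[OF W U])
    show "W = U * mat m m (\<lambda>(i, j). if i = j then complex_of_real (r i) else 0)"
    proof (rule eq_matI)
      fix i j assume "i < dim_row (U * mat m m (\<lambda>(i, j). if i = j then complex_of_real (r i) else 0))"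
        "j < dim_col (U * mat m m (\<lambda>(i, j). if i = j then complex_of_real (r i) else 0))"
      then have "i < n" "j < m" using U by auto
      then show "W $$ (i, j) = (U * mat m m (\<lambda>(i, j). if i = j then complex_of_real (r i) else 0)) $$ (i, j)"
        using r[of j] by (simp add: Wi U_def scalar_prod_def atLeast0LessThan if_distrib[of "\<lambda>z. _ * z"] cong: if_cong)
    qed (use W U in auto)
    show "U = W * mat m m (\<lambda>(i, j). if i = j then complex_of_real (1 / r i) else 0)"
    proof (rule eq_matI)
      fix i j assume "i < dim_row (W * mat m m (\<lambda>(i, j). if i = j then complex_of_real (1 / r i) else 0))"
        "j < dim_col (W * mat m m (\<lambda>(i, j). if i = j then complex_of_real (1 / r i) else 0))"
      then have ij: "i < n" "j < m" using W by auto
      have "(W * mat m m (\<lambda>(i, j). if i = j then complex_of_real (1 / r i) else 0)) $$ (i, j) =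
          (\<Sum>k<m. if k = j then us ! k $ i / complex_of_real (r k) else 0)"
        using ij W by (simp add: scalar_prod_def atLeast0LessThan Wi if_distrib[of "\<lambda>z. _ * z"] cong: if_cong)
      then show "U $$ (i, j) = (W * mat m m (\<lambda>(i, j). if i = j then complex_of_real (1 / r i) else 0)) $$ (i, j)"
        using ij by (simp add: U_def)
    qed (use W U in auto)
  qed auto
  moreover have "col_space W = col_space X"
    using us unfolding col_space_def W_def by (simp add: cols_mat_of_cols)
  moreover have "mat_adjoint U * U = 1\<^sub>m m"
  proof (rule eq_matI)
    fix i j assume "i < dim_row (1\<^sub>m m :: complex mat)" "j < dim_col (1\<^sub>m m :: complex mat)"
    then have ij: "i < m" "j < m" by auto
    have "(mat_adjoint U * U) $$ (i, j) = (us ! j \<bullet>c us ! i) / (complex_of_real (r i) * complex_of_real (r j))"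
      using ij U usc[of i] usc[of j]
      by (simp add: U_def scalar_prod_def atLeast0LessThan sum_divide_distrib mult.commute)
    also have "\<dots> = 1\<^sub>m m $$ (i, j)"
    proof (cases "i = j")
      case True
      have "complex_of_real (sqnorm (us ! j)) = complex_of_real (r j) * complex_of_real (r j)"
        by (simp add: r_def flip: of_real_mult)
      then show ?thesis using True ij r[of j] by (simp add: cscalar_prod_self)
    next
      case False
      then show ?thesis using ij orth[of j i] by simp
    qed
    finally show "(mat_adjoint U * U) $$ (i, j) = 1\<^sub>m m $$ (i, j)" .
  qed (use U in auto)
  ultimately show ?thesis
    using X U by (auto simp: orthonormal_basis_mat_def intro!: exI[of _ U])
qed

text \<open>The trace is cyclic: \<open>U* V V* U\<close> and \<open>U U* V V*\<close> have the same
  trace, and the latter does not depend on the bases.\<close>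

lemma sq_chordal_dist_eq_colproj:
  assumes X: "X \<in> carrier_mat n m" and Y: "Y \<in> carrier_mat n m"
    and U: "orthonormal_basis_mat X U" and V: "orthonormal_basis_mat Y V"
  shows "sq_chordal_dist U V = real m - Re (mat_trace (colproj X * colproj Y))"
proof -
  have Uc: "U \<in> carrier_mat n m" and Vc: "V \<in> carrier_mat n m"
    using X Y U V by (auto simp: orthonormal_basis_mat_def)
  have "mat_trace (mat_adjoint U * V * mat_adjoint V * U) = mat_trace (U * (mat_adjoint U * V * mat_adjoint V))"
    using Uc Vc by (intro mat_trace_mult_comm[of _ m n] carrier_matI) auto
  also have "U * (mat_adjoint U * V * mat_adjoint V) = (U * mat_adjoint U) * (V * mat_adjoint V)"
    using Uc Vc by (simp add: assoc_mult_mat_dim)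
  finally show ?thesis
    using Uc by (simp add: sq_chordal_dist_def colproj_eq[OF X U] colproj_eq[OF Y V])
qed

text \<open>For a rank-deficient pair an orthonormal basis is missing and the description is
  unsatisfiable, so all such pairs share the value \<open>THE d. False\<close>. A constant there
  keeps the metric measurable.\<close>

lemma sq_chordal_dist_col_eq:
  assumes X: "X \<in> carrier_mat n m" and Y: "Y \<in> carrier_mat n m"
  shows "sq_chordal_dist_col X Y =
    (if full_rank X \<and> full_rank Y
     then real m - Re (mat_trace (colproj X * colproj Y)) else (THE d. False))"
proof (cases "full_rank X \<and> full_rank Y")
  case True
  then obtain U V where UV: "orthonormal_basis_mat X U" "orthonormal_basis_mat Y V"
    using ex_orthonormal_basis_mat X Y by metis
  have "sq_chordal_dist_col X Y = real m - Re (mat_trace (colproj X * colproj Y))"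
    unfolding sq_chordal_dist_col_def
  proof (rule the_equality)
    show "\<exists>U V. orthonormal_basis_mat X U \<and> orthonormal_basis_mat Y V \<and>
        real m - Re (mat_trace (colproj X * colproj Y)) = sq_chordal_dist U V"
      using UV sq_chordal_dist_eq_colproj[OF X Y UV] by (intro exI[of _ U] exI[of _ V]) simp
  next
    fix d assume "\<exists>U V. orthonormal_basis_mat X U \<and> orthonormal_basis_mat Y V \<and> d = sq_chordal_dist U V"
    then show "d = real m - Re (mat_trace (colproj X * colproj Y))"
      using sq_chordal_dist_eq_colproj[OF X Y] by blast
  qed
  then show ?thesis using True by simp
next
  case False
  then have "(\<exists>U V. orthonormal_basis_mat X U \<and> orthonormal_basis_mat Y V \<and> d = sq_chordal_dist U V) = False" for d
    using orthonormal_basis_mat_det_gram X Y by blast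
  then have "sq_chordal_dist_col X Y = (THE d. False)" by (simp only: sq_chordal_dist_col_def)
  then show ?thesis using False by auto
qed

lemma sq_chordal_dist_col_smult:
  assumes X: "X \<in> carrier_mat n m" and Y: "Y \<in> carrier_mat n m" and t: "t \<noteq> 0"
  shows "sq_chordal_dist_col X (t \<cdot>\<^sub>m Y) = sq_chordal_dist_col X Y"
proof -
  have "vec_space.col_space n (t \<cdot>\<^sub>m Y) = vec_space.col_space n Y"
  proof (rule col_space_eqI[of _ n m _ m])
    show "t \<cdot>\<^sub>m Y = Y * (t \<cdot>\<^sub>m 1\<^sub>m m)" using Y by (simp add: mult_smult_mat_dim)
    show "Y = t \<cdot>\<^sub>m Y * (inverse t \<cdot>\<^sub>m 1\<^sub>m m)"
      using Y t by (auto simp: mult_smult_mat_dim intro!: eq_matI)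
  qed (use Y in auto)
  then have "orthonormal_basis_mat (t \<cdot>\<^sub>m Y) V \<longleftrightarrow> orthonormal_basis_mat Y V" for V
    using Y by (simp add: orthonormal_basis_mat_def)
  then show ?thesis by (simp add: sq_chordal_dist_col_def)
qed

text \<open>The matrix \<open>W = V - U * C\<close> is the part of \<open>V\<close> orthogonal to
  the column space of \<open>X\<close>, and its squared Frobenius norm is the squared chordal
  distance. If \<open>u\<close> is orthogonal to that space, the adjoints of \<open>W\<close> and
  \<open>V\<close> agree on \<open>u\<close>, so the image is small if the distance is; the equation
  \<open>V V* Y = Y\<close> passes from \<open>V\<close> to \<open>Y\<close>.\<close>

lemma sq_chordal_dist_col_bounds:
  assumes X: "X \<in> carrier_mat n m" and Y: "Y \<in> carrier_mat n m"
    and det: "full_rank X" "full_rank Y"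
  shows "0 \<le> sq_chordal_dist_col X Y" "sq_chordal_dist_col X Y \<le> real m"
    and "\<And>u. u \<in> carrier_vec n \<Longrightarrow> mat_adjoint X *\<^sub>v u = 0\<^sub>v m \<Longrightarrow>
      sqnorm (mat_adjoint Y *\<^sub>v u) \<le> sq_chordal_dist_col X Y * frob Y * sqnorm u"
proof -
  obtain U V where U: "orthonormal_basis_mat X U" and V: "orthonormal_basis_mat Y V"
    using ex_orthonormal_basis_mat X Y det by metis
  obtain S T where S: "S \<in> carrier_mat m m" "U = X * S" and T: "T \<in> carrier_mat m m" "X = U * T"
    and Uc: "U \<in> carrier_mat n m" "mat_adjoint U * U = 1\<^sub>m m" and UX: "U * mat_adjoint U * X = X"
    by (rule orthonormal_basis_mat_factors[OF X U])
  have Vc: "V \<in> carrier_mat n m" "mat_adjoint V * V = 1\<^sub>m m" "V * mat_adjoint V * Y = Y"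
    by (rule orthonormal_basis_mat_factors[OF Y V], assumption)+
  define C where "C = mat_adjoint U * V"
  define W where "W = V - U * C"
  have C: "C \<in> carrier_mat m m" and W: "W \<in> carrier_mat n m"
    using Uc Vc by (auto simp: C_def W_def)
  have d: "sq_chordal_dist_col X Y = sq_chordal_dist U V"
    using sq_chordal_dist_col_eq[OF X Y] sq_chordal_dist_eq_colproj[OF X Y U V] det by simp
  have CC: "mat_adjoint U * V * mat_adjoint V * U = C * mat_adjoint C"
    using Uc Vc by (simp add: C_def mat_adjoint_mult_dim assoc_mult_mat_dim)
  have dC: "sq_chordal_dist U V = real m - frob C"
    using Uc C mat_trace_gram[of C] mat_trace_mult_comm[of C m m "mat_adjoint C"]
    by (simp add: sq_chordal_dist_def CC)
  have aW: "mat_adjoint W = mat_adjoint V - mat_adjoint C * mat_adjoint U"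
    using Uc Vc C by (simp add: W_def mat_adjoint_minus[of _ n m] mat_adjoint_mult_dim)
  have "mat_adjoint W * U = mat_adjoint C - mat_adjoint C"
    using Uc Vc C unfolding aW
    by (simp add: minus_mult_mat_dim assoc_mult_mat_dim)
       (simp add: C_def mat_adjoint_mult_dim assoc_mult_mat_dim)
  then have WU: "mat_adjoint W * U = 0\<^sub>m m m" using C by auto
  \<comment> \<open>By \<open>WU\<close>, the summand \<open>U * C\<close> of \<open>W\<close>
    contributes nothing to the Gram matrix.\<close>
  have "mat_adjoint W * W = mat_adjoint W * V - mat_adjoint W * (U * C)"
    using Uc Vc C W mult_minus_mat_dim[of "mat_adjoint W" V "U * C"]
    by (simp flip: W_def)
  also have "mat_adjoint W * (U * C) = 0\<^sub>m m m"
    using Uc C W WU by (simp flip: assoc_mult_mat_dim)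
  also have "mat_adjoint W * V = 1\<^sub>m m - mat_adjoint C * C"
    using Uc Vc C unfolding aW
    by (simp add: minus_mult_mat_dim assoc_mult_mat_dim flip: C_def)
  finally have "mat_adjoint W * W = 1\<^sub>m m - mat_adjoint C * C - 0\<^sub>m m m" .
  also have "\<dots> = 1\<^sub>m m - mat_adjoint C * C"
    using C by (intro eq_matI) auto
  finally have "mat_trace (mat_adjoint W * W) = mat_trace (1\<^sub>m m - mat_adjoint C * C)" by simp
  then have "complex_of_real (frob W) = of_nat m - complex_of_real (frob C)"
    using C by (simp add: mat_trace_gram mat_trace_minus mat_trace_one)
  then have fW: "frob W = sq_chordal_dist_col X Y"
    unfolding d dC by (metis of_real_diff of_real_eq_iff of_real_of_nat_eq)
  show "0 \<le> sq_chordal_dist_col X Y" using frob_nonneg[of W] fW by simp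
  show "sq_chordal_dist_col X Y \<le> real m" unfolding d dC by simp
  fix u :: "complex vec" assume u: "u \<in> carrier_vec n" "mat_adjoint X *\<^sub>v u = 0\<^sub>v m"
  have "mat_adjoint U *\<^sub>v u = mat_adjoint S *\<^sub>v (mat_adjoint X *\<^sub>v u)"
    using X S u by (simp add: mat_adjoint_mult_dim assoc_mult_mat_vec_dim)
  then have Uu: "mat_adjoint U *\<^sub>v u = 0\<^sub>v m" using S u by auto
  have "mat_adjoint W *\<^sub>v u = mat_adjoint V *\<^sub>v u - (mat_adjoint C * mat_adjoint U) *\<^sub>v u"
    unfolding aW using Uc Vc C u by (subst minus_mult_distrib_mat_vec[of _ m n]) auto
  also have "(mat_adjoint C * mat_adjoint U) *\<^sub>v u = mat_adjoint C *\<^sub>v (mat_adjoint U *\<^sub>v u)"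
    using Uc C u by (intro assoc_mult_mat_vec) auto
  finally have Wu: "mat_adjoint W *\<^sub>v u = mat_adjoint V *\<^sub>v u"
    using Uc Vc C u by (auto simp: Uu)
  have Vu: "sqnorm (mat_adjoint V *\<^sub>v u) \<le> sq_chordal_dist_col X Y * sqnorm u"
    using sqnorm_mult_le_frob[of u "mat_adjoint W"] W u by (simp add: Wu fW)
  have "mat_adjoint (V * mat_adjoint V * Y) = mat_adjoint Y * (V * mat_adjoint V)"
    using Vc(1) Y by (simp add: mat_adjoint_mult_dim)
  then have "mat_adjoint Y *\<^sub>v u = (mat_adjoint Y * (V * mat_adjoint V)) *\<^sub>v u"
    by (simp only: Vc(3))
  also have "\<dots> = mat_adjoint Y *\<^sub>v ((V * mat_adjoint V) *\<^sub>v u)"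
    using Vc Y u by (intro assoc_mult_mat_vec) auto
  also have "(V * mat_adjoint V) *\<^sub>v u = V *\<^sub>v (mat_adjoint V *\<^sub>v u)"
    using Vc Y u by (intro assoc_mult_mat_vec) auto
  finally have "sqnorm (mat_adjoint Y *\<^sub>v u) = sqnorm (mat_adjoint Y *\<^sub>v (V *\<^sub>v (mat_adjoint V *\<^sub>v u)))" by simp
  also have "\<dots> \<le> frob Y * sqnorm (V *\<^sub>v (mat_adjoint V *\<^sub>v u))"
    using sqnorm_mult_le_frob[of "V *\<^sub>v (mat_adjoint V *\<^sub>v u)" "mat_adjoint Y"] Vc(1) Y by simp
  also have "\<dots> = frob Y * sqnorm (mat_adjoint V *\<^sub>v u)"
    using Vc u by (subst sqnorm_isometry[of _ n m]) auto
  also have "\<dots> \<le> frob Y * (sq_chordal_dist_col X Y * sqnorm u)"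
    using Vu by (intro mult_left_mono) auto
  finally show "sqnorm (mat_adjoint Y *\<^sub>v u) \<le> sq_chordal_dist_col X Y * frob Y * sqnorm u"
    by (simp add: mult_ac)
qed

section \<open>Eigenvalues of the interference and the rate of one user\<close>

lemma nth_eigenvalue_antimono:
  assumes X: "X \<in> carrier_mat d d" and ij: "1 \<le> i" "i \<le> j" "j \<le> d"
  shows "nth_eigenvalue j X \<le> nth_eigenvalue i X"
proof -
  define xs where "xs = sorted_list_of_multiset (image_mset Re (proots (char_poly X)))"
  have "mset xs = image_mset Re (proots (char_poly X))" by (simp add: xs_def)
  then have "length xs = size (proots (char_poly X))" by (metis size_mset size_image_mset)
  then have len: "length xs = d"
    using degree_monic_char_poly[OF X] by (simp add: size_proots_complex)
  have "sorted xs" by (simp add: xs_def)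
  then have "xs ! (d - j) \<le> xs ! (d - i)"
    using ij by (intro sorted_nth_mono) (auto simp: len)
  \<comment> \<open>The list \<open>xs\<close> is increasing, so the \<open>k\<close>-th largest
    entry, with \<open>k\<close> counted from 1, sits at position \<open>d - k\<close>.\<close>
  moreover have "rev xs ! (k - 1) = xs ! (d - k)" if "1 \<le> k" "k \<le> d" for k
    using that by (simp add: rev_nth len)
  ultimately show ?thesis
    using ij by (simp add: nth_eigenvalue_def flip: xs_def)
qed

locale oia_channel =
  fixes M :: nat and v :: "nat \<Rightarrow> complex mat \<Rightarrow> complex vec" and Hk :: "nat \<Rightarrow> complex mat"
  assumes M: "1 \<le> M" and v: "eigenvector_choice (2 * M) v"
    and Hk: "\<And>i. i \<in> {1..3} \<Longrightarrow> Hk i \<in> carrier_mat (2 * M) M"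
begin

abbreviation "B \<equiv> interference_cov Hk"
abbreviation "eig n \<equiv> nth_eigenvalue n B"
abbreviation "F \<equiv> postprocessing M v Hk"

lemma H_dims [simp]:
  "dim_row (Hk (Suc 0)) = 2 * M" "dim_col (Hk (Suc 0)) = M"
  "dim_row (Hk 2) = 2 * M" "dim_col (Hk 2) = M"
  "dim_row (Hk 3) = 2 * M" "dim_col (Hk 3) = M"
  using Hk[of 1] Hk[of 2] Hk[of 3] by auto

lemma B_dims [simp]: "dim_row B = 2 * M" "dim_col B = 2 * M"
  by (simp_all add: interference_cov_def)

lemma B_carrier: "B \<in> carrier_mat (2 * M) (2 * M)"
  by (intro carrier_matI) simp_all

lemma B_hermitian: "mat_adjoint B = B"
proof -
  have "mat_adjoint B = mat_adjoint (Hk 2 * mat_adjoint (Hk 2)) + mat_adjoint (Hk 3 * mat_adjoint (Hk 3))"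
    unfolding interference_cov_def by (intro mat_adjoint_add[of _ "2 * M" "2 * M"] carrier_matI) auto
  then show ?thesis by (simp add: mat_adjoint_mult_dim interference_cov_def)
qed

lemma B_quadratic_form:
  assumes "dim_vec u = 2 * M"
  shows "(B *\<^sub>v u) \<bullet>c u =
    complex_of_real (sqnorm (mat_adjoint (Hk 2) *\<^sub>v u) + sqnorm (mat_adjoint (Hk 3) *\<^sub>v u))"
proof -
  have u: "u \<in> carrier_vec (2 * M)" using assms by (rule carrier_vecI)
  have "B *\<^sub>v u = (Hk 2 * mat_adjoint (Hk 2)) *\<^sub>v u + (Hk 3 * mat_adjoint (Hk 3)) *\<^sub>v u"
    unfolding interference_cov_def
    by (intro add_mult_distrib_mat_vec[of _ "2 * M" "2 * M"] carrier_matI u) auto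
  then have "(B *\<^sub>v u) \<bullet>c u =
      ((Hk 2 * mat_adjoint (Hk 2)) *\<^sub>v u) \<bullet>c u + ((Hk 3 * mat_adjoint (Hk 3)) *\<^sub>v u) \<bullet>c u"
    by (simp only:) (rule add_scalar_prod_distrib[of _ "2 * M"], use u in \<open>auto intro!: carrier_vecI\<close>)
  then show ?thesis
    using gram_quadratic_form[of "Hk 2" "2 * M" M u] gram_quadratic_form[of "Hk 3" "2 * M" M u] Hk u
    by simp
qed

lemma ev_facts:
  assumes "n \<in> {1..2 * M}"
  shows "dim_vec (v n B) = 2 * M" "B *\<^sub>v v n B = complex_of_real (eig n) \<cdot>\<^sub>v v n B"
  using v B_carrier B_hermitian assms by (auto simp: eigenvector_choice_def)

lemma v_orthonormal:
  "m \<in> {1..2 * M} \<Longrightarrow> n \<in> {1..2 * M} \<Longrightarrow> v m B \<bullet>c v n B = (if m = n then 1 else 0)"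
  using v B_carrier B_hermitian by (auto simp: eigenvector_choice_def)

lemma sqnorm_v: "n \<in> {1..2 * M} \<Longrightarrow> sqnorm (v n B) = 1"
  using v_orthonormal[of n n] by (simp add: cscalar_prod_self)

text \<open>This is the Rayleigh quotient of \<open>B\<close> at a unit eigenvector; nonnegativity
  and the Frobenius bound below are read off from it.\<close>

lemma ev_eq:
  assumes n: "n \<in> {1..2 * M}"
  shows "eig n = sqnorm (mat_adjoint (Hk 2) *\<^sub>v v n B) + sqnorm (mat_adjoint (Hk 3) *\<^sub>v v n B)"
proof -
  have "(B *\<^sub>v v n B) \<bullet>c v n B = complex_of_real (eig n) * (v n B \<bullet>c v n B)"
    using ev_facts[OF n] by simp
  then have "complex_of_real (eig n) =
      complex_of_real (sqnorm (mat_adjoint (Hk 2) *\<^sub>v v n B) + sqnorm (mat_adjoint (Hk 3) *\<^sub>v v n B))"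
    unfolding v_orthonormal[OF n n] B_quadratic_form[OF ev_facts(1)[OF n]] by simp
  then show ?thesis by (simp only: of_real_eq_iff)
qed

lemma ev_bounds:
  assumes n: "n \<in> {1..2 * M}"
  shows "0 \<le> eig n" "eig n \<le> frob (Hk 2) + frob (Hk 3)"
proof -
  show "0 \<le> eig n" by (simp add: ev_eq[OF n])
  have "sqnorm (mat_adjoint (Hk i) *\<^sub>v v n B) \<le> frob (Hk i)" if "i \<in> {2, 3}" for i
    using sqnorm_mult_le_frob[of "v n B" "mat_adjoint (Hk i)"] ev_facts[OF n] sqnorm_v[OF n] that
    by auto
  from this[of 2] this[of 3] show "eig n \<le> frob (Hk 2) + frob (Hk 3)"
    by (simp add: ev_eq[OF n])
qed

text \<open>Courant--Fischer: the span of the first \<open>M + 1\<close> eigenvectors meets the orthogonal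
  complement of the column space of \<open>Hk 2\<close>, where only \<open>Hk 3\<close> contributes.\<close>

lemma ev_le_sq_chordal_dist:
  assumes det: "full_rank (Hk 2)" "full_rank (Hk 3)"
    and m: "m \<in> {M + 1..2 * M}"
  shows "eig m \<le> sq_chordal_dist_col (Hk 2) (Hk 3) * frob (Hk 3)"
proof -
  define V where "V = mat (2 * M) (M + 1) (\<lambda>(i, j). v (j + 1) B $ i)"
  \<comment> \<open>Padding the \<open>M\<close> by \<open>M + 1\<close> matrix
    \<open>mat_adjoint (Hk 2) * V\<close> with a zero row makes it square and singular. This yields
    the kernel vector \<open>a\<close> and is the dimension count behind the intersection.\<close>
  define N where "N = mat (M + 1) (M + 1) (\<lambda>(i, j). if i < M then (mat_adjoint (Hk 2) * V) $$ (i, j) else 0)"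
  have V: "dim_row V = 2 * M" "dim_col V = M + 1" by (simp_all add: V_def)
  have "det N = (\<Sum>j<M + 1. N $$ (M, j) * cofactor N M j)"
    by (rule laplace_expansion_row) (simp_all add: N_def)
  also have "\<dots> = 0" by (intro sum.neutral) (simp add: N_def)
  finally have "det N = 0" .
  then obtain a where a: "a \<in> carrier_vec (M + 1)" "a \<noteq> 0\<^sub>v (M + 1)" "N *\<^sub>v a = 0\<^sub>v (M + 1)"
    using det_0_iff_vec_prod_zero[of N "M + 1"] by (auto simp: N_def)
  define u where "u = V *\<^sub>v a"
  have u: "dim_vec u = 2 * M" "u \<in> carrier_vec (2 * M)" using V by (auto simp: u_def intro: carrier_vecI)
  have "mat_adjoint (Hk 2) *\<^sub>v u = (mat_adjoint (Hk 2) * V) *\<^sub>v a"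
    using V a by (simp add: u_def assoc_mult_mat_vec_dim)
  also have "\<dots> = 0\<^sub>v M"
  proof (rule eq_vecI)
    fix i assume i: "i < dim_vec (0\<^sub>v M :: complex vec)"
    have "row N i = row (mat_adjoint (Hk 2) * V) i"
      using i V by (intro eq_vecI) (simp_all add: N_def)
    then have "((mat_adjoint (Hk 2) * V) *\<^sub>v a) $ i = (N *\<^sub>v a) $ i"
      using i by (simp add: N_def del: row_mult)
    then show "((mat_adjoint (Hk 2) * V) *\<^sub>v a) $ i = 0\<^sub>v M $ i" using i a by simp
  qed simp
  finally have perp: "mat_adjoint (Hk 2) *\<^sub>v u = 0\<^sub>v M" .
  have VV: "mat_adjoint V * V = 1\<^sub>m (M + 1)"
  proof (rule eq_matI)
    fix i j assume "i < dim_row (1\<^sub>m (M + 1) :: complex mat)" "j < dim_col (1\<^sub>m (M + 1) :: complex mat)"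
    then have ij: "i + 1 \<in> {1..2 * M}" "j + 1 \<in> {1..2 * M}" "i < M + 1" "j < M + 1" using M by auto
    have "(mat_adjoint V * V) $$ (i, j) = v (j + 1) B \<bullet>c v (i + 1) B"
      using ij(3,4) ev_facts(1)[OF ij(1)] ev_facts(1)[OF ij(2)]
      by (simp add: V_def scalar_prod_def mult.commute)
    then show "(mat_adjoint V * V) $$ (i, j) = 1\<^sub>m (M + 1) $$ (i, j)"
      using v_orthonormal[OF ij(2,1)] ij(3,4) by auto
  qed (simp_all add: V)
  define L where "L = mat (M + 1) (M + 1) (\<lambda>(i, j). if i = j then complex_of_real (eig (i + 1)) else 0)"
  have L: "L \<in> carrier_mat (M + 1) (M + 1)" by (simp add: L_def)
  have BV: "B * V = V * L"
  proof (rule eq_matI)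
    fix i j assume "i < dim_row (V * L)" "j < dim_col (V * L)"
    then have ij: "i < 2 * M" "j < M + 1" "j + 1 \<in> {1..2 * M}" using V L M by auto
    have "col V j = v (j + 1) B"
      using ij ev_facts(1)[OF ij(3)] by (intro eq_vecI) (auto simp: V_def)
    then have "(B * V) $$ (i, j) = (B *\<^sub>v v (j + 1) B) $ i"
      using ij V by simp
    also have "\<dots> = complex_of_real (eig (j + 1)) * v (j + 1) B $ i"
      using ev_facts[OF ij(3)] ij by simp
    also have "\<dots> = (V * L) $$ (i, j)"
      using ij by (simp add: V_def L_def scalar_prod_def atLeast0LessThan if_distrib[of "\<lambda>z. _ * z"]
        mult.commute cong: if_cong)
    finally show "(B * V) $$ (i, j) = (V * L) $$ (i, j)" .
  qed (simp_all add: V L_def)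
  have su: "sqnorm u = sqnorm a"
    unfolding u_def using V VV a by (intro sqnorm_isometry[of _ "2 * M" "M + 1"] carrier_matI) auto
  have "B *\<^sub>v u = V *\<^sub>v (L *\<^sub>v a)"
  proof -
    have "B *\<^sub>v u = (B * V) *\<^sub>v a" using V a by (simp add: u_def assoc_mult_mat_vec_dim)
    also have "\<dots> = V *\<^sub>v (L *\<^sub>v a)" unfolding BV using V a L by (simp add: assoc_mult_mat_vec_dim)
    finally show ?thesis .
  qed
  then have "(B *\<^sub>v u) \<bullet>c u = (L *\<^sub>v a) \<bullet>c (mat_adjoint V *\<^sub>v u)"
    using V a L u by (auto intro!: cscalar_prod_adjoint carrier_matI carrier_vecI)
  also have "mat_adjoint V *\<^sub>v u = (mat_adjoint V * V) *\<^sub>v a"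
    using V a by (simp add: u_def assoc_mult_mat_vec_dim)
  also have "\<dots> = a" using VV a by simp
  also have "(L *\<^sub>v a) \<bullet>c a = complex_of_real (\<Sum>i<M + 1. eig (i + 1) * (cmod (a $ i))\<^sup>2)"
  proof -
    have "(L *\<^sub>v a) $ i = complex_of_real (eig (i + 1)) * a $ i" if "i < M + 1" for i
      using that a by (simp add: L_def scalar_prod_def atLeast0LessThan if_distrib[of "\<lambda>z. z * _"] cong: if_cong)
    then have "(L *\<^sub>v a) \<bullet>c a = (\<Sum>i<M + 1. complex_of_real (eig (i + 1)) * (a $ i * cnj (a $ i)))"
      using a L by (simp add: scalar_prod_def[of _ "conjugate a"] atLeast0LessThan mult.assoc del: sum.lessThan_Suc)
    then show ?thesis by (simp add: complex_norm_square del: of_real_power sum.lessThan_Suc)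
  qed
  finally have "(\<Sum>i<M + 1. eig (i + 1) * (cmod (a $ i))\<^sup>2) = sqnorm (mat_adjoint (Hk 3) *\<^sub>v u)"
    unfolding B_quadratic_form[OF u(1)] perp of_real_eq_iff by (simp add: sqnorm_def)
  \<comment> \<open>Eigenvalue \<open>M + 1\<close> is the smallest of those occurring in the
    sum.\<close>
  moreover have "eig (M + 1) * sqnorm a \<le> (\<Sum>i<M + 1. eig (i + 1) * (cmod (a $ i))\<^sup>2)"
    unfolding sqnorm_def sum_distrib_left using a M
    by (auto intro!: sum_mono mult_right_mono nth_eigenvalue_antimono[OF B_carrier] simp del: sum.lessThan_Suc)
  moreover have "sqnorm (mat_adjoint (Hk 3) *\<^sub>v u) \<le> sq_chordal_dist_col (Hk 2) (Hk 3) * frob (Hk 3) * sqnorm u"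
    using Hk det u perp by (intro sq_chordal_dist_col_bounds(3)[of _ "2 * M" M]) auto
  ultimately have "eig (M + 1) * sqnorm a \<le> (sq_chordal_dist_col (Hk 2) (Hk 3) * frob (Hk 3)) * sqnorm a"
    unfolding su by linarith
  moreover have "0 < sqnorm a"
    using a sqnorm_eq_0[of a] sqnorm_nonneg[of a] by (auto simp: less_le)
  ultimately have "eig (M + 1) \<le> sq_chordal_dist_col (Hk 2) (Hk 3) * frob (Hk 3)"
    by simp
  moreover have "eig m \<le> eig (M + 1)"
    using m by (intro nth_eigenvalue_antimono[OF B_carrier]) auto
  ultimately show ?thesis by linarith
qed

lemma F_dims [simp]: "dim_row F = M" "dim_col F = 2 * M"
  by (simp_all add: postprocessing_def)

lemma F_index: "i < M \<Longrightarrow> j < 2 * M \<Longrightarrow> F $$ (i, j) = cnj (v (M + 1 + i) B $ j)"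
  by (simp add: postprocessing_def mat_of_cols_index del: upt_Suc)

lemma F_orthonormal: "F * mat_adjoint F = 1\<^sub>m M"
proof (rule eq_matI)
  fix i j assume "i < dim_row (1\<^sub>m M :: complex mat)" "j < dim_col (1\<^sub>m M :: complex mat)"
  then have ij: "M + 1 + i \<in> {1..2 * M}" "M + 1 + j \<in> {1..2 * M}" "i < M" "j < M" by auto
  have "(F * mat_adjoint F) $$ (i, j) = v (M + 1 + j) B \<bullet>c v (M + 1 + i) B"
    using ij(3,4) ev_facts(1)[OF ij(1)]
    by (simp add: F_index scalar_prod_def mult.commute)
  then show "(F * mat_adjoint F) $$ (i, j) = 1\<^sub>m M $$ (i, j)"
    using v_orthonormal[OF ij(2,1)] ij(3,4) by auto
qed simp_all

text \<open>The columns of the adjoint of \<open>F\<close> are eigenvectors, so \<open>B\<close>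
  acts on them as a diagonal matrix from the right; orthonormality of the rows of \<open>F\<close>
  then leaves this diagonal matrix.\<close>

lemma F_diagonalizes:
  "F * B * mat_adjoint F = mat M M (\<lambda>(i, j). if i = j then complex_of_real (eig (M + 1 + i)) else 0)"
    (is "_ = ?L")
proof -
  have "B * mat_adjoint F = mat_adjoint F * ?L"
  proof (rule eq_matI)
    fix i j assume "i < dim_row (mat_adjoint F * ?L)" "j < dim_col (mat_adjoint F * ?L)"
    then have ij: "i < 2 * M" "j < M" "M + 1 + j \<in> {1..2 * M}" by auto
    have "col (mat_adjoint F) j = v (M + 1 + j) B"
      using ij ev_facts(1)[OF ij(3)] by (intro eq_vecI) (auto simp: F_index)
    then have "(B * mat_adjoint F) $$ (i, j) = (B *\<^sub>v v (M + 1 + j) B) $ i"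
      using ij by simp
    also have "\<dots> = complex_of_real (eig (M + 1 + j)) * v (M + 1 + j) B $ i"
      using ev_facts[OF ij(3)] ij by simp
    also have "\<dots> = (mat_adjoint F * ?L) $$ (i, j)"
      using ij by (simp add: F_index scalar_prod_def atLeast0LessThan if_distrib[of "\<lambda>z. _ * z"]
        mult.commute cong: if_cong)
    finally show "(B * mat_adjoint F) $$ (i, j) = (mat_adjoint F * ?L) $$ (i, j)" .
  qed simp_all
  then have "F * B * mat_adjoint F = (F * mat_adjoint F) * ?L"
    by (simp add: assoc_mult_mat_dim)
  then show ?thesis by (simp add: F_orthonormal)
qed

end

section \<open>Bounds on the rate and on the loss of one user\<close>

definition rate_gain :: "nat \<Rightarrow> real \<Rightarrow> complex mat \<Rightarrow> real" where
  "rate_gain M P Z = log2_det (1\<^sub>m M + complex_of_real (P / real M) \<cdot>\<^sub>m (Z * mat_adjoint Z))"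

lemma psd_smult_gram:
  assumes Z: "Z \<in> carrier_mat M M" and c: "0 \<le> c"
  shows "psd M (complex_of_real c \<cdot>\<^sub>m (Z * mat_adjoint Z))"
  unfolding psd_def
proof (intro conjI ballI)
  fix x :: "complex vec" assume x: "x \<in> carrier_vec M"
  have "(complex_of_real c \<cdot>\<^sub>m (Z * mat_adjoint Z) *\<^sub>v x) = complex_of_real c \<cdot>\<^sub>v (Z * mat_adjoint Z *\<^sub>v x)"
    using Z x by (intro eq_vecI) (auto simp: smult_scalar_prod_distrib)
  then have "(complex_of_real c \<cdot>\<^sub>m (Z * mat_adjoint Z) *\<^sub>v x) \<bullet>c x =
      complex_of_real (c * sqnorm (mat_adjoint Z *\<^sub>v x))"
    using Z x gram_quadratic_form[OF Z x] by simp
  then show "Im ((complex_of_real c \<cdot>\<^sub>m (Z * mat_adjoint Z) *\<^sub>v x) \<bullet>c x) = 0"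
    "0 \<le> Re ((complex_of_real c \<cdot>\<^sub>m (Z * mat_adjoint Z) *\<^sub>v x) \<bullet>c x)"
    using c by simp_all
qed (use Z in \<open>auto intro!: carrier_matI\<close>)

lemma rate_gain_eq:
  assumes Z: "Z \<in> carrier_mat M M"
  shows "rate_gain M P Z = log 2 (Re (det (add_diag (complex_of_real (P / real M) \<cdot>\<^sub>m (Z * mat_adjoint Z)) (\<lambda>_. 1))))"
  unfolding rate_gain_def log2_det_def
  using Z by (intro arg_cong[where f = "\<lambda>A. log 2 (Re (det A))"] eq_matI) (auto simp: add_diag_def)

lemma rate_gain_nonneg:
  assumes Z: "Z \<in> carrier_mat M M" and P: "0 \<le> P"
  shows "0 \<le> rate_gain M P Z"
  unfolding rate_gain_eq[OF Z]
  using psd_det_add_one_ge_1[OF psd_smult_gram[OF Z, of "P / real M"]] P by (simp add: zero_le_log_cancel_iff)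

context oia_channel
begin

text \<open>As \<open>F\<close> diagonalizes the interference, \<open>rate_minus\<close> is exactly
  the logarithm of the OIA1 metric, and \<open>rate_plus\<close> is that of
  \<open>det (add_diag X d)\<close>. The two bounds on this determinant give the two bounds on the
  difference.\<close>

lemma user_rate_bounds:
  assumes P: "0 < P"
  shows "user_rate M P F Hk \<le> rate_gain M P (F * Hk 1)"
    and "rate_gain M P (F * Hk 1) - log 2 (selection_metric OIA1 M P Hk) \<le> user_rate M P F Hk"
    and "1 \<le> selection_metric OIA1 M P Hk"
proof -
  define c where "c = P / real M"
  define Z where "Z = F * Hk 1"
  define d where "d i = 1 + c * eig (M + 1 + i)" for i
  define X where "X = complex_of_real c \<cdot>\<^sub>m (Z * mat_adjoint Z)"
  have c: "0 \<le> c" using P by (simp add: c_def)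
  have Z: "Z \<in> carrier_mat M M" by (intro carrier_matI) (simp_all add: Z_def)
  have X: "psd M X" using psd_smult_gram[OF Z c] by (simp add: X_def)
  have d: "1 \<le> d i" if "i < M" for i
    using ev_bounds[of "M + 1 + i"] that c by (auto simp: d_def)
  have r1: "received_cov F (Hk 1) = Z * mat_adjoint Z"
    by (simp add: received_cov_def Z_def mat_adjoint_mult_dim assoc_mult_mat_dim)
  have r23: "received_cov F (Hk 2) + received_cov F (Hk 3) = F * B * mat_adjoint F"
  proof -
    have "F * B * mat_adjoint F =
        F * (Hk 2 * mat_adjoint (Hk 2)) * mat_adjoint F + F * (Hk 3 * mat_adjoint (Hk 3)) * mat_adjoint F"
      unfolding interference_cov_def
      by (subst mult_add_distrib_mat[of _ M "2 * M" _ "2 * M"]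
            | subst add_mult_distrib_mat[of _ M "2 * M" _ _ M]
            | intro carrier_matI refl | simp)+
    then show ?thesis by (simp add: received_cov_def assoc_mult_mat_dim)
  qed
  have dims: "dim_row (received_cov F (Hk i)) = M" "dim_col (received_cov F (Hk i)) = M" for i
    by (simp_all add: received_cov_def)
  have plus: "rate_plus M P F Hk = log 2 (Re (det (add_diag X d)))"
  proof -
    have "1\<^sub>m M + complex_of_real (P / real M) \<cdot>\<^sub>m
        (received_cov F (Hk 1) + received_cov F (Hk 2) + received_cov F (Hk 3)) = add_diag X d"
    proof (rule eq_matI)
      fix i j assume "i < dim_row (add_diag X d)" "j < dim_col (add_diag X d)"
      then have ij: "i < M" "j < M" using X by (auto simp: psd_def add_diag_def)
      have "received_cov F (Hk 2) $$ (i, j) + received_cov F (Hk 3) $$ (i, j) =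
          (received_cov F (Hk 2) + received_cov F (Hk 3)) $$ (i, j)"
        using ij dims by simp
      also have "\<dots> = (if i = j then complex_of_real (eig (M + 1 + i)) else 0)"
        unfolding r23 F_diagonalizes using ij by simp
      finally have e: "received_cov F (Hk 3) $$ (i, j) =
          (if i = j then complex_of_real (eig (M + 1 + i)) else 0) - received_cov F (Hk 2) $$ (i, j)"
        by (simp add: algebra_simps)
      show "(1\<^sub>m M + complex_of_real (P / real M) \<cdot>\<^sub>m
          (received_cov F (Hk 1) + received_cov F (Hk 2) + received_cov F (Hk 3))) $$ (i, j) = add_diag X d $$ (i, j)"
        using ij dims Z by (simp add: e r1[unfolded One_nat_def] add_diag_def X_def d_def c_def algebra_simps)
    qed (use dims X in \<open>auto simp: psd_def add_diag_def\<close>)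
    then show ?thesis by (simp add: rate_plus_def log2_det_def)
  qed
  have prod: "(\<Prod>i<M. d i) = selection_metric OIA1 M P Hk"
  proof -
    have "(\<Prod>i<M. d i) = (\<Prod>m\<in>(\<lambda>i. M + 1 + i) ` {..<M}. 1 + c * eig m)"
      by (subst prod.reindex) (auto simp: d_def inj_on_def)
    also have "(\<lambda>i. M + 1 + i) ` {..<M} = {M + 1..2 * M}"
    proof
      show "{M + 1..2 * M} \<subseteq> (\<lambda>i. M + 1 + i) ` {..<M}"
      proof
        fix m assume "m \<in> {M + 1..2 * M}"
        then show "m \<in> (\<lambda>i. M + 1 + i) ` {..<M}" by (intro image_eqI[of _ _ "m - (M + 1)"]) auto
      qed
    qed auto
    finally show ?thesis by (simp add: c_def)
  qed
  have minus: "rate_minus M P F Hk = log 2 (\<Prod>i<M. d i)"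
  proof -
    define D where "D = mat M M (\<lambda>(i, j). if i = j then complex_of_real (d i) else 0)"
    have "1\<^sub>m M + complex_of_real (P / real M) \<cdot>\<^sub>m (received_cov F (Hk 2) + received_cov F (Hk 3)) = D"
      unfolding r23 F_diagonalizes by (intro eq_matI) (auto simp: D_def d_def c_def)
    moreover have "det D = (\<Prod>i<M. complex_of_real (d i))"
    proof -
      have "det D = prod_list (diag_mat D)"
        by (rule det_upper_triangular) (auto simp: D_def)
      also have "\<dots> = (\<Prod>i<M. complex_of_real (d i))"
        by (simp add: prod_list_diag_prod D_def atLeast0LessThan)
      finally show ?thesis .
    qed
    ultimately show ?thesis by (simp add: rate_minus_def log2_det_def flip: of_real_prod)
  qed
  have gain: "rate_gain M P (F * Hk 1) = log 2 (Re (det (add_diag X (\<lambda>_. 1))))"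
    using rate_gain_eq[OF Z, of P] by (simp add: X_def c_def Z_def)
  have one: "1 \<le> Re (det (add_diag X (\<lambda>_. 1)))" by (rule psd_det_add_one_ge_1[OF X])
  note bounds = psd_det_add_diag_bounds[where d = d, OF X d]
  have p1: "1 \<le> (\<Prod>i<M. d i)" using d by (intro prod_ge_1) auto
  show "1 \<le> selection_metric OIA1 M P Hk" using p1 prod by simp
  have "log 2 (Re (det (add_diag X d))) \<le> log 2 ((\<Prod>i<M. d i) * Re (det (add_diag X (\<lambda>_. 1))))"
    using one bounds p1 by (subst log_le_cancel_iff) (linarith | intro mult_pos_pos)+
  also have "\<dots> = log 2 (\<Prod>i<M. d i) + log 2 (Re (det (add_diag X (\<lambda>_. 1))))"
    using one p1 by (intro log_mult_pos) linarith+
  finally show "user_rate M P F Hk \<le> rate_gain M P (F * Hk 1)"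
    unfolding user_rate_def plus minus gain by linarith
  have "log 2 (Re (det (add_diag X (\<lambda>_. 1)))) \<le> log 2 (Re (det (add_diag X d)))"
    using one bounds(1) by (subst log_le_cancel_iff) auto
  then show "rate_gain M P (F * Hk 1) - log 2 (selection_metric OIA1 M P Hk) \<le> user_rate M P F Hk"
    unfolding user_rate_def plus minus gain prod by linarith
qed

text \<open>Each of the \<open>M\<close> factors is at most \<open>exp (P / M * b)\<close> by
  \<open>1 + t \<le> exp t\<close>, and the power \<open>P / M\<close> per stream makes their
  product \<open>exp (P * b)\<close>.\<close>

lemma selection_metric_OIA1_le:
  assumes P: "0 < P" and b: "\<And>m. m \<in> {M + 1..2 * M} \<Longrightarrow> eig m \<le> b"
  shows "log 2 (selection_metric OIA1 M P Hk) \<le> P * b / ln 2"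
proof -
  have "selection_metric OIA1 M P Hk \<le> (\<Prod>m = M + 1..2 * M. exp (P / real M * b))"
    unfolding selection_metric.simps
  proof (rule prod_mono)
    fix m assume m: "m \<in> {M + 1..2 * M}"
    have "P / real M * eig m \<le> P / real M * b" using b[OF m] P by (intro mult_left_mono) auto
    moreover have "0 \<le> P / real M * eig m" using ev_bounds[of m] m P by auto
    ultimately show "0 \<le> 1 + P / real M * eig m \<and> 1 + P / real M * eig m \<le> exp (P / real M * b)"
      using exp_ge_add_one_self[of "P / real M * b"] by linarith
  qed
  also have "\<dots> = exp (P * b)" using M by (simp flip: exp_of_nat_mult)
  finally have "ln (selection_metric OIA1 M P Hk) \<le> P * b"
    using user_rate_bounds(3)[OF P] by (subst ln_exp[symmetric], subst ln_le_cancel_iff) auto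
  then show ?thesis by (simp add: log_def divide_right_mono)
qed

end

section \<open>The complex Gaussian distribution\<close>

abbreviation bprod :: "'i set \<Rightarrow> ('i \<Rightarrow> complex) measure" where
  "bprod I \<equiv> PiM I (\<lambda>_. borel)"

text \<open>The standard complex Gaussian law: independent real and imaginary parts of variance 1/2
  have this joint density. A density in the plane suits the later changes of variables.\<close>

definition cgauss :: "complex measure" where
  "cgauss = density lborel (\<lambda>z. ennreal (exp (- (cmod z)\<^sup>2) / pi))"

lemma sets_cgauss [simp, measurable_cong]: "sets cgauss = sets borel"
  by (simp add: cgauss_def)

lemma space_cgauss [simp]: "space cgauss = UNIV"
  by (simp add: cgauss_def)

lemma measurable_Complex [measurable]: "(\<lambda>(x, y). Complex x y) \<in> borel \<Otimes>\<^sub>M borel \<rightarrow>\<^sub>M borel"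
proof -
  have "(\<lambda>(x, y). complex_of_real x + \<i> * complex_of_real y) \<in> borel \<Otimes>\<^sub>M borel \<rightarrow>\<^sub>M borel"
    by measurable
  then show ?thesis by (simp add: Complex_eq)
qed

lemma lborel_complex_eq:
  "(lborel :: complex measure) = distr (lborel \<Otimes>\<^sub>M lborel) borel (\<lambda>(x, y). Complex x y)"
proof (rule lborel_eqI)
  fix l u :: complex
  assume lu: "\<And>b. b \<in> Basis \<Longrightarrow> inner l b \<le> inner u b"
  then have le: "Re l \<le> Re u" "Im l \<le> Im u"
    using lu[of 1] lu[of \<i>] by (auto simp: Basis_complex_def)
  have "(\<lambda>(x, y). Complex x y) -` box l u \<inter> space (lborel \<Otimes>\<^sub>M lborel) =
      {Re l<..<Re u} \<times> {Im l<..<Im u}"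
    by (auto simp: in_box_complex_iff space_pair_measure)
  then show "emeasure (distr (lborel \<Otimes>\<^sub>M lborel) borel (\<lambda>(x, y). Complex x y)) (box l u) =
      ennreal (\<Prod>b\<in>Basis. inner (u - l) b)"
    using le by (subst emeasure_distr)
      (auto simp: lborel.emeasure_pair_measure_Times Basis_complex_def ennreal_mult)
qed simp

lemma cgauss_eq_distr:
  "cgauss = distr (density lborel (normal_density 0 (sqrt (1 / 2))) \<Otimes>\<^sub>M
    density lborel (normal_density 0 (sqrt (1 / 2)))) borel (\<lambda>(x, y). Complex x y)"
proof -
  let ?n = "normal_density 0 (sqrt (1 / 2))"
  have n: "?n x * ?n y = exp (- (cmod (Complex x y))\<^sup>2) / pi" for x y
    by (simp add: normal_density_def cmod_power2 field_simps flip: exp_add)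
  interpret n: prob_space "density lborel ?n" by (rule prob_space_normal_density) simp
  have "density lborel (\<lambda>x. ennreal (?n x)) \<Otimes>\<^sub>M density lborel (\<lambda>x. ennreal (?n x)) =
      density (lborel \<Otimes>\<^sub>M lborel) (\<lambda>(x, y). ennreal (?n x) * ennreal (?n y))"
    by (intro pair_measure_density n.sigma_finite_measure_axioms lborel.sigma_finite_measure_axioms) auto
  also have "\<dots> = density (lborel \<Otimes>\<^sub>M lborel)
      (\<lambda>p. ennreal (exp (- (cmod ((\<lambda>(x, y). Complex x y) p))\<^sup>2) / pi))"
    by (intro arg_cong[where f = "density _"])
       (auto simp: fun_eq_iff n normal_density_nonneg simp flip: ennreal_mult)
  finally show ?thesis
    unfolding cgauss_def lborel_complex_eq by (subst density_distr) auto
qed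

lemma prob_space_cgauss: "prob_space cgauss"
proof -
  interpret n: prob_space "density lborel (normal_density 0 (sqrt (1 / 2)))"
    by (rule prob_space_normal_density) simp
  interpret pair_prob_space "density lborel (normal_density 0 (sqrt (1 / 2)))"
    "density lborel (normal_density 0 (sqrt (1 / 2)))" ..
  show ?thesis unfolding cgauss_eq_distr by (rule prob_space_distr) simp
qed

interpretation cgauss: prob_space cgauss by (rule prob_space_cgauss)

interpretation cgauss_prod: product_sigma_finite "\<lambda>_. cgauss"
  by (simp add: product_sigma_finite_def cgauss.sigma_finite_measure_axioms)

lemma prob_space_PiM_cgauss: "prob_space (PiM I (\<lambda>_. cgauss))"
  by (intro prob_space_PiM prob_space_cgauss)

lemma sets_PiM_cgauss [measurable_cong]: "sets (PiM I (\<lambda>_. cgauss)) = sets (bprod I)"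
  by (intro sets_PiM_cong) auto

lemma (in prob_space) distr_std_complex_gaussian:
  assumes "std_complex_gaussian X"
  shows "distr M borel X = cgauss" "X \<in> borel_measurable M"
proof -
  let ?n = "density lborel (normal_density 0 (sqrt (1 / 2)))"
  have ind: "indep_var borel (\<lambda>\<omega>. Re (X \<omega>)) borel (\<lambda>\<omega>. Im (X \<omega>))"
    and "distributed M lborel (\<lambda>\<omega>. Re (X \<omega>)) (normal_density 0 (sqrt (1 / 2)))"
    and "distributed M lborel (\<lambda>\<omega>. Im (X \<omega>)) (normal_density 0 (sqrt (1 / 2)))"
    using assms by (auto simp: std_complex_gaussian_def)
  then have re: "distr M borel (\<lambda>\<omega>. Re (X \<omega>)) = ?n" and im: "distr M borel (\<lambda>\<omega>. Im (X \<omega>)) = ?n"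
    by (auto simp: distributed_def cong: distr_cong)
  have [measurable]: "(\<lambda>\<omega>. Re (X \<omega>)) \<in> borel_measurable M" "(\<lambda>\<omega>. Im (X \<omega>)) \<in> borel_measurable M"
    using ind by (auto dest: indep_var_rv1 indep_var_rv2)
  have X: "X = (\<lambda>\<omega>. (\<lambda>(x, y). Complex x y) (Re (X \<omega>), Im (X \<omega>)))" by simp
  show meas: "X \<in> borel_measurable M" by (subst X) measurable
  have "?n \<Otimes>\<^sub>M ?n = distr M (borel \<Otimes>\<^sub>M borel) (\<lambda>\<omega>. (Re (X \<omega>), Im (X \<omega>)))"
    using ind unfolding indep_var_distribution_eq re im by blast
  then have "cgauss = distr (distr M (borel \<Otimes>\<^sub>M borel) (\<lambda>\<omega>. (Re (X \<omega>), Im (X \<omega>)))) borel (\<lambda>(x, y). Complex x y)"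
    unfolding cgauss_eq_distr by simp
  also have "\<dots> = distr M borel X" by (subst distr_distr) (auto simp: comp_def)
  finally show "distr M borel X = cgauss" by simp
qed

lemma nn_integral_cgauss:
  assumes [measurable]: "f \<in> borel_measurable borel"
  shows "(\<integral>\<^sup>+z. f z \<partial>cgauss) = (\<integral>\<^sup>+z. ennreal (exp (- (cmod z)\<^sup>2) / pi) * f z \<partial>lborel)"
  unfolding cgauss_def by (intro nn_integral_density) auto

section \<open>Rotations of two complex coordinates\<close>

lemma nn_integral_lborel_shift:
  fixes t :: complex
  assumes [measurable]: "f \<in> borel_measurable borel"
  shows "(\<integral>\<^sup>+z. f (z + t) \<partial>lborel) = (\<integral>\<^sup>+z. f z \<partial>lborel)"
proof -
  have "(\<integral>\<^sup>+z. f z \<partial>lborel) = (\<integral>\<^sup>+z. f z \<partial>distr lborel borel ((+) t))"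
    by (simp add: lborel_distr_plus)
  also have "\<dots> = (\<integral>\<^sup>+z. f (t + z) \<partial>lborel)" by (subst nn_integral_distr) auto
  finally show ?thesis by (simp add: add.commute)
qed

text \<open>A shear translates one coordinate by an amount fixed by the other. Translation
  invariance of the inner integral and, for the second equation, Fubini's theorem thus stand in for
  a change of variables under linear maps.\<close>

lemma nn_integral_shear:
  fixes y :: complex
  assumes [measurable]: "f \<in> borel_measurable (borel \<Otimes>\<^sub>M borel)"
  shows "(\<integral>\<^sup>+z. \<integral>\<^sup>+w. f (z, w + y * z) \<partial>lborel \<partial>lborel) = (\<integral>\<^sup>+z. \<integral>\<^sup>+w. f (z, w) \<partial>lborel \<partial>lborel)"
    and "(\<integral>\<^sup>+z. \<integral>\<^sup>+w. f (z + y * w, w) \<partial>lborel \<partial>lborel) = (\<integral>\<^sup>+z. \<integral>\<^sup>+w. f (z, w) \<partial>lborel \<partial>lborel)"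
proof -
  show "(\<integral>\<^sup>+z. \<integral>\<^sup>+w. f (z, w + y * z) \<partial>lborel \<partial>lborel) = (\<integral>\<^sup>+z. \<integral>\<^sup>+w. f (z, w) \<partial>lborel \<partial>lborel)"
    by (intro nn_integral_cong nn_integral_lborel_shift) measurable
  have "(\<integral>\<^sup>+z. \<integral>\<^sup>+w. f (z + y * w, w) \<partial>lborel \<partial>lborel) = (\<integral>\<^sup>+w. \<integral>\<^sup>+z. f (z + y * w, w) \<partial>lborel \<partial>lborel)"
    by (intro lborel_pair.Fubini'[symmetric]) measurable
  also have "\<dots> = (\<integral>\<^sup>+w. \<integral>\<^sup>+z. f (z, w) \<partial>lborel \<partial>lborel)"
    by (intro nn_integral_cong nn_integral_lborel_shift[where f = "\<lambda>z. f (z, _)"]) measurable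
  also have "\<dots> = (\<integral>\<^sup>+z. \<integral>\<^sup>+w. f (z, w) \<partial>lborel \<partial>lborel)"
    by (intro lborel_pair.Fubini') measurable
  finally show "(\<integral>\<^sup>+z. \<integral>\<^sup>+w. f (z + y * w, w) \<partial>lborel \<partial>lborel) = (\<integral>\<^sup>+z. \<integral>\<^sup>+w. f (z, w) \<partial>lborel \<partial>lborel)" .
qed

lemma rotation_cmod:
  assumes "(cmod a)\<^sup>2 + (cmod b)\<^sup>2 = 1"
  shows "(cmod (a * z + b * w))\<^sup>2 + (cmod (- cnj b * z + cnj a * w))\<^sup>2 = (cmod z)\<^sup>2 + (cmod w)\<^sup>2"
proof -
  have "complex_of_real ((cmod (a * z + b * w))\<^sup>2 + (cmod (- cnj b * z + cnj a * w))\<^sup>2) =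
      (a * cnj a + b * cnj b) * (z * cnj z + w * cnj w)"
    unfolding of_real_add complex_norm_square by (simp add: algebra_simps)
  also have "a * cnj a + b * cnj b = 1"
    using assms by (metis complex_norm_square of_real_1 of_real_add)
  also have "1 * (z * cnj z + w * cnj w) = complex_of_real ((cmod z)\<^sup>2 + (cmod w)\<^sup>2)"
    unfolding of_real_add complex_norm_square by simp
  finally show ?thesis by (simp only: of_real_eq_iff)
qed

text \<open>A matrix in \<open>SU(2)\<close> whose off-diagonal entries do not vanish is a product of three shears.\<close>

lemma nn_integral_lborel_rotation:
  fixes a b :: complex
  assumes [measurable]: "f \<in> borel_measurable (borel \<Otimes>\<^sub>M borel)"
    and ab: "(cmod a)\<^sup>2 + (cmod b)\<^sup>2 = 1" "b \<noteq> 0"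
  shows "(\<integral>\<^sup>+z. \<integral>\<^sup>+w. f (a * z + b * w, - cnj b * z + cnj a * w) \<partial>lborel \<partial>lborel) =
    (\<integral>\<^sup>+z. \<integral>\<^sup>+w. f (z, w) \<partial>lborel \<partial>lborel)"
proof -
  \<comment> \<open>The shears are \<open>z + x' w\<close>, then \<open>w + y z\<close>, then
    \<open>z + x w\<close>. The lower left entry of their product is \<open>y\<close>;
    \<open>x\<close> and \<open>x'\<close> are solved from the diagonal entries \<open>a\<close> and
    \<open>cnj a\<close>, and the upper right entry is then \<open>b\<close> because the determinant
    is 1.\<close>
  define y x x' where "y = - cnj b" and "x = (a - 1) / y" and "x' = (cnj a - 1) / y"
  have y: "y \<noteq> 0" using ab by (simp add: y_def)
  have "a * cnj a + b * cnj b = 1"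
    using ab by (metis complex_norm_square of_real_1 of_real_add)
  then have ab': "b * y = a * cnj a - 1" by (simp add: y_def algebra_simps)
  have 1: "z + x' * w + x * (w + y * (z + x' * w)) = a * z + b * w" for z w
  proof -
    have "x * y = a - 1" "1 + y * x' = cnj a" using y by (simp_all add: x_def x'_def)
    moreover have "x' + x * cnj a = b"
    proof -
      have "y * (x' + x * cnj a) = y * x' + y * x * cnj a" by (simp add: algebra_simps)
      also have "\<dots> = (cnj a - 1) + (a - 1) * cnj a" using y by (simp add: x_def x'_def)
      also have "\<dots> = y * b" using ab' by (simp add: algebra_simps)
      finally have "y * (x' + x * cnj a) = y * b" .
      then show ?thesis using y by simp
    qed
    moreover have "z + x' * w + x * (w + y * (z + x' * w)) = (1 + x * y) * z + (x' + x * (1 + y * x')) * w"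
      by (simp add: algebra_simps)
    ultimately show ?thesis by simp
  qed
  have 2: "w + y * (z + x' * w) = - cnj b * z + cnj a * w" for z w
    using y by (simp add: x'_def y_def field_simps)
  have "(\<integral>\<^sup>+z. \<integral>\<^sup>+w. f (z, w) \<partial>lborel \<partial>lborel) = (\<integral>\<^sup>+z. \<integral>\<^sup>+w. f (z + x * w, w) \<partial>lborel \<partial>lborel)"
    by (rule nn_integral_shear(2)[symmetric]) measurable
  also have "\<dots> = (\<integral>\<^sup>+z. \<integral>\<^sup>+w. f (z + x * (w + y * z), w + y * z) \<partial>lborel \<partial>lborel)"
    using nn_integral_shear(1)[of "\<lambda>(z, w). f (z + x * w, w)" y] by simp
  also have "\<dots> = (\<integral>\<^sup>+z. \<integral>\<^sup>+w. f (z + x' * w + x * (w + y * (z + x' * w)), w + y * (z + x' * w)) \<partial>lborel \<partial>lborel)"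
    using nn_integral_shear(2)[of "\<lambda>(z, w). f (z + x * (w + y * z), w + y * z)" x'] by simp
  finally show ?thesis unfolding 1 unfolding 2 by simp
qed

lemma nn_integral_cgauss_pair:
  assumes [measurable]: "f \<in> borel_measurable (borel \<Otimes>\<^sub>M borel)"
  shows "(\<integral>\<^sup>+z. \<integral>\<^sup>+w. f (z, w) \<partial>cgauss \<partial>cgauss) =
    (\<integral>\<^sup>+z. \<integral>\<^sup>+w. ennreal (exp (- ((cmod z)\<^sup>2 + (cmod w)\<^sup>2)) / pi\<^sup>2) * f (z, w) \<partial>lborel \<partial>lborel)"
proof -
  have "(\<integral>\<^sup>+z. \<integral>\<^sup>+w. f (z, w) \<partial>cgauss \<partial>cgauss) =
      (\<integral>\<^sup>+z. ennreal (exp (- (cmod z)\<^sup>2) / pi) * (\<integral>\<^sup>+w. ennreal (exp (- (cmod w)\<^sup>2) / pi) * f (z, w) \<partial>lborel) \<partial>lborel)"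
    by (simp add: nn_integral_cgauss)
  also have "\<dots> = (\<integral>\<^sup>+z. \<integral>\<^sup>+w. ennreal (exp (- (cmod z)\<^sup>2) / pi) * (ennreal (exp (- (cmod w)\<^sup>2) / pi) * f (z, w)) \<partial>lborel \<partial>lborel)"
    by (intro nn_integral_cong nn_integral_cmult[symmetric]) measurable
  also have "\<dots> = (\<integral>\<^sup>+z. \<integral>\<^sup>+w. ennreal (exp (- ((cmod z)\<^sup>2 + (cmod w)\<^sup>2)) / pi\<^sup>2) * f (z, w) \<partial>lborel \<partial>lborel)"
  proof (intro nn_integral_cong)
    fix z w :: complex
    have "exp (- ((cmod z)\<^sup>2 + (cmod w)\<^sup>2)) = exp (- (cmod z)\<^sup>2) * exp (- (cmod w)\<^sup>2)"
      by (simp flip: exp_add)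
    then have "exp (- ((cmod z)\<^sup>2 + (cmod w)\<^sup>2)) / pi\<^sup>2 =
        exp (- (cmod z)\<^sup>2) / pi * (exp (- (cmod w)\<^sup>2) / pi)"
      by (simp add: power2_eq_square)
    then have "ennreal (exp (- ((cmod z)\<^sup>2 + (cmod w)\<^sup>2)) / pi\<^sup>2) =
        ennreal (exp (- (cmod z)\<^sup>2) / pi) * ennreal (exp (- (cmod w)\<^sup>2) / pi)"
      by (simp only:) (rule ennreal_mult', simp)
    then show "ennreal (exp (- (cmod z)\<^sup>2) / pi) * (ennreal (exp (- (cmod w)\<^sup>2) / pi) * f (z, w)) =
        ennreal (exp (- ((cmod z)\<^sup>2 + (cmod w)\<^sup>2)) / pi\<^sup>2) * f (z, w)"
      by (simp only: mult.assoc)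
  qed
  finally show ?thesis .
qed

text \<open>The joint density depends on \<open>|z|^2 + |w|^2\<close> only, which rotations
  preserve.\<close>

lemma nn_integral_cgauss_rotation:
  fixes a b :: complex
  assumes f [measurable]: "f \<in> borel_measurable (borel \<Otimes>\<^sub>M borel)"
    and ab: "(cmod a)\<^sup>2 + (cmod b)\<^sup>2 = 1"
  shows "(\<integral>\<^sup>+z. \<integral>\<^sup>+w. f (a * z + b * w, - cnj b * z + cnj a * w) \<partial>cgauss \<partial>cgauss) =
    (\<integral>\<^sup>+z. \<integral>\<^sup>+w. f (z, w) \<partial>cgauss \<partial>cgauss)"
proof -
  have nz: "(\<integral>\<^sup>+z. \<integral>\<^sup>+w. f (a * z + b * w, - cnj b * z + cnj a * w) \<partial>cgauss \<partial>cgauss) =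
    (\<integral>\<^sup>+z. \<integral>\<^sup>+w. f (z, w) \<partial>cgauss \<partial>cgauss)"
    if [measurable]: "f \<in> borel_measurable (borel \<Otimes>\<^sub>M borel)"
      and ab: "(cmod a)\<^sup>2 + (cmod b)\<^sup>2 = 1" "b \<noteq> 0" for a b and f :: "complex \<times> complex \<Rightarrow> ennreal"
  proof -
    let ?h = "\<lambda>(z, w). ennreal (exp (- ((cmod z)\<^sup>2 + (cmod w)\<^sup>2)) / pi\<^sup>2) * f (z, w)"
    have "(\<integral>\<^sup>+z. \<integral>\<^sup>+w. f (a * z + b * w, - cnj b * z + cnj a * w) \<partial>cgauss \<partial>cgauss) =
        (\<integral>\<^sup>+z. \<integral>\<^sup>+w. ?h (a * z + b * w, - cnj b * z + cnj a * w) \<partial>lborel \<partial>lborel)"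
      using nn_integral_cgauss_pair[of "\<lambda>(z, w). f (a * z + b * w, - cnj b * z + cnj a * w)"]
      by (simp only: split_conv rotation_cmod[OF ab(1)]) simp
    also have "\<dots> = (\<integral>\<^sup>+z. \<integral>\<^sup>+w. ?h (z, w) \<partial>lborel \<partial>lborel)"
      by (rule nn_integral_lborel_rotation[OF _ ab]) measurable
    also have "\<dots> = (\<integral>\<^sup>+z. \<integral>\<^sup>+w. f (z, w) \<partial>cgauss \<partial>cgauss)"
      by (simp add: nn_integral_cgauss_pair)
    finally show ?thesis .
  qed
  show ?thesis
  proof (cases "b = 0")
    \<comment> \<open>A diagonal rotation is the composition of two antidiagonal ones,
      \<open>(a w, - cnj a z)\<close> and \<open>(- w, z)\<close>, and both have nonzero
      off-diagonal entries.\<close>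
    case True
    then have a: "(cmod a)\<^sup>2 + (cmod 0)\<^sup>2 = 1" "a \<noteq> 0" using ab by auto
    have "(\<integral>\<^sup>+z. \<integral>\<^sup>+w. f (z, w) \<partial>cgauss \<partial>cgauss) =
        (\<integral>\<^sup>+z. \<integral>\<^sup>+w. f (a * w, - cnj a * z) \<partial>cgauss \<partial>cgauss)"
      using nz[OF f, of 0 a] a by simp
    also have "\<dots> = (\<integral>\<^sup>+z. \<integral>\<^sup>+w. f (a * z, cnj a * w) \<partial>cgauss \<partial>cgauss)"
      using nz[of "\<lambda>(z, w). f (a * w, - cnj a * z)" 0 "- 1"] by simp
    finally show ?thesis using True by simp
  qed (use nz ab f in blast)
qed

text \<open>A phase is the rotation with entries \<open>u\<close> and 0, applied to a function of
  the first coordinate alone.\<close>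

lemma nn_integral_cgauss_phase:
  assumes [measurable]: "f \<in> borel_measurable borel" and u: "cmod u = 1"
  shows "(\<integral>\<^sup>+z. f (u * z) \<partial>cgauss) = (\<integral>\<^sup>+z. f z \<partial>cgauss)"
  using nn_integral_cgauss_rotation[of "\<lambda>(z, w). f z" u 0] u
  by (simp add: cgauss.emeasure_space_1[unfolded space_cgauss])

section \<open>Unitary invariance and exponential tilting\<close>

abbreviation gprod :: "'i set \<Rightarrow> ('i \<Rightarrow> complex) measure" where
  "gprod I \<equiv> PiM I (\<lambda>_. cgauss)"

lemma nn_integral_gprod_insert:
  assumes "finite I" "i \<notin> I" and [measurable]: "f \<in> borel_measurable (bprod (insert i I))"
  shows "(\<integral>\<^sup>+x. f x \<partial>gprod (insert i I)) = (\<integral>\<^sup>+x. \<integral>\<^sup>+z. f (x(i := z)) \<partial>cgauss \<partial>gprod I)"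
  using assms by (intro cgauss_prod.product_nn_integral_insert) auto

lemma measurable_fun_upd_borel [measurable (raw)]:
  assumes "f \<in> N \<rightarrow>\<^sub>M PiM I (\<lambda>_. borel :: complex measure)" "g \<in> borel_measurable N" "J = insert i I"
  shows "(\<lambda>x. (f x)(i := g x)) \<in> N \<rightarrow>\<^sub>M bprod J"
  using assms by (auto intro!: measurable_fun_upd)

lemma nn_integral_gprod_rotation:
  fixes a b :: complex
  assumes S: "finite S" "s \<in> S" "j \<in> S" "s \<noteq> j"
    and f [measurable]: "f \<in> borel_measurable (bprod S)"
    and ab: "(cmod a)\<^sup>2 + (cmod b)\<^sup>2 = 1"
  shows "(\<integral>\<^sup>+x. f (x(s := a * x s + b * x j, j := - cnj b * x s + cnj a * x j)) \<partial>gprod S) =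
    (\<integral>\<^sup>+x. f x \<partial>gprod S)"
proof -
  define T where "T = S - {s, j}"
  have S_eq: "S = insert s (insert j T)" and T: "finite T" "s \<notin> insert j T" "j \<notin> T"
    using S by (auto simp: T_def)
  have f' [measurable]: "f \<in> borel_measurable (bprod (insert s (insert j T)))"
    using f by (simp only: S_eq)
  have expand: "(\<integral>\<^sup>+x. g x \<partial>gprod S) =
      (\<integral>\<^sup>+x. \<integral>\<^sup>+w. \<integral>\<^sup>+z. g (x(j := w, s := z)) \<partial>cgauss \<partial>cgauss \<partial>gprod T)"
    if [measurable]: "g \<in> borel_measurable (bprod (insert s (insert j T)))" for g
    unfolding S_eq using T by (simp add: nn_integral_gprod_insert)
  have "(\<integral>\<^sup>+x. f (x(s := a * x s + b * x j, j := - cnj b * x s + cnj a * x j)) \<partial>gprod S) =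
      (\<integral>\<^sup>+x. \<integral>\<^sup>+w. \<integral>\<^sup>+z. f (x(j := - cnj b * z + cnj a * w, s := a * z + b * w)) \<partial>cgauss \<partial>cgauss \<partial>gprod T)"
    using S(4) by (subst expand) (simp_all add: fun_upd_twist[of s j] insert_commute)
  also have "\<dots> = (\<integral>\<^sup>+x. \<integral>\<^sup>+w. \<integral>\<^sup>+z. f (x(j := w, s := z)) \<partial>cgauss \<partial>cgauss \<partial>gprod T)"
  proof (rule nn_integral_cong)
    fix x assume "x \<in> space (gprod T)"
    then have const: "(\<lambda>_. x) \<in> borel \<Otimes>\<^sub>M borel \<rightarrow>\<^sub>M bprod T"
      by (intro measurable_const) (simp add: space_PiM)
    have "(\<lambda>p. f (x(j := fst p, s := snd p))) \<in> borel_measurable (borel \<Otimes>\<^sub>M borel)"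
      by (rule measurable_compose[OF measurable_fun_upd_borel[OF measurable_fun_upd_borel[OF const
        measurable_fst refl] measurable_snd refl] f'])
    then have meas: "(\<lambda>(w, z). f (x(j := w, s := z))) \<in> borel_measurable (borel \<Otimes>\<^sub>M borel)"
      by (simp only: case_prod_beta')
    \<comment> \<open>In \<open>expand\<close> the coordinate \<open>j\<close> is integrated outside
      of \<open>s\<close>, so the rotation acts on \<open>(w, z)\<close>; exchanging the coordinates
      turns \<open>a\<close> and \<open>b\<close> into \<open>cnj a\<close> and
      \<open>- cnj b\<close>.\<close>
    have ab': "(cmod (cnj a))\<^sup>2 + (cmod (- cnj b))\<^sup>2 = 1" using ab by simp
    have args: "cnj a * w + - cnj b * z = - cnj b * z + cnj a * w"
      "- cnj (- cnj b) * w + cnj (cnj a) * z = a * z + b * w" for w z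
      by simp_all
    show "(\<integral>\<^sup>+w. \<integral>\<^sup>+z. f (x(j := - cnj b * z + cnj a * w, s := a * z + b * w)) \<partial>cgauss \<partial>cgauss) =
        (\<integral>\<^sup>+w. \<integral>\<^sup>+z. f (x(j := w, s := z)) \<partial>cgauss \<partial>cgauss)"
      using nn_integral_cgauss_rotation[OF meas ab'] unfolding split_conv args .
  qed
  also have "\<dots> = (\<integral>\<^sup>+x. f x \<partial>gprod S)" by (simp add: expand)
  finally show ?thesis .
qed

definition lin_comb :: "'r set \<Rightarrow> 's set \<Rightarrow> ('r \<Rightarrow> 's \<Rightarrow> complex) \<Rightarrow> ('s \<Rightarrow> complex) \<Rightarrow> 'r \<Rightarrow> complex" where
  "lin_comb R S K x = (\<lambda>r\<in>R. \<Sum>s\<in>S. K r s * x s)"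

lemma measurable_lin_comb [measurable]:
  "lin_comb R S K \<in> bprod S \<rightarrow>\<^sub>M bprod R"
  unfolding lin_comb_def by measurable

definition orthonormal_rows :: "'r set \<Rightarrow> 's set \<Rightarrow> ('r \<Rightarrow> 's \<Rightarrow> complex) \<Rightarrow> bool" where
  "orthonormal_rows R S K \<longleftrightarrow>
     (\<forall>r\<in>R. \<forall>r'\<in>R. (\<Sum>s\<in>S. K r s * cnj (K r' s)) = (if r = r' then 1 else 0))"

text \<open>The rows are treated one after the other. Rotations in pairs of coordinates reduce a row to
  a single nonzero entry; by orthogonality, no other row involves the coordinate of that entry.\<close>

lemma nn_integral_orthonormal_rows:
  fixes K :: "'r \<Rightarrow> 's \<Rightarrow> complex"
  assumes "finite R" "finite S" "orthonormal_rows R S K"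
    and "f \<in> borel_measurable (bprod R)"
  shows "(\<integral>\<^sup>+x. f (lin_comb R S K x) \<partial>gprod S) = (\<integral>\<^sup>+y. f y \<partial>gprod R)"
  using assms
proof (induction R arbitrary: S K f rule: finite_induct)
  case empty
  interpret S: prob_space "gprod S" by (rule prob_space_PiM_cgauss)
  have "lin_comb {} S K x = (\<lambda>_. undefined)" for x by (auto simp: lin_comb_def)
  then show ?case by (simp add: S.emeasure_space_1 PiM_empty nn_integral_count_space_finite)
next
  case (insert i R)
  define supp where "supp K = {s \<in> S. K i s \<noteq> (0 :: complex)}" for K :: "'r \<Rightarrow> 's \<Rightarrow> complex"
  have "(\<integral>\<^sup>+x. f (lin_comb (insert i R) S K x) \<partial>gprod S) = (\<integral>\<^sup>+y. f y \<partial>gprod (insert i R))"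
    using insert.prems(2)
  \<comment> \<open>The inner induction is on the number of nonzero entries of row \<open>i\<close>;
    each rotation removes at least one of them.\<close>
  proof (induction "card (supp K)" arbitrary: K rule: less_induct)
    case less
    note rows = less.prems
    have fin: "finite (supp K)" using insert.prems(1) by (simp add: supp_def)
    show ?case
    proof (cases "\<exists>s \<in> supp K. \<exists>j \<in> supp K. s \<noteq> j")
      case True
      then obtain s j where sj: "s \<in> S" "j \<in> S" "s \<noteq> j" "K i s \<noteq> 0" "K i j \<noteq> 0"
        by (auto simp: supp_def)
      define m where "m = sqrt ((cmod (K i s))\<^sup>2 + (cmod (K i j))\<^sup>2)"
      define a b where "a = K i s / complex_of_real m" and "b = K i j / complex_of_real m"
      have "0 < (cmod (K i s))\<^sup>2 + (cmod (K i j))\<^sup>2"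
        using sj(4) by (intro add_pos_nonneg) auto
      then have m: "m > 0" unfolding m_def by (rule real_sqrt_gt_zero)
      have ab: "(cmod a)\<^sup>2 + (cmod b)\<^sup>2 = 1"
      proof -
        have "(cmod a)\<^sup>2 + (cmod b)\<^sup>2 = ((cmod (K i s))\<^sup>2 + (cmod (K i j))\<^sup>2) / m\<^sup>2"
          using m by (simp add: a_def b_def norm_divide power_divide add_divide_distrib)
        also have "\<dots> = 1" using m sj(4) by (simp add: m_def)
        finally show ?thesis .
      qed
      then have ab': "a * cnj a + b * cnj b = 1"
        by (metis complex_norm_square of_real_1 of_real_add)
      \<comment> \<open>\<open>K'\<close> is \<open>K\<close> composed with the inverse rotation, so
        \<open>K'\<close> at the rotated vector equals \<open>K\<close> at \<open>x\<close>;
        \<open>a\<close> and \<open>b\<close> are proportional to the two entries of row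
        \<open>i\<close>, which makes \<open>K' i j\<close> vanish.\<close>
      define K' where "K' r t = (if t = s then K r s * cnj a + K r j * cnj b
        else if t = j then - K r s * b + K r j * a else K r t)" for r t
      have split: "(\<Sum>t\<in>S. g t) = g s + g j + (\<Sum>t\<in>S - {s, j}. g t)" for g :: "'s \<Rightarrow> complex"
      proof -
        have "sum g (insert s (insert j (S - {s, j}))) = g s + (g j + sum g (S - {s, j}))"
          using sj(3) insert.prems(1) by simp
        moreover have "insert s (insert j (S - {s, j})) = S" using sj by auto
        ultimately show ?thesis by (simp only: add.assoc)
      qed
      have "orthonormal_rows (insert i R) S K'"
        unfolding orthonormal_rows_def
      proof (intro ballI)
        fix r r' assume r: "r \<in> insert i R" "r' \<in> insert i R"
        have "K' r s * cnj (K' r' s) + K' r j * cnj (K' r' j) =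
            (a * cnj a + b * cnj b) * (K r s * cnj (K r' s) + K r j * cnj (K r' j))"
          using sj(3) by (simp add: K'_def algebra_simps)
        moreover have "(\<Sum>t\<in>S - {s, j}. K' r t * cnj (K' r' t)) = (\<Sum>t\<in>S - {s, j}. K r t * cnj (K r' t))"
          by (intro sum.cong) (auto simp: K'_def)
        ultimately have "(\<Sum>t\<in>S. K' r t * cnj (K' r' t)) = (\<Sum>t\<in>S. K r t * cnj (K r' t))"
          unfolding split[of "\<lambda>t. K' r t * cnj (K' r' t)"] split[of "\<lambda>t. K r t * cnj (K r' t)"] ab' by simp
        then show "(\<Sum>t\<in>S. K' r t * cnj (K' r' t)) = (if r = r' then 1 else 0)"
          using rows[unfolded orthonormal_rows_def, rule_format, OF r] by (rule trans)
      qed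
      moreover have "card (supp K') < card (supp K)"
      proof (intro psubset_card_mono fin psubsetI)
        have "K' i j = 0" using sj m by (simp add: K'_def a_def b_def)
        then show "supp K' \<noteq> supp K" using sj by (auto simp: supp_def)
        show "supp K' \<subseteq> supp K" using sj \<open>K' i j = 0\<close> by (auto simp: supp_def K'_def split: if_splits)
      qed
      ultimately have "(\<integral>\<^sup>+x. f (lin_comb (insert i R) S K' x) \<partial>gprod S) = (\<integral>\<^sup>+y. f y \<partial>gprod (insert i R))"
        by (intro less.hyps)
      moreover have "lin_comb (insert i R) S K' (x(s := a * x s + b * x j, j := - cnj b * x s + cnj a * x j)) =
          lin_comb (insert i R) S K x" (is "lin_comb _ _ _ ?y = _") for x
      proof -
        have "(\<Sum>t\<in>S. K' r t * ?y t) = (\<Sum>t\<in>S. K r t * x t)" for r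
        proof -
          have "K' r s * ?y s + K' r j * ?y j = (a * cnj a + b * cnj b) * (K r s * x s + K r j * x j)"
            using sj(3) by (simp add: K'_def algebra_simps)
          moreover have "(\<Sum>t\<in>S - {s, j}. K' r t * ?y t) = (\<Sum>t\<in>S - {s, j}. K r t * x t)"
            by (intro sum.cong) (auto simp: K'_def)
          ultimately show ?thesis
            unfolding split[of "\<lambda>t. K' r t * ?y t"] split[of "\<lambda>t. K r t * x t"] ab' by simp
        qed
        then show ?thesis by (simp add: lin_comb_def)
      qed
      moreover have "(\<lambda>x. f (lin_comb (insert i R) S K' x)) \<in> borel_measurable (bprod S)"
        using insert.prems(3) by measurable
      note nn_integral_gprod_rotation[OF insert.prems(1) sj(1-3) this ab]
      ultimately show ?thesis by simp
    next
      case False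
      have norm: "(\<Sum>s\<in>S. K i s * cnj (K i s)) = 1" using rows by (auto simp: orthonormal_rows_def)
      then obtain s where s: "s \<in> S" "K i s \<noteq> 0"
        by (metis (no_types, lifting) mult_zero_left sum.neutral zero_neq_one)
      have z: "K i t = 0" if "t \<in> S" "t \<noteq> s" for t
        using False that s by (auto simp: supp_def)
      define T where "T = S - {s}"
      have S_eq: "S = insert s T" and T: "finite T" "s \<notin> T"
        using s insert.prems(1) by (auto simp: T_def)
      have row: "(\<Sum>t\<in>S. g t * cnj (K i t)) = g s * cnj (K i s)" for g
      proof -
        have "(\<Sum>t\<in>T. g t * cnj (K i t)) = 0"
          using z by (intro sum.neutral) (auto simp: T_def)
        then show ?thesis using T unfolding S_eq by simp
      qed
      have u: "cmod (K i s) = 1"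
      proof -
        have "complex_of_real ((cmod (K i s))\<^sup>2) = 1"
          using norm unfolding row complex_norm_square .
        then have "(cmod (K i s))\<^sup>2 = 1" by (simp only: of_real_eq_1_iff)
        then show ?thesis using norm_ge_zero[of "K i s"] by (simp add: power2_eq_1_iff)
      qed
      \<comment> \<open>Row \<open>i\<close> is now supported at \<open>s\<close> alone, so
        orthogonality to it forces \<open>K r s\<close> to vanish, and the coordinate
        \<open>s\<close> can be integrated separately.\<close>
      have zr: "K r s = 0" if r: "r \<in> R" for r
      proof -
        have "(\<Sum>t\<in>S. K r t * cnj (K i t)) = 0"
          using rows r insert.hyps(2) by (auto simp: orthonormal_rows_def)
        then show ?thesis using s unfolding row by simp
      qed
      have rowsR: "orthonormal_rows R T K"
        using rows T zr unfolding orthonormal_rows_def S_eq by auto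
      have upd: "lin_comb (insert i R) S K (x(s := w)) = (lin_comb R T K x)(i := K i s * w)" for x w
      proof (rule ext)
        fix r
        have "(\<Sum>t\<in>T. K i t * (x(s := w)) t) = 0"
          using z by (intro sum.neutral) (auto simp: T_def)
        moreover have "(\<Sum>t\<in>T. K r t * (x(s := w)) t) = (\<Sum>t\<in>T. K r t * x t)"
          by (intro sum.cong) (auto simp: T_def)
        ultimately show "lin_comb (insert i R) S K (x(s := w)) r = ((lin_comb R T K x)(i := K i s * w)) r"
          using T zr[of r] insert.hyps(2) unfolding S_eq by (auto simp: lin_comb_def simp del: fun_upd_apply) 
            (auto simp: lin_comb_def)
      qed
      have [measurable]: "f \<in> borel_measurable (bprod (insert i R))" by (rule insert.prems(3))
      have "(\<integral>\<^sup>+x. f (lin_comb (insert i R) S K x) \<partial>gprod S) =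
          (\<integral>\<^sup>+x. \<integral>\<^sup>+w. f ((lin_comb R T K x)(i := K i s * w)) \<partial>cgauss \<partial>gprod T)"
        using nn_integral_gprod_insert[OF T, of "\<lambda>x. f (lin_comb (insert i R) S K x)"]
        unfolding upd unfolding S_eq by simp
      also have "\<dots> = (\<integral>\<^sup>+x. \<integral>\<^sup>+w. f ((lin_comb R T K x)(i := w)) \<partial>cgauss \<partial>gprod T)"
      proof (rule nn_integral_cong)
        fix x assume "x \<in> space (gprod T)"
        then have const: "(\<lambda>_. lin_comb R T K x) \<in> borel \<rightarrow>\<^sub>M bprod R"
          by (intro measurable_const) (simp add: space_PiM lin_comb_def)
        have meas: "(\<lambda>w. f ((lin_comb R T K x)(i := w))) \<in> borel_measurable borel"
          by (rule measurable_compose[OF measurable_fun_upd_borel[OF const measurable_ident_sets[OF refl] refl] insert.prems(3)])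
        show "(\<integral>\<^sup>+w. f ((lin_comb R T K x)(i := K i s * w)) \<partial>cgauss) = (\<integral>\<^sup>+w. f ((lin_comb R T K x)(i := w)) \<partial>cgauss)"
          by (rule nn_integral_cgauss_phase[OF meas u])
      qed
      also have "\<dots> = (\<integral>\<^sup>+y. \<integral>\<^sup>+w. f (y(i := w)) \<partial>cgauss \<partial>gprod R)"
        by (rule insert.IH[OF T(1) rowsR]) measurable
      also have "\<dots> = (\<integral>\<^sup>+y. f y \<partial>gprod (insert i R))"
        using insert.hyps by (subst nn_integral_gprod_insert) auto
      finally show ?thesis .
    qed
  qed
  then show ?case .
qed

text \<open>The weighted density is \<open>exp (- |z / 2|^2) / pi\<close>; substituting
  \<open>2 * z\<close> for \<open>z\<close> in the plane produces the Jacobian 4.\<close>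

lemma nn_integral_cgauss_tilt:
  assumes [measurable]: "f \<in> borel_measurable borel"
  shows "(\<integral>\<^sup>+z. f z * ennreal (exp (3 / 4 * (cmod z)\<^sup>2)) \<partial>cgauss) = 4 * (\<integral>\<^sup>+z. f (2 * z) \<partial>cgauss)"
proof -
  have "(\<integral>\<^sup>+z. f z * ennreal (exp (3 / 4 * (cmod z)\<^sup>2)) \<partial>cgauss) =
      (\<integral>\<^sup>+z. ennreal (exp (- (cmod z)\<^sup>2) / pi) * (f z * ennreal (exp (3 / 4 * (cmod z)\<^sup>2))) \<partial>lborel)"
    by (rule nn_integral_cgauss) measurable
  also have "\<dots> = (\<integral>\<^sup>+z. ennreal (exp (- ((cmod z)\<^sup>2 / 4)) / pi) * f z \<partial>lborel)"
  proof (rule nn_integral_cong)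
    fix z :: complex
    have "exp (- ((cmod z)\<^sup>2 / 4)) / pi = exp (- (cmod z)\<^sup>2) / pi * exp (3 / 4 * (cmod z)\<^sup>2)"
      by (simp flip: exp_add)
    then have "ennreal (exp (- ((cmod z)\<^sup>2 / 4)) / pi) =
        ennreal (exp (- (cmod z)\<^sup>2) / pi) * ennreal (exp (3 / 4 * (cmod z)\<^sup>2))"
      by (simp only:) (rule ennreal_mult', simp)
    then show "ennreal (exp (- (cmod z)\<^sup>2) / pi) * (f z * ennreal (exp (3 / 4 * (cmod z)\<^sup>2))) =
        ennreal (exp (- ((cmod z)\<^sup>2 / 4)) / pi) * f z"
      by (simp only: mult_ac)
  qed
  also have "\<dots> = (\<integral>\<^sup>+z. ennreal (exp (- ((cmod z)\<^sup>2 / 4)) / pi) * f z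
      \<partial>density (distr lborel borel (\<lambda>x. 0 + 2 *\<^sub>R x)) (\<lambda>_. \<bar>2\<bar> ^ DIM(complex)))"
    using lborel_affine[of 2 "0 :: complex"] by simp
  also have "\<dots> = (\<integral>\<^sup>+z. 4 * (ennreal (exp (- (cmod z)\<^sup>2) / pi) * f (2 * z)) \<partial>lborel)"
    by (subst nn_integral_density, simp, simp, subst nn_integral_distr)
       (auto simp: scaleR_conv_of_real norm_mult power_mult_distrib)
  also have "\<dots> = 4 * (\<integral>\<^sup>+z. f (2 * z) \<partial>cgauss)"
    by (simp add: nn_integral_cmult nn_integral_cgauss)
  finally show ?thesis .
qed

text \<open>The weight is a product over the coordinates, so each contributes its own factor 4 and
  its own doubling.\<close>

lemma nn_integral_gprod_tilt:
  assumes "finite J" "f \<in> borel_measurable (bprod J)"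
  shows "(\<integral>\<^sup>+x. f x * ennreal (exp (3 / 4 * (\<Sum>j\<in>J. (cmod (x j))\<^sup>2))) \<partial>gprod J) =
    4 ^ card J * (\<integral>\<^sup>+x. f (\<lambda>j\<in>J. 2 * x j) \<partial>gprod J)"
  using assms
proof (induction J arbitrary: f rule: finite_induct)
  case empty
  have "(\<lambda>j\<in>{}. 2 * x j) = (\<lambda>_. undefined)" for x :: "'a \<Rightarrow> complex" by auto
  then show ?case by (simp add: PiM_empty nn_integral_count_space_finite)
next
  case (insert i J)
  note [measurable] = insert.prems
  let ?e = "\<lambda>x. ennreal (exp (3 / 4 * (\<Sum>j\<in>J. (cmod (x j))\<^sup>2)))"
  have e: "ennreal (exp (3 / 4 * (\<Sum>j\<in>insert i J. (cmod ((x(i := z)) j))\<^sup>2))) =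
      ennreal (exp (3 / 4 * (cmod z)\<^sup>2)) * ?e x" for x z
  proof -
    have "(\<Sum>j\<in>insert i J. (cmod ((x(i := z)) j))\<^sup>2) = (cmod z)\<^sup>2 + (\<Sum>j\<in>J. (cmod (x j))\<^sup>2)"
      using insert.hyps by (auto intro!: sum.cong)
    then show ?thesis by (simp add: distrib_left exp_add ennreal_mult')
  qed
  have x_meas: "(\<lambda>_. x) \<in> borel \<rightarrow>\<^sub>M bprod J" if "x \<in> space (gprod J)" for x
    using that by (intro measurable_const) (simp add: space_PiM)
  have "(\<integral>\<^sup>+x. f x * ennreal (exp (3 / 4 * (\<Sum>j\<in>insert i J. (cmod (x j))\<^sup>2))) \<partial>gprod (insert i J)) =
      (\<integral>\<^sup>+x. \<integral>\<^sup>+z. f (x(i := z)) * (ennreal (exp (3 / 4 * (cmod z)\<^sup>2)) * ?e x) \<partial>cgauss \<partial>gprod J)"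
    unfolding e[symmetric] using insert.hyps by (intro nn_integral_gprod_insert) measurable
  also have "\<dots> = (\<integral>\<^sup>+x. 4 * (\<integral>\<^sup>+z. f (x(i := 2 * z)) \<partial>cgauss) * ?e x \<partial>gprod J)"
  proof (rule nn_integral_cong)
    fix x assume x: "x \<in> space (gprod J)"
    have [measurable]: "(\<lambda>z. f (x(i := z))) \<in> borel_measurable borel"
      by (rule measurable_compose[OF measurable_fun_upd_borel[OF x_meas[OF x] measurable_ident_sets[OF refl] refl] insert.prems])
    have "(\<integral>\<^sup>+z. f (x(i := z)) * (ennreal (exp (3 / 4 * (cmod z)\<^sup>2)) * ?e x) \<partial>cgauss) =
        (\<integral>\<^sup>+z. (f (x(i := z)) * ennreal (exp (3 / 4 * (cmod z)\<^sup>2))) * ?e x \<partial>cgauss)"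
      by (simp only: mult.assoc)
    also have "\<dots> = (\<integral>\<^sup>+z. f (x(i := z)) * ennreal (exp (3 / 4 * (cmod z)\<^sup>2)) \<partial>cgauss) * ?e x"
      by (rule nn_integral_multc) measurable
    also have "(\<integral>\<^sup>+z. f (x(i := z)) * ennreal (exp (3 / 4 * (cmod z)\<^sup>2)) \<partial>cgauss) =
        4 * (\<integral>\<^sup>+z. f (x(i := 2 * z)) \<partial>cgauss)"
      by (rule nn_integral_cgauss_tilt) measurable
    finally show "(\<integral>\<^sup>+z. f (x(i := z)) * (ennreal (exp (3 / 4 * (cmod z)\<^sup>2)) * ?e x) \<partial>cgauss) =
        4 * (\<integral>\<^sup>+z. f (x(i := 2 * z)) \<partial>cgauss) * ?e x" .
  qed
  also have "\<dots> = 4 ^ card J * (\<integral>\<^sup>+x. 4 * (\<integral>\<^sup>+z. f ((\<lambda>j\<in>J. 2 * x j)(i := 2 * z)) \<partial>cgauss) \<partial>gprod J)"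
    by (rule insert.IH) measurable
  also have "\<dots> = 4 ^ card (insert i J) * (\<integral>\<^sup>+x. \<integral>\<^sup>+z. f ((\<lambda>j\<in>J. 2 * x j)(i := 2 * z)) \<partial>cgauss \<partial>gprod J)"
    using insert.hyps by (subst nn_integral_cmult) (measurable, simp add: mult_ac)
  also have "(\<integral>\<^sup>+x. \<integral>\<^sup>+z. f ((\<lambda>j\<in>J. 2 * x j)(i := 2 * z)) \<partial>cgauss \<partial>gprod J) =
      (\<integral>\<^sup>+x. f (\<lambda>j\<in>insert i J. 2 * x j) \<partial>gprod (insert i J))"
  proof -
    have upd: "(\<lambda>j\<in>J. 2 * x j)(i := 2 * z) = (\<lambda>j\<in>insert i J. 2 * (x(i := z)) j)" for x and z :: complex
      using insert.hyps by (auto simp: fun_eq_iff)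
    show ?thesis
      unfolding upd using insert.hyps by (intro nn_integral_gprod_insert[symmetric]) measurable
  qed
  finally show ?case .
qed

text \<open>The Gaussian density is positive everywhere, so its null sets are Lebesgue null, and a
  nonempty open set is not.\<close>

lemma cgauss_open_pos:
  assumes "open U" "U \<noteq> {}"
  shows "0 < cgauss.prob U"
proof -
  have U [measurable]: "U \<in> sets borel" using assms(1) by simp
  have "emeasure cgauss U \<noteq> 0"
  proof
    assume "emeasure cgauss U = 0"
    then have "U \<in> null_sets cgauss" using U by (simp add: null_sets_def)
    then have "AE z in lborel. z \<notin> U"
      unfolding cgauss_def by (subst (asm) null_sets_density_iff) (auto elim!: eventually_mono)
    then have "U \<in> null_sets lborel" using U by (subst AE_iff_null_sets) auto
    then have "negligible U" by (simp add: negligible_iff_null_sets null_sets_completionI)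
    then show False using assms open_not_negligible by blast
  qed
  then show ?thesis
    by (simp add: cgauss.emeasure_eq_measure less_le)
qed

lemma AE_cgauss_neq: "AE z in cgauss. z \<noteq> c"
proof -
  have "AE z in lborel. z \<noteq> c" using AE_lborel_singleton by auto
  then show ?thesis unfolding cgauss_def by (subst AE_density) (auto elim!: eventually_mono)
qed

section \<open>Resampling coordinates and measurability of matrix functions\<close>

lemma distr_gprod_restrict:
  assumes "J \<subseteq> I"
  shows "distr (gprod I) (bprod J) (\<lambda>x. restrict x J) = gprod J"
proof -
  have "distr (gprod I) (bprod J) (\<lambda>x. restrict x J) = distr (gprod I) (gprod J) (\<lambda>x. \<lambda>j\<in>J. x j)"
    by (intro distr_cong) (auto simp: sets_PiM_cgauss)
  also have "\<dots> = gprod J"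
    using distr_PiM_reindex[of I "\<lambda>_. cgauss" "\<lambda>i. i" J] assms prob_space_cgauss by auto
  finally show ?thesis .
qed

text \<open>The coordinates inside and outside \<open>J\<close> are independent, so those in
  \<open>J\<close> may be replaced by a fresh copy. The outer integral still runs over the whole
  space, whose index set may be infinite, so a function that ignores \<open>J\<close> keeps its
  argument.\<close>

lemma nn_integral_gprod_resample:
  assumes "I \<noteq> {}" and J: "J \<subseteq> I" and f [measurable]: "f \<in> borel_measurable (bprod I)"
  shows "(\<integral>\<^sup>+x. f x \<partial>gprod I) = (\<integral>\<^sup>+x. \<integral>\<^sup>+z. f (merge (I - J) J (x, z)) \<partial>gprod J \<partial>gprod I)"
proof -
  interpret I: prob_space "gprod I" by (rule prob_space_PiM_cgauss)
  interpret J: prob_space "gprod J" by (rule prob_space_PiM_cgauss)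
  let ?A = "bprod (I - J) :: ('a \<Rightarrow> complex) measure"
  let ?B = "bprod J :: ('a \<Rightarrow> complex) measure"
  have un: "I - J \<union> J = I" using J by auto
  have merge [measurable]: "merge (I - J) J \<in> ?A \<Otimes>\<^sub>M ?B \<rightarrow>\<^sub>M bprod I"
    using measurable_merge[of "I - J" J "\<lambda>_. borel"] by (simp only: un)
  have indep: "I.indep_vars (\<lambda>_. borel) (\<lambda>i x. x i) I"
  proof (subst I.indep_vars_iff_distr_eq_PiM'[OF \<open>I \<noteq> {}\<close>])
    fix i assume i: "i \<in> I"
    then show "(\<lambda>x. x i) \<in> borel_measurable (gprod I)" by measurable
  next
    have "distr (gprod I) borel (\<lambda>x. x i) = cgauss" if "i \<in> I" for i
    proof -
      have "distr (gprod I) borel (\<lambda>x. x i) = distr (gprod I) cgauss (\<lambda>x. x i)"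
        by (intro distr_cong) auto
      then show ?thesis using distr_PiM_component[of I "\<lambda>_. cgauss" i] that prob_space_cgauss by simp
    qed
    then have "(PiM I (\<lambda>i. distr (gprod I) borel (\<lambda>x. x i))) = gprod I"
      by (intro PiM_cong) auto
    then show "distr (gprod I) (bprod I) (\<lambda>x. \<lambda>i\<in>I. x i) = PiM I (\<lambda>i. distr (gprod I) borel (\<lambda>x. x i))"
      using distr_gprod_restrict[of I I] by simp
  qed
  have "I.indep_var ?A (\<lambda>x. restrict x (I - J)) ?B (\<lambda>x. restrict x J)"
    using J by (intro I.indep_var_restrict[OF indep]) auto
  then have joint: "distr (gprod I) (?A \<Otimes>\<^sub>M ?B) (\<lambda>x. (restrict x (I - J), restrict x J)) =
      distr (gprod I) ?A (\<lambda>x. restrict x (I - J)) \<Otimes>\<^sub>M gprod J"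
    using J by (simp add: I.indep_var_distribution_eq distr_gprod_restrict)
  have [measurable]: "(\<lambda>x. restrict x (I - J)) \<in> gprod I \<rightarrow>\<^sub>M ?A" "(\<lambda>x. restrict x J) \<in> gprod I \<rightarrow>\<^sub>M ?B"
    using J by (auto intro!: measurable_restrict measurable_component_singleton cong: measurable_cong_sets)
  have "(\<integral>\<^sup>+x. f x \<partial>gprod I) = (\<integral>\<^sup>+x. f (merge (I - J) J (restrict x (I - J), restrict x J)) \<partial>gprod I)"
  proof (rule nn_integral_cong)
    fix x assume "x \<in> space (gprod I)"
    then have "merge (I - J) J (restrict x (I - J), restrict x J) = x"
      using J by (auto simp: merge_def space_PiM PiE_def extensional_def fun_eq_iff)
    then show "f x = f (merge (I - J) J (restrict x (I - J), restrict x J))" by simp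
  qed
  also have "\<dots> = (\<integral>\<^sup>+p. f (merge (I - J) J p) \<partial>(distr (gprod I) ?A (\<lambda>x. restrict x (I - J)) \<Otimes>\<^sub>M gprod J))"
    unfolding joint[symmetric] by (subst nn_integral_distr) auto
  also have "\<dots> = (\<integral>\<^sup>+y. \<integral>\<^sup>+z. f (merge (I - J) J (y, z)) \<partial>gprod J \<partial>distr (gprod I) ?A (\<lambda>x. restrict x (I - J)))"
    by (subst J.nn_integral_fst[symmetric]) (auto cong: measurable_cong_sets)
  also have "\<dots> = (\<integral>\<^sup>+x. \<integral>\<^sup>+z. f (merge (I - J) J (restrict x (I - J), z)) \<partial>gprod J \<partial>gprod I)"
    by (subst nn_integral_distr) auto
  finally show ?thesis by simp
qed

text \<open>The instances are the measurable functions and the functions continuous on a set.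
  Closure under products, determinants, adjugates and traces of matrices is thus proved once, for
  measurability and for the continuity of the chordal distance.\<close>

locale fun_algebra =
  fixes A :: "('x \<Rightarrow> complex) set"
  assumes const: "(\<lambda>_. c) \<in> A"
    and add: "f \<in> A \<Longrightarrow> g \<in> A \<Longrightarrow> (\<lambda>x. f x + g x) \<in> A"
    and mult: "f \<in> A \<Longrightarrow> g \<in> A \<Longrightarrow> (\<lambda>x. f x * g x) \<in> A"
    and cnj: "f \<in> A \<Longrightarrow> (\<lambda>x. cnj (f x)) \<in> A"
begin

lemma sum_in: "(\<And>i. i \<in> I \<Longrightarrow> f i \<in> A) \<Longrightarrow> (\<lambda>x. \<Sum>i\<in>I. f i x) \<in> A"
  by (induction I rule: infinite_finite_induct) (auto intro: const add)

lemma prod_in: "(\<And>i. i \<in> I \<Longrightarrow> f i \<in> A) \<Longrightarrow> (\<lambda>x. \<Prod>i\<in>I. f i x) \<in> A"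
  by (induction I rule: infinite_finite_induct) (auto intro: const mult)

definition mat_in :: "nat \<Rightarrow> nat \<Rightarrow> ('x \<Rightarrow> complex mat) \<Rightarrow> bool" where
  "mat_in n m f \<longleftrightarrow> (\<forall>x. f x \<in> carrier_mat n m) \<and> (\<forall>i<n. \<forall>j<m. (\<lambda>x. f x $$ (i, j)) \<in> A)"

lemma mat_in_dims: "mat_in n m f \<Longrightarrow> dim_row (f x) = n" "mat_in n m f \<Longrightarrow> dim_col (f x) = m"
  by (auto simp: mat_in_def)

lemma mat_in_entry: "mat_in n m f \<Longrightarrow> i < n \<Longrightarrow> j < m \<Longrightarrow> (\<lambda>x. f x $$ (i, j)) \<in> A"
  by (auto simp: mat_in_def)

lemma mat_inI:
  assumes "\<And>x. dim_row (f x) = n" "\<And>x. dim_col (f x) = m"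
    and "\<And>i j. i < n \<Longrightarrow> j < m \<Longrightarrow> (\<lambda>x. f x $$ (i, j)) \<in> A"
  shows "mat_in n m f"
  using assms by (auto simp: mat_in_def)

lemma mat_in_const: "C \<in> carrier_mat n m \<Longrightarrow> mat_in n m (\<lambda>_. C)"
  by (intro mat_inI) (auto intro: const)

lemma mat_in_adjoint:
  assumes f: "mat_in n m f"
  shows "mat_in m n (\<lambda>x. mat_adjoint (f x))"
  by (intro mat_inI) (auto simp: mat_in_dims[OF f] intro!: cnj mat_in_entry[OF f])

lemma mat_in_add:
  assumes f: "mat_in n m f" and g: "mat_in n m g"
  shows "mat_in n m (\<lambda>x. f x + g x)"
  by (intro mat_inI) (auto simp: mat_in_dims[OF f] mat_in_dims[OF g] intro!: add mat_in_entry[OF f] mat_in_entry[OF g])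

lemma mat_in_smult:
  assumes f: "mat_in n m f" and c: "c \<in> A"
  shows "mat_in n m (\<lambda>x. c x \<cdot>\<^sub>m f x)"
  by (intro mat_inI) (auto simp: mat_in_dims[OF f] intro!: mult c mat_in_entry[OF f])

lemma mat_in_mult:
  assumes f: "mat_in n m f" and g: "mat_in m k g"
  shows "mat_in n k (\<lambda>x. f x * g x)"
proof (intro mat_inI)
  fix i j assume ij: "i < n" "j < k"
  have "(\<lambda>x. (f x * g x) $$ (i, j)) = (\<lambda>x. \<Sum>l<m. f x $$ (i, l) * g x $$ (l, j))"
    using ij by (auto simp: fun_eq_iff mat_in_dims[OF f] mat_in_dims[OF g] scalar_prod_def atLeast0LessThan)
  then show "(\<lambda>x. (f x * g x) $$ (i, j)) \<in> A"
    using ij by (auto intro!: sum_in mult mat_in_entry[OF f] mat_in_entry[OF g])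
qed (auto simp: mat_in_dims[OF f] mat_in_dims[OF g])

lemma det_in:
  assumes f: "mat_in n n f"
  shows "(\<lambda>x. det (f x)) \<in> A"
proof -
  have "(\<lambda>x. det (f x)) = (\<lambda>x. \<Sum>p | p permutes {0..<n}. signof p * (\<Prod>i = 0..<n. f x $$ (i, p i)))"
    using f by (auto simp: fun_eq_iff mat_in_def det_def')
  moreover have "(\<lambda>x. f x $$ (i, p i)) \<in> A" if "p permutes {0..<n}" "i \<in> {0..<n}" for p i
    using that permutes_in_image[of p "{0..<n}" i] by (intro mat_in_entry[OF f]) auto
  ultimately show ?thesis by (auto intro!: sum_in mult const prod_in)
qed

lemma mat_in_adj_mat:
  assumes f: "mat_in n n f"
  shows "mat_in n n (\<lambda>x. adj_mat (f x))"
proof (intro mat_inI)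
  fix i j assume ij: "i < n" "j < n"
  have "mat_in (n - 1) (n - 1) (\<lambda>x. mat_delete (f x) j i)"
    using ij by (intro mat_inI) (auto simp: mat_in_dims[OF f] mat_delete_def intro!: mat_in_entry[OF f])
  from det_in[OF this] have "(\<lambda>x. cofactor (f x) j i) \<in> A"
    unfolding cofactor_def by (intro mult const)
  then show "(\<lambda>x. adj_mat (f x) $$ (i, j)) \<in> A"
    using ij by (simp add: adj_mat_def mat_in_dims[OF f])
qed (auto simp: mat_in_dims[OF f])

text \<open>The reciprocal determinant is a premise of its own: measurability survives inversion
  everywhere, continuity only where the determinant is nonzero.\<close>

lemma mat_in_colproj:
  assumes f: "mat_in n m f" and inv: "(\<lambda>x. inverse (det (mat_adjoint (f x) * f x))) \<in> A"
  shows "mat_in n n (\<lambda>x. colproj (f x))"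
  unfolding colproj_def
  by (intro mat_in_smult inv mat_in_mult[of n m] mat_in_mult[of m n] mat_in_mult[of n m _ m] mat_in_adj_mat mat_in_adjoint f)

lemma trace_in:
  assumes f: "mat_in n n f"
  shows "(\<lambda>x. mat_trace (f x)) \<in> A"
  unfolding mat_trace_def by (auto simp: mat_in_dims[OF f] intro!: sum_in mat_in_entry[OF f])

end

lemma fun_algebra_measurable: "fun_algebra (borel_measurable N)"
proof
  have "(cnj :: complex \<Rightarrow> complex) \<in> borel_measurable borel"
    by (intro borel_measurable_continuous_onI continuous_intros)
  then show "(\<lambda>x. cnj (f x)) \<in> borel_measurable N" if "f \<in> borel_measurable N" for f
    using measurable_compose[OF that] by blast
qed auto

lemma fun_algebra_continuous: "fun_algebra {f. continuous_on S f}"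
  by unfold_locales (auto intro!: continuous_intros)

text \<open>Only the diagonal is random. Expansion along the last row makes the determinant affine
  in the last diagonal entry, with the smaller determinant as slope; the slope is almost surely
  nonzero by induction, and the Gaussian law has no atoms.\<close>

lemma nn_integral_det_diag_zero:
  fixes e :: "nat \<Rightarrow> 'i" and C :: "nat \<Rightarrow> nat \<Rightarrow> complex"
  assumes "inj_on e {..<n}"
  shows "(\<integral>\<^sup>+z. indicator {0} (det (mat n n (\<lambda>(r, c). C r c + (if r = c then z (e r) else 0)))) \<partial>gprod (e ` {..<n})) = 0"
  using assms
proof (induction n)
  case 0
  have "det (mat 0 0 (\<lambda>(r, c). C r c + (if r = c then z (e r) else 0))) = 1" for z by (rule det_dim_zero) simp
  then show ?case by simp
next
  case (Suc n)
  define D where "D m z = mat m m (\<lambda>(r, c). C r c + (if r = c then z (e r) else 0))" for m and z :: "'i \<Rightarrow> complex"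
  have e: "e i \<noteq> e n" if "i < n" for i using Suc.prems that by (auto dest: inj_onD)
  have im: "e ` {..<Suc n} = insert (e n) (e ` {..<n})" by (auto simp: less_Suc_eq)
  interpret ma: fun_algebra "borel_measurable (bprod (e ` {..<m}))" for m by (rule fun_algebra_measurable)
  have D_in: "ma.mat_in m m m (D m)" for m
    by (intro ma.mat_inI) (auto simp: D_def)
  have D_meas [measurable]: "(\<lambda>z. det (D m z)) \<in> borel_measurable (bprod (e ` {..<m}))" for m
    by (rule ma.det_in[OF D_in])
  define q where "q z = (\<Sum>j<n. C n j * cofactor (D (Suc n) z) n j) + C n n * det (D n z)" for z
  have det_eq: "det (D (Suc n) (z(e n := w))) = q z + w * det (D n z)" for z w
  proof -
    have del: "mat_delete (D (Suc n) (z(e n := w))) n j = mat_delete (D (Suc n) z) n j" for j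
      using e by (intro eq_matI) (auto simp: mat_delete_def D_def)
    then have cof: "cofactor (D (Suc n) (z(e n := w))) n j = cofactor (D (Suc n) z) n j" for j
      by (simp add: cofactor_def)
    have "mat_delete (D (Suc n) z) n n = D n z"
      by (intro eq_matI) (auto simp: mat_delete_def D_def)
    then have nn: "cofactor (D (Suc n) z) n n = det (D n z)" by (simp add: cofactor_def)
    have "det (D (Suc n) (z(e n := w))) = (\<Sum>j<Suc n. D (Suc n) (z(e n := w)) $$ (n, j) * cofactor (D (Suc n) (z(e n := w))) n j)"
      by (rule laplace_expansion_row) (auto simp: D_def)
    also have "\<dots> = (\<Sum>j<n. D (Suc n) (z(e n := w)) $$ (n, j) * cofactor (D (Suc n) z) n j) + (C n n + w) * det (D n z)"
      by (simp add: cof nn) (simp add: D_def)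
    also have "(\<Sum>j<n. D (Suc n) (z(e n := w)) $$ (n, j) * cofactor (D (Suc n) z) n j) =
        (\<Sum>j<n. C n j * cofactor (D (Suc n) z) n j)"
      by (intro sum.cong) (auto simp: D_def)
    finally show ?thesis by (simp only: q_def distrib_right add.assoc)
  qed
  have "(\<integral>\<^sup>+z. indicator {0} (det (D (Suc n) z)) \<partial>gprod (e ` {..<Suc n})) =
      (\<integral>\<^sup>+z. \<integral>\<^sup>+w. indicator {0} (q z + w * det (D n z)) \<partial>cgauss \<partial>gprod (e ` {..<n}))"
    unfolding det_eq[symmetric] im
  proof (rule nn_integral_gprod_insert)
    show "(\<lambda>x. indicator {0} (det (D (Suc n) x)) :: ennreal) \<in> borel_measurable (bprod (insert (e n) (e ` {..<n})))"
      unfolding im[symmetric] by measurable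
    show "e n \<notin> e ` {..<n}" using e by (metis imageE lessThan_iff)
  qed auto
  also have "\<dots> = (\<integral>\<^sup>+z. 0 \<partial>gprod (e ` {..<n}))"
  proof (rule nn_integral_cong_AE)
    have "inj_on e {..<n}" using Suc.prems by (auto simp: inj_on_def)
    from Suc.IH[OF this] have "(\<integral>\<^sup>+z. indicator {0} (det (D n z)) \<partial>gprod (e ` {..<n})) = 0"
      by (simp add: D_def)
    then have "AE z in gprod (e ` {..<n}). indicator {0} (det (D n z)) = (0 :: ennreal)"
      by (subst (asm) nn_integral_0_iff_AE) auto
    then have "AE z in gprod (e ` {..<n}). det (D n z) \<noteq> 0"
      by eventually_elim (auto simp: indicator_def split: if_splits)
    then show "AE z in gprod (e ` {..<n}). (\<integral>\<^sup>+w. indicator {0} (q z + w * det (D n z)) \<partial>cgauss) = 0"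
    proof eventually_elim
      fix z assume z: "det (D n z) \<noteq> 0"
      have "AE w in cgauss. indicator {0} (q z + w * det (D n z)) = (0 :: ennreal)"
        using AE_cgauss_neq[of "- q z / det (D n z)"]
        by eventually_elim (use z in \<open>auto simp: indicator_def field_simps eq_neg_iff_add_eq_0\<close>)
      then show "(\<integral>\<^sup>+w. indicator {0} (q z + w * det (D n z)) \<partial>cgauss) = 0"
        by (subst nn_integral_0_iff_AE) auto
    qed
  qed
  finally show ?case by (simp add: D_def)
qed

text \<open>A kernel vector \<open>u\<close> of the Gram matrix has
  \<open>sqnorm (X *\<^sub>v u) = 0\<close>, so it is a kernel vector of \<open>X\<close> and of its
  top \<open>M\<close> by \<open>M\<close> block, which is nonsingular.\<close>

lemma det_gram_nonzero:
  fixes X :: "complex mat"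
  assumes X: "X \<in> carrier_mat (2 * M) M" and det: "det (mat M M (\<lambda>(r, c). X $$ (r, c))) \<noteq> 0"
  shows "full_rank X"
proof
  assume "det (mat_adjoint X * X) = 0"
  then obtain u where u: "u \<in> carrier_vec M" "u \<noteq> 0\<^sub>v M" "mat_adjoint X * X *\<^sub>v u = 0\<^sub>v M"
    using det_0_iff_vec_prod_zero[of "mat_adjoint X * X" M] carrier_matI[of "mat_adjoint X * X" M M] X by auto
  have "(X *\<^sub>v u) \<bullet>c (X *\<^sub>v u) = u \<bullet>c (mat_adjoint X *\<^sub>v (X *\<^sub>v u))"
    using cscalar_prod_adjoint[of X "2 * M" M u "X *\<^sub>v u"] X u(1) by auto
  also have "mat_adjoint X *\<^sub>v (X *\<^sub>v u) = 0\<^sub>v M"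
    using u X by (simp add: assoc_mult_mat_vec_dim)
  finally have "sqnorm (X *\<^sub>v u) = 0" using u(1) by (simp add: cscalar_prod_self)
  then have Xu: "X *\<^sub>v u = 0\<^sub>v (2 * M)" using X by (simp add: sqnorm_eq_0)
  have "mat M M (\<lambda>(r, c). X $$ (r, c)) *\<^sub>v u = 0\<^sub>v M"
  proof (rule eq_vecI)
    fix i assume i: "i < dim_vec (0\<^sub>v M :: complex vec)"
    then have "row (mat M M (\<lambda>(r, c). X $$ (r, c))) i = row X i" using X by (intro eq_vecI) auto
    then have "(mat M M (\<lambda>(r, c). X $$ (r, c)) *\<^sub>v u) $ i = (X *\<^sub>v u) $ i" using i X by simp
    then show "(mat M M (\<lambda>(r, c). X $$ (r, c)) *\<^sub>v u) $ i = 0\<^sub>v M $ i" using i by (simp add: Xu)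
  qed simp
  then show False
    using det u(1,2) det_0_iff_vec_prod_zero[of "mat M M (\<lambda>(r, c). X $$ (r, c))" M] by auto
qed

section \<open>Random channel matrices\<close>

text \<open>The bound \<open>t \<le> 2 * exp (3 / 4 * t)\<close> reduces the second moment to the
  tilting lemma for a constant function.\<close>

lemma nn_integral_frob_gprod_finite:
  assumes "finite J"
  shows "(\<integral>\<^sup>+z. ennreal (\<Sum>j\<in>J. (cmod (z j))\<^sup>2) \<partial>gprod J) < \<infinity>"
proof -
  interpret J: prob_space "gprod J" by (rule prob_space_PiM_cgauss)
  have "t \<le> 2 * exp (3 / 4 * t)" if "0 \<le> t" for t :: real
    using exp_ge_add_one_self[of "3 / 4 * t"] that by linarith
  then have "(\<integral>\<^sup>+z. ennreal (\<Sum>j\<in>J. (cmod (z j))\<^sup>2) \<partial>gprod J) \<le>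
      (\<integral>\<^sup>+z. 2 * ennreal (exp (3 / 4 * (\<Sum>j\<in>J. (cmod (z j))\<^sup>2))) \<partial>gprod J)"
    by (intro nn_integral_mono) (simp add: sum_nonneg flip: ennreal_numeral ennreal_mult'')
  also have "\<dots> = 4 ^ card J * (\<integral>\<^sup>+z. 2 \<partial>gprod J)"
    using nn_integral_gprod_tilt[OF assms, of "\<lambda>_. 2"] by simp
  also have "\<dots> < \<infinity>"
    by (simp add: J.emeasure_space_1 ennreal_mult_less_top power_less_top_ennreal)
  finally show ?thesis .
qed

lemma measurable_merge_right:
  assumes x: "x \<in> space (gprod I)" and J: "J \<subseteq> I"
  shows "(\<lambda>z. merge (I - J) J (x, z)) \<in> bprod J \<rightarrow>\<^sub>M bprod I"
proof -
  have un: "I - J \<union> J = I" using J by auto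
  have "(\<lambda>z. (restrict x (I - J), z)) \<in> bprod J \<rightarrow>\<^sub>M bprod (I - J) \<Otimes>\<^sub>M bprod J"
    using x by (intro measurable_Pair measurable_const measurable_ident_sets) (auto simp: space_PiM PiE_def)
  from measurable_compose[OF this measurable_merge[of "I - J" J "\<lambda>_. borel", unfolded un]]
  show ?thesis by simp
qed

section \<open>Coordinates of the channel matrices\<close>

definition blk :: "nat \<Rightarrow> nat \<Rightarrow> nat \<Rightarrow> (nat \<times> nat \<times> nat \<times> nat) set" where
  "blk M k i = {k} \<times> {i} \<times> {..<2 * M} \<times> {..<M}"

text \<open>The coordinate \<open>(k, i, r, c)\<close> is the entry in row \<open>r\<close> and column \<open>c\<close> of the channel matrix \<open>H k i\<close>.\<close>

definition idx :: "nat \<Rightarrow> (nat \<times> nat \<times> nat \<times> nat) set" where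
  "idx M = {1..} \<times> {1..3} \<times> {..<2 * M} \<times> {..<M}"

definition Hm :: "nat \<Rightarrow> (nat \<times> nat \<times> nat \<times> nat \<Rightarrow> complex) \<Rightarrow> nat \<Rightarrow> nat \<Rightarrow> complex mat" where
  "Hm M x k i = mat (2 * M) M (\<lambda>(r, c). x (k, i, r, c))"

lemma Hm_dims [simp]: "dim_row (Hm M x k i) = 2 * M" "dim_col (Hm M x k i) = M"
  by (simp_all add: Hm_def)

lemma Hm_carrier [simp]: "Hm M x k i \<in> carrier_mat (2 * M) M"
  by (simp add: Hm_def)

lemma finite_blk [simp]: "finite (blk M k i)"
  by (simp add: blk_def)

lemma blk_subset: "1 \<le> k \<Longrightarrow> i \<in> {1..3} \<Longrightarrow> blk M k i \<subseteq> idx M"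
  by (auto simp: blk_def idx_def)

lemma sum_blk: "(\<Sum>j\<in>blk M k i. g j) = (\<Sum>r<2 * M. \<Sum>c<M. g (k, i, r, c))"
proof -
  have "(\<Sum>j\<in>blk M k i. g j) = (\<Sum>p\<in>{..<2 * M} \<times> {..<M}. g (k, i, p))"
    unfolding blk_def by (rule sum.reindex_bij_witness[of _ "\<lambda>p. (k, i, p)" "\<lambda>j. snd (snd j)"]) auto
  then show ?thesis by (simp add: sum.cartesian_product case_prod_beta')
qed

lemma frob_Hm: "frob (Hm M x k i) = (\<Sum>j\<in>blk M k i. (cmod (x j))\<^sup>2)"
  by (simp add: frob_def sum_blk Hm_def)

lemma Hm_merge:
  assumes "1 \<le> k" "i \<in> {1..3}"
  shows "Hm M (merge (idx M - blk M k' i') (blk M k' i') (x, z)) k i =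
    (if k = k' \<and> i = i' then Hm M z k i else Hm M x k i)"
  using assms by (auto simp: Hm_def merge_def idx_def blk_def intro!: eq_matI)

lemma Hm_scale: "Hm M (\<lambda>j\<in>blk M k i. 2 * z j) k i = 2 \<cdot>\<^sub>m Hm M z k i"
  by (auto simp: Hm_def blk_def intro!: eq_matI)

lemma idx_nonempty: "1 \<le> M \<Longrightarrow> idx M \<noteq> {}"
proof -
  assume "1 \<le> M"
  then have "(1, 1, 0, 0) \<in> idx M" by (simp add: idx_def)
  then show ?thesis by blast
qed

lemma nn_integral_frob_Hm_finite:
  assumes M: "1 \<le> M" and k: "1 \<le> k" "i \<in> {1..3}"
  shows "(\<integral>\<^sup>+x. ennreal (frob (Hm M x k i)) \<partial>gprod (idx M)) < \<infinity>"
proof -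
  interpret N: prob_space "gprod (idx M)" by (rule prob_space_PiM_cgauss)
  note sub = blk_subset[OF k, of M]
  have "(\<lambda>x. ennreal (frob (Hm M x k i))) \<in> borel_measurable (bprod (idx M))"
  proof -
    have [measurable]: "(\<lambda>x. x j) \<in> borel_measurable (bprod (idx M))" if "j \<in> blk M k i" for j
      using sub that by (intro measurable_component_singleton) auto
    show ?thesis unfolding frob_Hm by measurable
  qed
  from nn_integral_gprod_resample[OF idx_nonempty[OF M] sub this]
  have "(\<integral>\<^sup>+x. ennreal (frob (Hm M x k i)) \<partial>gprod (idx M)) =
      (\<integral>\<^sup>+x. \<integral>\<^sup>+z. ennreal (frob (Hm M z k i)) \<partial>gprod (blk M k i) \<partial>gprod (idx M))"
    using Hm_merge[OF k] by simp
  also have "\<dots> = (\<integral>\<^sup>+z. ennreal (frob (Hm M z k i)) \<partial>gprod (blk M k i))"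
    by (simp add: N.emeasure_space_1)
  also have "\<dots> < \<infinity>"
    unfolding frob_Hm by (intro nn_integral_frob_gprod_finite) simp
  finally show ?thesis .
qed

text \<open>Resampling the diagonal of the top block, with everything else fixed, already makes that
  block nonsingular almost surely.\<close>

lemma AE_det_gram_Hm:
  assumes M: "1 \<le> M" and k: "1 \<le> k" "i \<in> {1..3}"
  shows "AE x in gprod (idx M). full_rank (Hm M x k i)"
proof -
  define e where "e r = (k, i, r, r)" for r :: nat
  define J where "J = e ` {..<M}"
  have J: "J \<subseteq> idx M" using k by (auto simp: J_def e_def idx_def)
  have inj: "inj_on e {..<M}" by (auto simp: inj_on_def e_def)
  define T where "T x = mat M M (\<lambda>(r, c). x (k, i, r, c))" for x :: "nat \<times> nat \<times> nat \<times> nat \<Rightarrow> complex"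
  interpret fa: fun_algebra "borel_measurable (bprod (idx M))" by (rule fun_algebra_measurable)
  have "fa.mat_in M M T"
    using k by (intro fa.mat_inI) (auto simp: T_def idx_def intro!: measurable_component_singleton)
  from fa.det_in[OF this] have [measurable]: "(\<lambda>x. det (T x)) \<in> borel_measurable (bprod (idx M))" .
  have merge: "T (merge (idx M - J) J (x, z)) =
      mat M M (\<lambda>(r, c). (if r = c then 0 else x (k, i, r, c)) + (if r = c then z (e r) else 0))" for x z
    using k by (intro eq_matI) (auto simp: T_def merge_def J_def e_def idx_def)
  have "(\<integral>\<^sup>+x. indicator {0} (det (T x)) \<partial>gprod (idx M)) = 0"
    using nn_integral_gprod_resample[OF idx_nonempty[OF M] J, of "\<lambda>x. indicator {0} (det (T x))"]
    by (simp add: merge nn_integral_det_diag_zero[OF inj, folded J_def, of "\<lambda>r c. if r = c then 0 else _ (k, i, r, c)"])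
  then have "AE x in gprod (idx M). indicator {0} (det (T x)) = (0 :: ennreal)"
    by (subst (asm) nn_integral_0_iff_AE) auto
  then show ?thesis
  proof eventually_elim
    fix x assume "indicator {0} (det (T x)) = (0 :: ennreal)"
    then have "det (T x) \<noteq> 0" by (auto simp: indicator_def split: if_splits)
    moreover have "T x = mat M M (\<lambda>(r, c). Hm M x k i $$ (r, c))"
      by (intro eq_matI) (auto simp: T_def Hm_def)
    ultimately show "full_rank (Hm M x k i)"
      by (intro det_gram_nonzero) auto
  qed
qed

text \<open>Every user falls into the box with the same probability \<open>p > 0\<close>,
  independently of the others, so the first \<open>n\<close> all miss it with probability
  \<open>(1 - p) ^ n\<close>. The recursion comes from resampling the coordinates of user
  \<open>n + 1\<close>.\<close>

lemma AE_exists_user_in_box: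
  fixes A :: "nat \<times> nat \<times> nat \<Rightarrow> complex set"
  assumes M: "1 \<le> M" and A: "\<And>j. open (A j)" "\<And>j. A j \<noteq> {}"
  shows "AE x in gprod (idx M). \<exists>k\<ge>1. \<forall>j \<in> {2..3} \<times> {..<2 * M} \<times> {..<M}. x (k, j) \<in> A j"
proof -
  define T :: "(nat \<times> nat \<times> nat) set" where "T = {2..3} \<times> {..<2 * M} \<times> {..<M}"
  define p where "p = (\<Prod>j\<in>T. cgauss.prob (A j))"
  have T: "finite T" by (simp add: T_def)
  have p: "0 < p" "p \<le> 1"
    unfolding p_def using cgauss_open_pos[OF A] by (auto intro!: prod_pos prod_le_1 cgauss.prob_le_1)
  have sub: "{k} \<times> T \<subseteq> idx M" if "1 \<le> k" for k using that by (auto simp: T_def idx_def)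
  have [measurable]: "A j \<in> sets borel" for j using A by simp
  define Z where "Z n = {x \<in> space (gprod (idx M)). \<forall>k \<in> {1..n}. \<exists>j\<in>T. x (k, j) \<notin> A j}" for n :: nat
  have coord [measurable]: "(\<lambda>x. x (k, j)) \<in> borel_measurable (bprod (idx M))"
    if "1 \<le> k" "j \<in> T" for k j
    using that by (intro measurable_component_singleton) (auto simp: T_def idx_def)
  have Z_meas [measurable]: "Z n \<in> sets (gprod (idx M))" for n
    unfolding Z_def
  proof (intro sets.sets_Collect_finite_All sets.sets_Collect_finite_Ex)
    fix k j assume kj: "k \<in> {1..n}" "j \<in> T"
    then have "(\<lambda>x. x (k, j)) -` (- A j) \<inter> space (bprod (idx M)) \<in> sets (gprod (idx M))"
      unfolding sets_PiM_cgauss by (intro measurable_sets[OF coord]) auto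
    also have "(\<lambda>x. x (k, j)) -` (- A j) \<inter> space (bprod (idx M)) =
        {x \<in> space (gprod (idx M)). x (k, j) \<notin> A j}"
      by (auto simp: space_PiM)
    finally show "{x \<in> space (gprod (idx M)). x (k, j) \<notin> A j} \<in> sets (gprod (idx M))" .
  qed (use T in auto)
  have Z: "emeasure (gprod (idx M)) (Z n) = ennreal ((1 - p) ^ n)" for n
  proof (induction n)
    case 0
    interpret N: prob_space "gprod (idx M)" by (rule prob_space_PiM_cgauss)
    show ?case by (simp add: Z_def N.emeasure_space_1)
  next
    case (Suc n)
    let ?J = "{Suc n} \<times> T"
    interpret J: prob_space "gprod ?J" by (rule prob_space_PiM_cgauss)
    have sJ: "?J \<subseteq> idx M" by (rule sub) simp
    define Y where "Y = (\<Pi>\<^sub>E i\<in>?J. A (snd i))"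
    have Y [measurable]: "Y \<in> sets (gprod ?J)"
      unfolding Y_def using T by (intro sets_PiM_I_finite) auto
    have "emeasure (gprod ?J) Y = (\<Prod>i\<in>?J. emeasure cgauss (A (snd i)))"
      unfolding Y_def using T by (intro cgauss_prod.emeasure_PiM) auto
    also have "\<dots> = ennreal (\<Prod>i\<in>?J. cgauss.prob (A (snd i)))"
      by (simp add: cgauss.emeasure_eq_measure prod_ennreal)
    also have "(\<Prod>i\<in>?J. cgauss.prob (A (snd i))) = p"
      unfolding p_def by (rule prod.reindex_bij_witness[of _ "Pair (Suc n)" snd]) auto
    finally have "J.prob Y = p" using p by (simp add: J.emeasure_eq_measure)
    then have comp: "emeasure (gprod ?J) (space (gprod ?J) - Y) = ennreal (1 - p)"
      using J.prob_compl[OF Y] by (simp add: J.emeasure_eq_measure)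
    \<comment> \<open>After resampling, the event splits into the old one, for \<open>x\<close>, and
      a miss of the new user, which depends on \<open>z\<close> alone.\<close>
    have ind: "indicator (Z (Suc n)) (merge (idx M - ?J) ?J (x, z)) =
        (indicator (Z n) x * indicator (space (gprod ?J) - Y) z :: ennreal)"
      if x: "x \<in> space (gprod (idx M))" and z: "z \<in> space (gprod ?J)" for x z
    proof -
      have m: "merge (idx M - ?J) ?J (x, z) \<in> space (gprod (idx M))"
        using x z sJ by (auto simp: space_PiM merge_def PiE_def extensional_def)
      have k: "merge (idx M - ?J) ?J (x, z) (k, j) = (if k = Suc n then z (k, j) else x (k, j))"
        if "k \<in> {1..Suc n}" "j \<in> T" for k j
        using that sub[of k] by (auto simp: merge_def)
      have zY: "z \<in> Y \<longleftrightarrow> (\<forall>j\<in>T. z (Suc n, j) \<in> A j)"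
        using z by (auto simp: Y_def space_PiM PiE_def Pi_def)
      have "merge (idx M - ?J) ?J (x, z) \<in> Z (Suc n) \<longleftrightarrow> x \<in> Z n \<and> z \<notin> Y"
      proof -
        have "{1..Suc n} = insert (Suc n) {1..n}" by auto
        then show ?thesis using m x by (simp add: Z_def zY k) blast
      qed
      then show ?thesis using z by (auto simp: indicator_def)
    qed
    have "emeasure (gprod (idx M)) (Z (Suc n)) = (\<integral>\<^sup>+x. indicator (Z (Suc n)) x \<partial>gprod (idx M))"
      by simp
    also have "\<dots> = (\<integral>\<^sup>+x. \<integral>\<^sup>+z. indicator (Z (Suc n)) (merge (idx M - ?J) ?J (x, z)) \<partial>gprod ?J \<partial>gprod (idx M))"
      using Z_meas[of "Suc n"]
      by (intro nn_integral_gprod_resample[OF idx_nonempty[OF M] sJ]) (auto simp: sets_PiM_cgauss)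
    also have "\<dots> = (\<integral>\<^sup>+x. \<integral>\<^sup>+z. indicator (Z n) x * indicator (space (gprod ?J) - Y) z \<partial>gprod ?J \<partial>gprod (idx M))"
      by (intro nn_integral_cong) (simp add: ind)
    also have "\<dots> = (\<integral>\<^sup>+x. indicator (Z n) x * ennreal (1 - p) \<partial>gprod (idx M))"
      by (simp add: nn_integral_cmult comp)
    also have "\<dots> = ennreal ((1 - p) ^ n) * ennreal (1 - p)"
      by (simp add: nn_integral_multc Suc.IH)
    also have "\<dots> = ennreal ((1 - p) ^ Suc n)"
      using p by (simp add: mult.commute flip: ennreal_mult')
    finally show ?case .
  qed
  define W where "W = (\<Inter>n. Z n)"
  have W: "W \<in> sets (gprod (idx M))" unfolding W_def by (intro sets.countable_INT) auto
  have "(\<lambda>n. ennreal ((1 - p) ^ n)) \<longlonglongrightarrow> ennreal 0"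
    using p by (intro tendsto_ennrealI LIMSEQ_power_zero) auto
  moreover have "emeasure (gprod (idx M)) W \<le> ennreal ((1 - p) ^ n)" for n
    unfolding Z[symmetric] W_def by (intro emeasure_mono) auto
  ultimately have "emeasure (gprod (idx M)) W \<le> ennreal 0"
    by (intro LIMSEQ_le_const) auto
  then have null: "W \<in> null_sets (gprod (idx M))" using W by (auto simp: null_sets_def)
  show ?thesis
  proof (rule AE_I'[OF null], safe)
    fix x assume "x \<in> space (gprod (idx M))"
      and "\<not> (\<exists>k\<ge>1. \<forall>j\<in>{2..3} \<times> {..<2 * M} \<times> {..<M}. x (k, j) \<in> A j)"
    then show "x \<in> W" by (auto simp: W_def Z_def T_def)
  qed
qed

text \<open>User 1 always competes, so \<open>ennreal (m x 1)\<close> dominates every minimum, and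
  almost surely the minima drop below each \<epsilon>. Through \<open>ennreal\<close>, negative
  values of \<open>m\<close> count as 0.\<close>

lemma nn_integral_minimum_tendsto_0:
  fixes m :: "'x \<Rightarrow> nat \<Rightarrow> real" and sel :: "nat \<Rightarrow> 'x \<Rightarrow> nat"
  assumes meas: "\<And>k. 1 \<le> k \<Longrightarrow> (\<lambda>x. m x k) \<in> borel_measurable N"
    and sel [measurable]: "\<And>K. 1 \<le> K \<Longrightarrow> sel K \<in> N \<rightarrow>\<^sub>M count_space {1..K}"
    and min: "\<And>K k x. x \<in> space N \<Longrightarrow> k \<in> {1..K} \<Longrightarrow> m x (sel K x) \<le> m x k"
    and int: "(\<integral>\<^sup>+x. ennreal (m x 1) \<partial>N) < \<infinity>"
    and small: "\<And>\<epsilon>. 0 < \<epsilon> \<Longrightarrow> AE x in N. \<exists>k\<ge>1. m x k < \<epsilon>"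
  shows "(\<lambda>K. \<integral>\<^sup>+x. ennreal (m x (sel K x)) \<partial>N) \<longlonglongrightarrow> 0"
proof -
  have [measurable]: "(\<lambda>x. m x (sel (Suc K) x)) \<in> borel_measurable N" for K
    using measurable_compose_countable'[of "{1..Suc K}" "\<lambda>k x. m x k" N borel "sel (Suc K)"] meas sel[of "Suc K"]
    by auto
  have [measurable]: "(\<lambda>x. m x 1) \<in> borel_measurable N" using meas[of 1] by simp
  \<comment> \<open>The sequence is shifted by one, since for \<open>K = 0\<close> there is no user
    to select.\<close>
  have "(\<lambda>K. \<integral>\<^sup>+x. ennreal (m x (sel (Suc K) x)) \<partial>N) \<longlonglongrightarrow> (\<integral>\<^sup>+x. 0 \<partial>N)"
  proof (rule nn_integral_dominated_convergence[where w = "\<lambda>x. ennreal (m x 1)"])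
    show "AE x in N. ennreal (m x (sel (Suc K) x)) \<le> ennreal (m x 1)" for K
      using min[of _ 1 "Suc K"] by (intro AE_I2 ennreal_leI) auto
    have "AE x in N. \<forall>n. \<exists>k\<ge>1. m x k < 1 / real (Suc n)"
      using small by (subst AE_all_countable) auto
    then show "AE x in N. (\<lambda>K. ennreal (m x (sel (Suc K) x))) \<longlonglongrightarrow> 0"
      using AE_space
    proof eventually_elim
      fix x assume x: "\<forall>n. \<exists>k\<ge>1. m x k < 1 / real (Suc n)" "x \<in> space N"
      show "(\<lambda>K. ennreal (m x (sel (Suc K) x))) \<longlonglongrightarrow> 0"
      proof (rule order_tendstoI)
        fix a :: ennreal assume "0 < a"
        then obtain b where b: "0 < b" "b < a" using dense by blast
        then obtain r where r: "b = ennreal r" "0 < r"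
          using b by (cases b) auto
        obtain n where n: "inverse (real (Suc n)) < r" using reals_Archimedean[OF r(2)] by blast
        obtain k where k: "1 \<le> k" "m x k < 1 / real (Suc n)" using x(1) by blast
        have "ennreal (m x (sel (Suc K) x)) < a" if "k \<le> K" for K
        proof -
          have "m x (sel (Suc K) x) \<le> m x k" using min[OF x(2), of k "Suc K"] k that by auto
          then have "m x (sel (Suc K) x) \<le> r" using k n by (simp add: inverse_eq_divide)
          then have "ennreal (m x (sel (Suc K) x)) \<le> b" unfolding r(1) by (rule ennreal_leI)
          then show ?thesis using b(2) by simp
        qed
        then show "\<forall>\<^sub>F K in sequentially. ennreal (m x (sel (Suc K) x)) < a"
          using eventually_ge_at_top[of k] by (rule eventually_mono[rotated])
      qed simp
    qed
  qed (use int meas[of 1] in auto)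
  then have "(\<lambda>K. \<integral>\<^sup>+x. ennreal (m x (sel (Suc K) x)) \<partial>N) \<longlonglongrightarrow> 0" by simp
  then show ?thesis by (rule LIMSEQ_imp_Suc)
qed

section \<open>The selected user\<close>

text \<open>Ties are broken by a choice from the predicate of minimizers, so equal metrics on
  \<open>{1..K}\<close> give the same predicate and the same choice.\<close>

lemma selected_user_cong:
  assumes "\<And>k. k \<in> {1..K} \<Longrightarrow> selection_metric s M P (H k) = selection_metric s M P (H' k)"
  shows "selected_user s M P K H = selected_user s M P K H'"
proof -
  have "is_arg_min (\<lambda>k. selection_metric s M P (H k)) (\<lambda>k. k \<in> {1..K}) =
      is_arg_min (\<lambda>k. selection_metric s M P (H' k)) (\<lambda>k. k \<in> {1..K})"
    using assms by (auto simp: is_arg_min_def fun_eq_iff)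
  then show ?thesis by (simp add: selected_user_def arg_min_on_def arg_min_def)
qed

lemma selected_user_minimizes:
  assumes "1 \<le> K"
  shows "selected_user s M P K H \<in> {1..K}"
    and "k \<in> {1..K} \<Longrightarrow> selection_metric s M P (H (selected_user s M P K H)) \<le> selection_metric s M P (H k)"
proof -
  let ?f = "\<lambda>k. selection_metric s M P (H k)"
  have "finite {1..K}" "{1..K} \<noteq> {}" using assms by auto
  from arg_min_if_finite[OF this, of ?f]
  show "selected_user s M P K H \<in> {1..K}"
    and "k \<in> {1..K} \<Longrightarrow> selection_metric s M P (H (selected_user s M P K H)) \<le> selection_metric s M P (H k)"
    unfolding selected_user_def by (blast, meson not_le_imp_less)
qed

locale oia =
  fixes M :: nat and P :: real and s :: oia_scheme and v :: "nat \<Rightarrow> complex mat \<Rightarrow> complex vec"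
  assumes M: "1 \<le> M" and P: "0 < P" and v: "eigenvector_choice (2 * M) v"
begin

abbreviation "BN \<equiv> PiM (idx M) (\<lambda>_. borel :: complex measure)"
abbreviation "N \<equiv> gprod (idx M)"

sublocale N: prob_space N
  by (rule prob_space_PiM_cgauss)

sublocale fa: fun_algebra "borel_measurable BN"
  by (rule fun_algebra_measurable)

lemma chan: "oia_channel M v (Hm M x k)"
  using M v by unfold_locales auto

section \<open>Metric, selection, gain, loss and rate as random variables\<close>

definition "user_metric s' x k = selection_metric s' M P (Hm M x k)"
definition "sel K x = selected_user s M P K (Hm M x)"
definition "F x k = postprocessing M v (Hm M x k)"
definition "gain x k = rate_gain M P (F x k * Hm M x k 1)"
definition "loss x k = log 2 (user_metric OIA1 x k)"
definition "rate x k = user_rate M P (F x k) (Hm M x k)"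

lemma F_dims [simp]: "dim_row (F x k) = M" "dim_col (F x k) = 2 * M"
  using oia_channel.F_dims[OF chan, of x k] by (simp_all add: F_def)

lemma Hm_in:
  assumes "1 \<le> k" "i \<in> {1..3}"
  shows "fa.mat_in (2 * M) M (\<lambda>x. Hm M x k i)"
  using assms by (intro fa.mat_inI) (auto simp: Hm_def idx_def intro!: measurable_component_singleton)

lemma cov_in:
  assumes k: "1 \<le> k"
  shows "fa.mat_in (2 * M) (2 * M) (\<lambda>x. interference_cov (Hm M x k))"
  unfolding interference_cov_def
  by (intro fa.mat_in_add fa.mat_in_mult[where m = M] fa.mat_in_adjoint Hm_in k) auto

text \<open>The eigenvectors are measurable in the entries of the covariance by
  \<open>eigenvector_choice\<close>, and these entries are measurable in the channel
  coordinates.\<close>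

lemma F_in:
  assumes k: "1 \<le> k"
  shows "fa.mat_in M (2 * M) (\<lambda>x. F x k)"
proof (intro fa.mat_inI)
  fix i j assume ij: "i < M" "j < 2 * M"
  let ?D = "{..<2 * M} \<times> {..<2 * M}"
  have "(\<lambda>x. \<lambda>p\<in>?D. interference_cov (Hm M x k) $$ p) \<in> BN \<rightarrow>\<^sub>M bprod ?D"
    using fa.mat_in_entry[OF cov_in[OF k]] by (intro measurable_restrict) auto
  moreover have "(\<lambda>a. v (M + 1 + i) (mat (2 * M) (2 * M) a) $ j) \<in> borel_measurable (bprod ?D)"
    using v ij by (auto simp: eigenvector_choice_def)
  ultimately have "(\<lambda>x. v (M + 1 + i) (mat (2 * M) (2 * M) (\<lambda>p\<in>?D. interference_cov (Hm M x k) $$ p)) $ j)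
      \<in> borel_measurable BN"
    by (rule measurable_compose)
  moreover have "mat (2 * M) (2 * M) (\<lambda>p\<in>?D. interference_cov (Hm M x k) $$ p) = interference_cov (Hm M x k)" for x
    using fa.mat_in_dims[OF cov_in[OF k]] by (intro eq_matI) auto
  ultimately have "(\<lambda>x. cnj (v (M + 1 + i) (interference_cov (Hm M x k)) $ j)) \<in> borel_measurable BN"
    using fa.cnj by simp
  then show "(\<lambda>x. F x k $$ (i, j)) \<in> borel_measurable BN"
    using ij unfolding F_def by (simp add: oia_channel.F_index[OF chan])
qed auto

text \<open>The eigenvalue is a diagonal entry of \<open>F B F*\<close>, so its measurability is
  inherited from the eigenvectors and no roots of characteristic polynomials have to be
  tracked.\<close>

lemma measurable_eigenvalue:
  assumes k: "1 \<le> k" and m: "m \<in> {M + 1..2 * M}"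
  shows "(\<lambda>x. nth_eigenvalue m (interference_cov (Hm M x k))) \<in> borel_measurable BN"
proof -
  have "fa.mat_in M M (\<lambda>x. F x k * interference_cov (Hm M x k) * mat_adjoint (F x k))"
    by (intro fa.mat_in_mult[where m = "2 * M"] fa.mat_in_adjoint F_in cov_in k)
  from fa.mat_in_entry[OF this, of "m - (M + 1)" "m - (M + 1)"]
  have "(\<lambda>x. (F x k * interference_cov (Hm M x k) * mat_adjoint (F x k)) $$ (m - (M + 1), m - (M + 1)))
      \<in> borel_measurable BN"
    using m by auto
  then have "(\<lambda>x. Re ((F x k * interference_cov (Hm M x k) * mat_adjoint (F x k)) $$ (m - (M + 1), m - (M + 1))))
      \<in> borel_measurable BN"
    by (rule measurable_compose[OF _ borel_measurable_Re])
  moreover have "m - (M + 1) < M" "M + 1 + (m - (M + 1)) = m" using m by auto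
  ultimately show ?thesis
    unfolding F_def oia_channel.F_diagonalizes[OF chan] by (simp only: index_mat split_conv if_True Re_complex_of_real refl)
qed

lemma measurable_metric [measurable]:
  assumes k: "1 \<le> k"
  shows "(\<lambda>x. user_metric s' x k) \<in> borel_measurable BN"
proof (cases s')
  case OIA1
  then show ?thesis
    using measurable_eigenvalue[OF k] unfolding user_metric_def by (simp add: borel_measurable_prod)
next
  case OIA2
  have gram: "fa.mat_in M M (\<lambda>x. mat_adjoint (Hm M x k i) * Hm M x k i)" if "i \<in> {1..3}" for i
    using k that by (intro fa.mat_in_mult[where m = "2 * M"] fa.mat_in_adjoint Hm_in)
  then have det [measurable]: "(\<lambda>x. det (mat_adjoint (Hm M x k i) * Hm M x k i)) \<in> borel_measurable BN" if "i \<in> {1..3}" for i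
    using that by (intro fa.det_in)
  have proj: "fa.mat_in (2 * M) (2 * M) (\<lambda>x. colproj (Hm M x k i))" if "i \<in> {1..3}" for i
    using k that det by (intro fa.mat_in_colproj[where m = M] Hm_in borel_measurable_inverse) auto
  have [measurable]: "(\<lambda>x. mat_trace (colproj (Hm M x k 2) * colproj (Hm M x k 3))) \<in> borel_measurable BN"
    by (rule fa.trace_in[OF fa.mat_in_mult[OF proj proj]]) auto
  have [measurable]: "(\<lambda>x. det (mat_adjoint (Hm M x k 2) * Hm M x k 2)) \<in> borel_measurable BN"
    "(\<lambda>x. det (mat_adjoint (Hm M x k 3) * Hm M x k 3)) \<in> borel_measurable BN"
    by (auto intro!: det)
  show ?thesis
    unfolding user_metric_def OIA2 selection_metric.simps sq_chordal_dist_col_eq[OF Hm_carrier Hm_carrier]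
    by measurable
qed

lemma measurable_log2_det:
  assumes "fa.mat_in n n f"
  shows "(\<lambda>x. log2_det (f x)) \<in> borel_measurable BN"
proof -
  have [measurable]: "(\<lambda>x. det (f x)) \<in> borel_measurable BN" by (rule fa.det_in[OF assms])
  show ?thesis unfolding log2_det_def by measurable
qed

lemma measurable_gain [measurable]: "1 \<le> k \<Longrightarrow> (\<lambda>x. gain x k) \<in> borel_measurable BN"
  unfolding gain_def rate_gain_def
  by (intro measurable_log2_det[where n = M] fa.mat_in_add fa.mat_in_smult fa.mat_in_mult[where m = M]
      fa.mat_in_mult[where m = "2 * M"] fa.mat_in_adjoint fa.mat_in_const F_in Hm_in fa.const) auto

lemma received_cov_in:
  "1 \<le> k \<Longrightarrow> i \<in> {1..3} \<Longrightarrow> fa.mat_in M M (\<lambda>x. received_cov (F x k) (Hm M x k i))"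
  unfolding received_cov_def
  by (intro fa.mat_in_mult[where m = M] fa.mat_in_mult[where m = "2 * M"] fa.mat_in_adjoint F_in Hm_in) auto

lemma measurable_rate [measurable]: "1 \<le> k \<Longrightarrow> (\<lambda>x. rate x k) \<in> borel_measurable BN"
  unfolding rate_def user_rate_def rate_plus_def rate_minus_def
  by (intro borel_measurable_diff measurable_log2_det[where n = M] fa.mat_in_add fa.mat_in_smult
      fa.mat_in_const fa.const received_cov_in) auto

lemma measurable_loss [measurable]: "1 \<le> k \<Longrightarrow> (\<lambda>x. loss x k) \<in> borel_measurable BN"
  unfolding loss_def by measurable

lemma sel_in: "1 \<le> K \<Longrightarrow> sel K x \<in> {1..K}"
  and metric_sel_le: "1 \<le> K \<Longrightarrow> k \<in> {1..K} \<Longrightarrow> user_metric s x (sel K x) \<le> user_metric s x k"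
  unfolding sel_def user_metric_def by (intro selected_user_minimizes; simp)+

text \<open>Ties are broken by \<open>SOME\<close>, so \<open>sel K\<close> is a function of the set
  \<open>Q x\<close> of minimizers. This set takes finitely many values, and each event
  \<open>Q x = T\<close> is a finite combination of comparisons of metrics.\<close>

lemma measurable_sel:
  assumes K: "1 \<le> K"
  shows "sel K \<in> BN \<rightarrow>\<^sub>M count_space {1..K}"
proof (rule measurable_count_space_eq2[THEN iffD2])
  define Q where "Q x = {j \<in> {1..K}. \<forall>i\<in>{1..K}. user_metric s x j \<le> user_metric s x i}" for x
  have sel_Q: "sel K x = (SOME j. j \<in> Q x)" for x
  proof -
    have "is_arg_min (user_metric s x) (\<lambda>k. k \<in> {1..K}) = (\<lambda>j. j \<in> Q x)"
      by (auto simp: is_arg_min_def Q_def fun_eq_iff not_less)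
    moreover have "user_metric s x = (\<lambda>k. selection_metric s M P (Hm M x k))" by (simp add: user_metric_def fun_eq_iff)
    ultimately show ?thesis by (simp add: sel_def selected_user_def arg_min_on_def arg_min_def)
  qed
  have Q: "{x \<in> space BN. Q x = T} \<in> sets BN" if "T \<subseteq> {1..K}" for T
  proof -
    have "{x \<in> space BN. Q x = T} =
        {x \<in> space BN. \<forall>j\<in>{1..K}. (\<forall>i\<in>{1..K}. user_metric s x j \<le> user_metric s x i) \<longleftrightarrow> j \<in> T}"
      using that by (auto simp: Q_def)
    also have "\<dots> \<in> sets BN"
    proof (intro sets.sets_Collect_finite_All)
      fix j assume j: "j \<in> {1..K}"
      have "{x \<in> space BN. \<forall>i\<in>{1..K}. user_metric s x j \<le> user_metric s x i} \<in> sets BN"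
        using j by (intro sets.sets_Collect_finite_All borel_measurable_le measurable_metric) auto
      then have "{x \<in> space BN. (\<forall>i\<in>{1..K}. user_metric s x j \<le> user_metric s x i) = True} \<in> sets BN"
          "{x \<in> space BN. \<not> (\<forall>i\<in>{1..K}. user_metric s x j \<le> user_metric s x i)} \<in> sets BN"
        by (simp, intro sets.sets_Collect_neg)
      then show "{x \<in> space BN. (\<forall>i\<in>{1..K}. user_metric s x j \<le> user_metric s x i) \<longleftrightarrow> j \<in> T} \<in> sets BN"
        by (cases "j \<in> T") (simp_all del: sets_PiM_cgauss)
    qed auto
    finally show ?thesis .
  qed
  have "{x \<in> space BN. sel K x = k} = (\<Union>T \<in> {T \<in> Pow {1..K}. (SOME j. j \<in> T) = k}. {x \<in> space BN. Q x = T})" for k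
    by (auto simp: sel_Q Q_def)
  moreover have "(\<Union>T \<in> {T \<in> Pow {1..K}. (SOME j. j \<in> T) = k}. {x \<in> space BN. Q x = T}) \<in> sets BN" for k
    using Q by (intro sets.finite_UN) auto
  ultimately have "{x \<in> space BN. sel K x = k} \<in> sets BN" for k by simp
  moreover have "sel K -` {k} \<inter> space BN = {x \<in> space BN. sel K x = k}" for k by auto
  ultimately show "sel K \<in> space BN \<rightarrow> {1..K} \<and> (\<forall>k\<in>{1..K}. sel K -` {k} \<inter> space BN \<in> sets BN)"
    using sel_in[OF K] by auto
qed simp

lemma measurable_at_sel:
  assumes K: "1 \<le> K" and f: "\<And>k. 1 \<le> k \<Longrightarrow> (\<lambda>x. f x k) \<in> borel_measurable BN"
  shows "(\<lambda>x. f x (sel K x)) \<in> borel_measurable BN"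
  using measurable_compose_countable'[of "{1..K}" "\<lambda>k x. f x k" BN borel "sel K"] f measurable_sel[OF K]
  by auto

text \<open>Resampling acts on the block of a fixed user, whereas the selected user is random; the
  sum over its possible values fixes the index.\<close>

lemma nn_integral_at_sel:
  fixes f :: "_ \<Rightarrow> nat \<Rightarrow> ennreal"
  assumes K: "1 \<le> K" and f: "\<And>k. 1 \<le> k \<Longrightarrow> (\<lambda>x. f x k) \<in> borel_measurable BN"
  shows "(\<integral>\<^sup>+x. f x (sel K x) \<partial>N) = (\<Sum>k = 1..K. \<integral>\<^sup>+x. indicator {k} (sel K x) * f x k \<partial>N)"
proof -
  have [measurable]: "(\<lambda>x. indicator {k} (sel K x) :: ennreal) \<in> borel_measurable BN" for k
    using measurable_compose[OF measurable_sel[OF K], of "indicator {k}" borel] by simp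
  have "(\<integral>\<^sup>+x. f x (sel K x) \<partial>N) = (\<integral>\<^sup>+x. (\<Sum>k = 1..K. indicator {k} (sel K x) * f x k) \<partial>N)"
  proof (rule nn_integral_cong)
    fix x
    have "(\<Sum>k = 1..K. indicator {k} (sel K x) * f x k) = (\<Sum>k\<in>{sel K x}. indicator {k} (sel K x) * f x k)"
      using sel_in[OF K, of x] by (intro sum.mono_neutral_right) auto
    then show "f x (sel K x) = (\<Sum>k = 1..K. indicator {k} (sel K x) * f x k)" by simp
  qed
  also have "\<dots> = (\<Sum>k = 1..K. \<integral>\<^sup>+x. indicator {k} (sel K x) * f x k \<partial>N)"
    using f by (intro nn_integral_sum) (auto cong: measurable_cong_sets)
  finally show ?thesis .
qed

lemma measurable_indicator_sel: "1 \<le> K \<Longrightarrow> (\<lambda>x. indicator {k} (sel K x) :: ennreal) \<in> borel_measurable BN"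
  using measurable_compose[OF measurable_sel, of K "indicator {k}" borel] by simp

lemma metric_cong:
  assumes "\<And>i. i \<in> {2, 3} \<Longrightarrow> Hm M x k i = Hm M y k i"
  shows "user_metric s' x k = user_metric s' y k"
proof -
  have "interference_cov (Hm M x k) = interference_cov (Hm M y k)"
    using assms by (simp add: interference_cov_def)
  then show ?thesis using assms by (cases s') (simp_all add: user_metric_def)
qed

lemma F_cong: "(\<And>i. i \<in> {2, 3} \<Longrightarrow> Hm M x k i = Hm M y k i) \<Longrightarrow> F x k = F y k"
  by (simp add: F_def postprocessing_def interference_cov_def)

lemma sel_cong: "(\<And>k. k \<in> {1..K} \<Longrightarrow> user_metric s x k = user_metric s y k) \<Longrightarrow> sel K x = sel K y"
  unfolding sel_def user_metric_def by (rule selected_user_cong)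

section \<open>The gain at the selected user\<close>

definition "capacity = (\<integral>\<^sup>+z. ennreal (rate_gain M P (mat M M z)) \<partial>gprod ({..<M} \<times> {..<M}))"

lemma measurable_rate_gain_mat:
  "(\<lambda>z. rate_gain M P (mat M M z)) \<in> borel_measurable (bprod ({..<M} \<times> {..<M}))"
proof -
  interpret fb: fun_algebra "borel_measurable (bprod ({..<M} \<times> {..<M}))" by (rule fun_algebra_measurable)
  have "fb.mat_in M M (mat M M)"
    by (intro fb.mat_inI) (auto intro!: measurable_component_singleton)
  then have "fb.mat_in M M (\<lambda>z. 1\<^sub>m M + complex_of_real (P / real M) \<cdot>\<^sub>m (mat M M z * mat_adjoint (mat M M z)))"
    by (intro fb.mat_in_add fb.mat_in_smult fb.mat_in_mult[where m = M] fb.mat_in_adjoint fb.mat_in_const fb.const) auto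
  from fb.det_in[OF this] show ?thesis
    unfolding rate_gain_def log2_det_def by measurable
qed

lemma nn_integral_gain_rotated:
  assumes A: "A \<in> carrier_mat M (2 * M)" "A * mat_adjoint A = 1\<^sub>m M"
  shows "(\<integral>\<^sup>+z. ennreal (rate_gain M P (A * Hm M z k i)) \<partial>gprod (blk M k i)) = capacity"
proof -
  \<comment> \<open>Left multiplication by \<open>A\<close> acts on each column separately: the
    kernel is the Kronecker product of \<open>A\<close> with the identity, and its rows are
    orthonormal because those of \<open>A\<close> are.\<close>
  define Kern where "Kern = (\<lambda>(r, c) (k' :: nat, i' :: nat, q, c' :: nat). if c = c' then A $$ (r, q) else 0)"
  let ?R = "{..<M} \<times> {..<M}"
  have "orthonormal_rows ?R (blk M k i) Kern"
    unfolding orthonormal_rows_def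
  proof (intro ballI)
    fix p p' assume pp: "p \<in> ?R" "p' \<in> ?R"
    obtain r c r' c' where p: "p = (r, c)" "p' = (r', c')" by (cases p, cases p')
    have rc: "r < M" "c < M" "r' < M" "c' < M" using pp p by auto
    have "(\<Sum>j\<in>blk M k i. Kern p j * cnj (Kern p' j)) =
        (\<Sum>q<2 * M. \<Sum>d<M. if d = c then (if c = c' then A $$ (r, q) * cnj (A $$ (r', q)) else 0) else 0)"
      unfolding sum_blk p by (intro sum.cong refl) (auto simp: Kern_def)
    also have "\<dots> = (if c = c' then (A * mat_adjoint A) $$ (r, r') else 0)"
      using rc A(1) by (simp add: scalar_prod_def atLeast0LessThan)
    also have "\<dots> = (if p = p' then 1 else 0)"
      using rc unfolding A(2) p by auto
    finally show "(\<Sum>j\<in>blk M k i. Kern p j * cnj (Kern p' j)) = (if p = p' then 1 else 0)" .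
  qed
  moreover have "mat M M (lin_comb ?R (blk M k i) Kern z) = A * Hm M z k i" for z
  proof (rule eq_matI)
    fix r c assume "r < dim_row (A * Hm M z k i)" "c < dim_col (A * Hm M z k i)"
    then have rc: "r < M" "c < M" using A by auto
    have "(\<Sum>j\<in>blk M k i. Kern (r, c) j * z j) = (\<Sum>q<2 * M. \<Sum>d<M. if d = c then A $$ (r, q) * z (k, i, q, c) else 0)"
      unfolding sum_blk by (intro sum.cong refl) (auto simp: Kern_def)
    also have "\<dots> = (A * Hm M z k i) $$ (r, c)"
      using rc A(1) by (simp add: Hm_def scalar_prod_def atLeast0LessThan)
    finally show "mat M M (lin_comb ?R (blk M k i) Kern z) $$ (r, c) = (A * Hm M z k i) $$ (r, c)"
      using rc by (simp add: lin_comb_def)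
  qed (use A in auto)
  ultimately show ?thesis
    using nn_integral_orthonormal_rows[of ?R "blk M k i" Kern "\<lambda>z. ennreal (rate_gain M P (mat M M z))"]
      measurable_rate_gain_mat by (simp add: capacity_def)
qed

lemma nn_integral_gain_sel:
  assumes K: "1 \<le> K"
  shows "(\<integral>\<^sup>+x. ennreal (gain x (sel K x)) \<partial>N) = capacity"
proof -
  have ind_meas [measurable]: "(\<lambda>x. indicator {k} (sel K x) :: ennreal) \<in> borel_measurable BN" for k
    by (rule measurable_indicator_sel[OF K])
  have "(\<integral>\<^sup>+x. indicator {k} (sel K x) * ennreal (gain x k) \<partial>N) = (\<integral>\<^sup>+x. indicator {k} (sel K x) * capacity \<partial>N)"
    if k: "k \<in> {1..K}" for k
  proof -
    let ?J = "blk M k 1"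
    have k1: "1 \<le> k" using k by auto
    have sub: "?J \<subseteq> idx M" using k1 by (intro blk_subset) auto
    have [measurable]: "(\<lambda>x. gain x k) \<in> borel_measurable BN" by (rule measurable_gain[OF k1])
    have "(\<integral>\<^sup>+x. indicator {k} (sel K x) * ennreal (gain x k) \<partial>N) =
        (\<integral>\<^sup>+x. \<integral>\<^sup>+z. indicator {k} (sel K (merge (idx M - ?J) ?J (x, z))) *
          ennreal (gain (merge (idx M - ?J) ?J (x, z)) k) \<partial>gprod ?J \<partial>N)"
      by (intro nn_integral_gprod_resample[OF idx_nonempty[OF M] sub]) measurable
    also have "\<dots> = (\<integral>\<^sup>+x. indicator {k} (sel K x) * capacity \<partial>N)"
    proof (rule nn_integral_cong)
      fix x :: "nat \<times> nat \<times> nat \<times> nat \<Rightarrow> complex"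
      let ?m = "\<lambda>z. merge (idx M - ?J) ?J (x, z)"
      have H: "Hm M (?m z) k' i = Hm M x k' i" if "1 \<le> k'" "i \<in> {2, 3}" for z k' i
        using that by (subst Hm_merge) auto
      have sel: "sel K (?m z) = sel K x" for z
        using H by (intro sel_cong metric_cong) auto
      have F: "F (?m z) k = F x k" for z
        using H k1 by (intro F_cong) auto
      have H1: "Hm M (?m z) k 1 = Hm M z k 1" for z using k1 by (subst Hm_merge) auto
      have "(\<integral>\<^sup>+z. ennreal (rate_gain M P (F x k * Hm M z k 1)) \<partial>gprod ?J) = capacity"
        using oia_channel.F_orthonormal[OF chan, of x k]
        by (intro nn_integral_gain_rotated carrier_matI) (simp_all add: F_def[symmetric])
      then show "(\<integral>\<^sup>+z. indicator {k} (sel K (?m z)) * ennreal (gain (?m z) k) \<partial>gprod ?J) =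
          indicator {k} (sel K x) * capacity"
        unfolding gain_def sel F H1 by (cases "sel K x = k") simp_all
    qed
    finally show ?thesis .
  qed
  then have "(\<integral>\<^sup>+x. ennreal (gain x (sel K x)) \<partial>N) = (\<Sum>k = 1..K. \<integral>\<^sup>+x. indicator {k} (sel K x) * capacity \<partial>N)"
    using K by (subst nn_integral_at_sel) auto
  \<comment> \<open>The events \<open>sel K x = k\<close> partition the space, so the indicators add
    up to 1 again.\<close>
  also have "\<dots> = (\<integral>\<^sup>+x. capacity \<partial>N)"
    using nn_integral_at_sel[OF K, of "\<lambda>_ _. capacity"] by simp
  also have "\<dots> = capacity" by (simp add: N.emeasure_space_1)
  finally show ?thesis .
qed

end

section \<open>The loss at the selected user\<close>

context oia
begin

lemma measurable_frob:
  assumes k: "1 \<le> k"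
  shows "(\<lambda>x. frob (Hm M x k 2)) \<in> borel_measurable BN" "(\<lambda>x. frob (Hm M x k 3)) \<in> borel_measurable BN"
proof -
  have "(\<lambda>x. frob (Hm M x k i)) \<in> borel_measurable BN" if i: "i \<in> {1..3}" for i
  proof -
    have [measurable]: "(\<lambda>x. x j) \<in> borel_measurable BN" if "j \<in> blk M k i" for j
      using blk_subset[OF k i] that by (intro measurable_component_singleton) auto
    show ?thesis unfolding frob_Hm by measurable
  qed
  then show "(\<lambda>x. frob (Hm M x k 2)) \<in> borel_measurable BN" "(\<lambda>x. frob (Hm M x k 3)) \<in> borel_measurable BN"
    by auto
qed

lemma user_metric_OIA1_ge_1: "1 \<le> user_metric OIA1 x k"
  using oia_channel.user_rate_bounds(3)[OF chan P] by (simp add: user_metric_def)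

lemma rate_bounds: "rate x k \<le> gain x k" "gain x k - loss x k \<le> rate x k"
  using oia_channel.user_rate_bounds(1,2)[OF chan P]
  by (simp_all add: rate_def gain_def loss_def F_def user_metric_def)

lemma loss_nonneg: "0 \<le> loss x k"
  using user_metric_OIA1_ge_1[of x k] by (simp add: loss_def zero_le_log_cancel_iff)

lemma gain_nonneg: "0 \<le> gain x k"
  unfolding gain_def using P by (intro rate_gain_nonneg carrier_matI) auto

text \<open>This bound holds for either scheme; for OIA1 it supplies both the integrable majorant
  and the arbitrarily small values.\<close>

lemma loss_le_frob: "loss x k \<le> P * (frob (Hm M x k 2) + frob (Hm M x k 3)) / ln 2"
  unfolding loss_def user_metric_def
  by (intro oia_channel.selection_metric_OIA1_le[OF chan P] oia_channel.ev_bounds[OF chan]) auto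

lemma loss_le_chordal:
  assumes "full_rank (Hm M x k 2)" "full_rank (Hm M x k 3)"
  shows "loss x k \<le> P * (user_metric OIA2 x k * frob (Hm M x k 3)) / ln 2"
  unfolding loss_def user_metric_def selection_metric.simps(2)
  by (intro oia_channel.selection_metric_OIA1_le[OF chan P] oia_channel.ev_le_sq_chordal_dist[OF chan] assms)

lemma user_metric_OIA2_bounds:
  assumes "full_rank (Hm M x k 2)" "full_rank (Hm M x k 3)"
  shows "0 \<le> user_metric OIA2 x k" "user_metric OIA2 x k \<le> real M"
  unfolding user_metric_def selection_metric.simps(2)
  using sq_chordal_dist_col_bounds(1,2)[OF Hm_carrier Hm_carrier assms] by auto

section \<open>Almost sure existence of users with little interference\<close>

lemma AE_det_gram_all:
  "AE x in N. \<forall>k\<ge>1. full_rank (Hm M x k 2) \<and>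
     full_rank (Hm M x k 3)"
proof -
  have "AE x in N. 1 \<le> k \<longrightarrow> full_rank (Hm M x k 2) \<and>
     full_rank (Hm M x k 3)" for k
  proof (cases "1 \<le> k")
    case True
    from AE_det_gram_Hm[OF M True, of 2] AE_det_gram_Hm[OF M True, of 3] show ?thesis
      by (auto elim: AE_mp)
  qed simp
  then show ?thesis by (subst AE_all_countable) auto
qed

lemma AE_exists_small_frob:
  assumes "0 < \<epsilon>"
  shows "AE x in N. \<exists>k\<ge>1. frob (Hm M x k 2) + frob (Hm M x k 3) < \<epsilon>"
proof -
  \<comment> \<open>The two matrices have \<open>4 M^2\<close> entries together; the additional 1
    makes the final inequality strict.\<close>
  define \<delta> where "\<delta> = sqrt (\<epsilon> / (4 * real M * real M + 1))"
  have pos: "0 < 4 * real M * real M + 1" by (intro add_nonneg_pos) auto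
  have \<delta>: "0 < \<delta>" "\<delta>\<^sup>2 = \<epsilon> / (4 * real M * real M + 1)"
    using assms pos by (auto simp: \<delta>_def)
  have "AE x in N. \<exists>k\<ge>1. \<forall>j \<in> {2..3} \<times> {..<2 * M} \<times> {..<M}. x (k, j) \<in> ball 0 \<delta>"
    using \<delta> by (intro AE_exists_user_in_box M) auto
  then show ?thesis
  proof eventually_elim
    fix x :: "nat \<times> nat \<times> nat \<times> nat \<Rightarrow> complex"
    assume "\<exists>k\<ge>1. \<forall>j \<in> {2..3} \<times> {..<2 * M} \<times> {..<M}. x (k, j) \<in> ball 0 \<delta>"
    then obtain k where k: "1 \<le> k" "\<And>j. j \<in> {2..3} \<times> {..<2 * M} \<times> {..<M} \<Longrightarrow> x (k, j) \<in> ball 0 \<delta>" by blast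
    have "frob (Hm M x k i) \<le> 2 * real M * real M * \<delta>\<^sup>2" if i: "i \<in> {2..3}" for i
    proof -
      have "frob (Hm M x k i) \<le> (\<Sum>r<2 * M. \<Sum>c<M. \<delta>\<^sup>2)"
        unfolding frob_Hm sum_blk
      proof (intro sum_mono power_mono)
        fix r c assume "r \<in> {..<2 * M}" "c \<in> {..<M}"
        then show "cmod (x (k, i, r, c)) \<le> \<delta>" using k(2)[of "(i, r, c)"] i by auto
      qed auto
      then show ?thesis by (simp add: mult.assoc)
    qed
    from this[of 2] this[of 3] have "frob (Hm M x k 2) + frob (Hm M x k 3) \<le> 4 * real M * real M * \<delta>\<^sup>2" by simp
    also have "\<dots> < (4 * real M * real M + 1) * \<delta>\<^sup>2" using \<delta>(1) by simp
    also have "\<dots> = \<epsilon>" using pos by (simp add: \<delta>(2))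
    finally show "\<exists>k\<ge>1. frob (Hm M x k 2) + frob (Hm M x k 3) < \<epsilon>" using k(1) by blast
  qed
qed

text \<open>The chordal distance is continuous near a pair of equal matrices of full column rank,
  where it vanishes.\<close>

lemma AE_exists_small_chordal:
  assumes "0 < \<epsilon>"
  shows "AE x in N. \<exists>k\<ge>1. user_metric OIA2 x k < \<epsilon>"
proof -
  define Y where "Y i y = mat (2 * M) M (\<lambda>(r, c). y (i, r, c))" for i :: nat and y :: "nat \<times> nat \<times> nat \<Rightarrow> complex"
  define g where "g i y = det (mat_adjoint (Y i y) * Y i y)" for i y
  define U where "U = {y. g 2 y \<noteq> 0 \<and> g 3 y \<noteq> 0}"
  define d where "d y = real M - Re (mat_trace (colproj (Y 2 y) * colproj (Y 3 y)))" for y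
  have Yc: "Y i y \<in> carrier_mat (2 * M) M" for i y by (simp add: Y_def)
  interpret fu: fun_algebra "{f. continuous_on UNIV f}" by (rule fun_algebra_continuous)
  interpret fU: fun_algebra "{f. continuous_on U f}" by (rule fun_algebra_continuous)
  have "fu.mat_in (2 * M) M (Y i)" for i
    by (intro fu.mat_inI) (auto simp: Y_def intro!: continuous_on_product_coordinates)
  then have "g i \<in> {f. continuous_on UNIV f}" for i
    unfolding g_def by (intro fu.det_in[where n = M] fu.mat_in_mult[where m = "2 * M"] fu.mat_in_adjoint)
  then have g: "continuous_on S (g i)" for i S
    using continuous_on_subset by blast
  have "open {y. g i y \<noteq> 0}" for i
    using g[of UNIV i] by (intro open_Collect_neq) (auto intro: continuous_intros)
  then have U: "open U" unfolding U_def by (intro open_Collect_conj)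
  have Y_in: "fU.mat_in (2 * M) M (Y i)" for i
    by (intro fU.mat_inI) (auto simp: Y_def intro!: continuous_on_subset[OF continuous_on_product_coordinates])
  have proj: "fU.mat_in (2 * M) (2 * M) (\<lambda>y. colproj (Y i y))" if "i \<in> {2, 3}" for i
  proof (rule fU.mat_in_colproj[OF Y_in])
    show "(\<lambda>y. inverse (det (mat_adjoint (Y i y) * Y i y))) \<in> {f. continuous_on U f}"
      using that g[of U i] unfolding g_def[symmetric]
      by (auto simp: U_def intro!: continuous_intros)
  qed
  have "(\<lambda>y. mat_trace (colproj (Y 2 y) * colproj (Y 3 y))) \<in> {f. continuous_on U f}"
    by (rule fU.trace_in[OF fU.mat_in_mult[OF proj proj]]) auto
  then have "continuous_on U d" unfolding d_def by (auto intro!: continuous_intros)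
  then have S: "open (U \<inter> d -` {..<\<epsilon>})"
    by (rule continuous_open_preimage[OF _ U]) simp
  \<comment> \<open>The identity on top of zeros, used for both matrices: its columns are
    orthonormal, and a space has distance 0 from itself.\<close>
  define e :: "nat \<times> nat \<times> nat \<Rightarrow> complex" where "e = (\<lambda>(i, r, c). if r = c then 1 else 0)"
  have eU: "e \<in> U \<inter> d -` {..<\<epsilon>}"
  proof -
    define E where "E = Y 2 e"
    have E: "Y 3 e = E" "E \<in> carrier_mat (2 * M) M" by (simp_all add: E_def Y_def e_def)
    have EE: "mat_adjoint E * E = 1\<^sub>m M"
      by (rule eq_matI) (auto simp: E_def Y_def e_def scalar_prod_def atLeast0LessThan if_distrib[of cnj] if_distrib[of "\<lambda>z. z * _"] cong: if_cong)
    have onb: "orthonormal_basis_mat E E" using E(2) EE by (simp add: orthonormal_basis_mat_def)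
    have "sq_chordal_dist E E = 0"
    proof -
      have "mat_adjoint E * E * mat_adjoint E * E = 1\<^sub>m M"
        using E(2) EE by (simp add: assoc_mult_mat_dim)
      then show ?thesis using E(2) by (simp add: sq_chordal_dist_def mat_trace_one)
    qed
    then have "d e = 0"
      using sq_chordal_dist_eq_colproj[OF E(2) E(2) onb onb] by (simp add: d_def E(1) flip: E_def)
    moreover have "g 2 e = 1" "g 3 e = 1" using EE E(1) by (simp_all add: g_def flip: E_def)
    ultimately show ?thesis using assms by (simp add: U_def)
  qed
  have "openin (product_topology (\<lambda>_. euclidean) UNIV) (U \<inter> d -` {..<\<epsilon>})"
    using S by (simp add: open_fun_def)
  \<comment> \<open>An open set of the product topology contains a box around \<open>e\<close>, and
    boxes are what \<open>AE_exists_user_in_box\<close> can hit.\<close>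
  from product_topology_open_contains_basis[OF this eU]
  obtain A where A: "e \<in> (\<Pi>\<^sub>E i\<in>UNIV. A i)" "\<And>i. openin euclidean (A i)" "(\<Pi>\<^sub>E i\<in>UNIV. A i) \<subseteq> U \<inter> d -` {..<\<epsilon>}"
    by blast
  have "AE x in N. \<exists>k\<ge>1. \<forall>j \<in> {2..3} \<times> {..<2 * M} \<times> {..<M}. x (k, j) \<in> A j"
    using A(1,2) by (intro AE_exists_user_in_box M) auto
  then show ?thesis
  proof eventually_elim
    fix x :: "nat \<times> nat \<times> nat \<times> nat \<Rightarrow> complex"
    assume "\<exists>k\<ge>1. \<forall>j \<in> {2..3} \<times> {..<2 * M} \<times> {..<M}. x (k, j) \<in> A j"
    then obtain k where k: "1 \<le> k" "\<And>j. j \<in> {2..3} \<times> {..<2 * M} \<times> {..<M} \<Longrightarrow> x (k, j) \<in> A j" by blast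
    \<comment> \<open>The box constrains all index triples, while the channels of user
      \<open>k\<close> fill only finitely many of them; \<open>e\<close> fills the rest.\<close>
    define y where "y j = (if j \<in> {2..3} \<times> {..<2 * M} \<times> {..<M} then x (k, j) else e j)" for j
    have "y \<in> (\<Pi>\<^sub>E i\<in>UNIV. A i)" using A(1) k(2) by (auto simp: y_def)
    then have y: "y \<in> U" "d y < \<epsilon>" using A(3) by auto
    have H: "Hm M x k i = Y i y" if "i \<in> {2..3}" for i
      using that by (auto simp: Hm_def Y_def y_def intro!: eq_matI)
    have "user_metric OIA2 x k = d y"
      using y(1) unfolding user_metric_def selection_metric.simps sq_chordal_dist_col_eq[OF Hm_carrier Hm_carrier]
      by (simp add: H U_def d_def g_def)
    then show "\<exists>k\<ge>1. user_metric OIA2 x k < \<epsilon>" using y(2) k(1) by auto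
  qed
qed

text \<open>The loss is the logarithm of the metric that OIA1 minimizes, so the selected user also
  minimizes the loss itself.\<close>

lemma nn_integral_loss_OIA1:
  assumes s: "s = OIA1"
  shows "(\<lambda>K. \<integral>\<^sup>+x. ennreal (loss x (sel K x)) \<partial>N) \<longlonglongrightarrow> 0"
proof (rule nn_integral_minimum_tendsto_0)
  show "(\<lambda>x. loss x k) \<in> borel_measurable N" if "1 \<le> k" for k
    using measurable_loss[OF that] by (simp cong: measurable_cong_sets)
  show "sel K \<in> N \<rightarrow>\<^sub>M count_space {1..K}" if "1 \<le> K" for K
    using measurable_sel[OF that] by (simp cong: measurable_cong_sets)
  show "loss x (sel K x) \<le> loss x k" if "k \<in> {1..K}" for x K k
  proof -
    have "user_metric OIA1 x (sel K x) \<le> user_metric OIA1 x k"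
      using metric_sel_le[of K k x] that s by auto
    then show ?thesis
      using user_metric_OIA1_ge_1[of x "sel K x"] unfolding loss_def by (subst log_le_cancel_iff) auto
  qed
  have "ennreal (loss x 1) \<le> ennreal (P / ln 2) * (ennreal (frob (Hm M x 1 2)) + ennreal (frob (Hm M x 1 3)))" for x
  proof -
    have "ennreal (loss x 1) \<le> ennreal (P / ln 2 * (frob (Hm M x 1 2) + frob (Hm M x 1 3)))"
      using loss_le_frob[of x 1] by (intro ennreal_leI) simp
    also have "\<dots> = ennreal (P / ln 2) * ennreal (frob (Hm M x 1 2) + frob (Hm M x 1 3))"
      using P by (intro ennreal_mult') simp
    also have "ennreal (frob (Hm M x 1 2) + frob (Hm M x 1 3)) = ennreal (frob (Hm M x 1 2)) + ennreal (frob (Hm M x 1 3))"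
      by (intro ennreal_plus frob_nonneg)
    finally show ?thesis .
  qed
  then have "(\<integral>\<^sup>+x. ennreal (loss x 1) \<partial>N) \<le>
      (\<integral>\<^sup>+x. ennreal (P / ln 2) * (ennreal (frob (Hm M x 1 2)) + ennreal (frob (Hm M x 1 3))) \<partial>N)"
    by (intro nn_integral_mono)
  also have "\<dots> = ennreal (P / ln 2) * ((\<integral>\<^sup>+x. ennreal (frob (Hm M x 1 2)) \<partial>N) + (\<integral>\<^sup>+x. ennreal (frob (Hm M x 1 3)) \<partial>N))"
    using measurable_frob by (simp add: nn_integral_cmult nn_integral_add cong: measurable_cong_sets)
  also have "\<dots> < \<infinity>"
    using nn_integral_frob_Hm_finite[OF M, of 1 2] nn_integral_frob_Hm_finite[OF M, of 1 3]
    by (simp add: ennreal_mult_less_top)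
  finally show "(\<integral>\<^sup>+x. ennreal (loss x 1) \<partial>N) < \<infinity>" .
  fix \<epsilon> :: real assume "0 < \<epsilon>"
  then have "0 < \<epsilon> * ln 2 / P" using P by simp
  from AE_exists_small_frob[OF this] show "AE x in N. \<exists>k\<ge>1. loss x k < \<epsilon>"
  proof eventually_elim
    fix x assume "\<exists>k\<ge>1. frob (Hm M x k 2) + frob (Hm M x k 3) < \<epsilon> * ln 2 / P"
    then obtain k where k: "1 \<le> k" "frob (Hm M x k 2) + frob (Hm M x k 3) < \<epsilon> * ln 2 / P" by blast
    have "P * (frob (Hm M x k 2) + frob (Hm M x k 3)) / ln 2 < \<epsilon>"
      using k(2) P by (simp add: field_simps)
    then show "\<exists>k\<ge>1. loss x k < \<epsilon>" using loss_le_frob[of x k] k(1) by (intro exI[of _ k]) auto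
  qed
qed

text \<open>The chordal distance is invariant under scaling of \<open>Hm M x k 3\<close>, so the exponential weight
  can be absorbed by a change of variables.\<close>

lemma nn_integral_tilted_metric_sel:
  assumes s: "s = OIA2" and K: "1 \<le> K"
  shows "(\<integral>\<^sup>+x. ennreal (user_metric s x (sel K x)) * ennreal (exp (3 / 4 * frob (Hm M x (sel K x) 3))) \<partial>N) =
    4 ^ (2 * M * M) * (\<integral>\<^sup>+x. ennreal (user_metric s x (sel K x)) \<partial>N)"
proof -
  have [measurable]: "(\<lambda>x. indicator {k} (sel K x) :: ennreal) \<in> borel_measurable BN" for k
    by (rule measurable_indicator_sel[OF K])
  have step: "(\<integral>\<^sup>+x. indicator {k} (sel K x) * (ennreal (user_metric s x k) * ennreal (exp (3 / 4 * frob (Hm M x k 3)))) \<partial>N) =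
      4 ^ (2 * M * M) * (\<integral>\<^sup>+x. indicator {k} (sel K x) * ennreal (user_metric s x k) \<partial>N)"
    if k: "k \<in> {1..K}" for k
  proof -
    let ?J = "blk M k 3"
    let ?m = "\<lambda>x z. merge (idx M - ?J) ?J (x, z)"
    have k1: "1 \<le> k" using k by auto
    have sub: "?J \<subseteq> idx M" using k1 by (intro blk_subset) auto
    define f where "f x = indicator {k} (sel K x) * ennreal (user_metric s x k)" for x
    have [measurable]: "(\<lambda>x. user_metric s x k) \<in> borel_measurable BN" "(\<lambda>x. frob (Hm M x k 3)) \<in> borel_measurable BN"
      using measurable_metric[OF k1] measurable_frob[OF k1] by auto
    have f [measurable]: "f \<in> borel_measurable BN" unfolding f_def by measurable
    have card: "card ?J = 2 * M * M" by (simp add: blk_def card_cartesian_product)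
    have H3: "Hm M (?m x z) k 3 = Hm M z k 3" for x z using k1 by (subst Hm_merge) auto
    have "(\<integral>\<^sup>+x. indicator {k} (sel K x) * (ennreal (user_metric s x k) * ennreal (exp (3 / 4 * frob (Hm M x k 3)))) \<partial>N) =
        (\<integral>\<^sup>+x. f x * ennreal (exp (3 / 4 * frob (Hm M x k 3))) \<partial>N)"
      by (simp add: f_def mult.assoc)
    also have "\<dots> = (\<integral>\<^sup>+x. \<integral>\<^sup>+z. f (?m x z) * ennreal (exp (3 / 4 * frob (Hm M (?m x z) k 3))) \<partial>gprod ?J \<partial>N)"
      by (intro nn_integral_gprod_resample[OF idx_nonempty[OF M] sub]) measurable
    also have "\<dots> = (\<integral>\<^sup>+x. 4 ^ (2 * M * M) * (\<integral>\<^sup>+z. f (?m x z) \<partial>gprod ?J) \<partial>N)"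
    proof (rule nn_integral_cong)
      fix x assume x: "x \<in> space N"
      have fm: "(\<lambda>z. f (?m x z)) \<in> borel_measurable (bprod ?J)"
        by (rule measurable_compose[OF measurable_merge_right[OF x sub] f])
      \<comment> \<open>Doubling the third channel of user \<open>k\<close> changes no metric: that
        of user \<open>k\<close> by scale invariance, those of the other users because they do not
        contain this block. Hence the selection is unchanged as well.\<close>
      have inv: "f (?m x (\<lambda>j\<in>?J. 2 * z j)) = f (?m x z)" for z
      proof -
        have "user_metric s (?m x (\<lambda>j\<in>?J. 2 * z j)) k' = user_metric s (?m x z) k'" if k': "1 \<le> k'" for k'
        proof (cases "k' = k")
          case True
          have H2: "Hm M (?m x w) k 2 = Hm M x k 2" for w
            using k1 by (subst Hm_merge) auto
          show ?thesis
            unfolding True s user_metric_def selection_metric.simps H3 H2 Hm_scale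
            by (intro sq_chordal_dist_col_smult[OF Hm_carrier Hm_carrier]) simp
        next
          case False
          then show ?thesis using k' by (intro metric_cong) (auto simp: Hm_merge)
        qed
        moreover from this have "sel K (?m x (\<lambda>j\<in>?J. 2 * z j)) = sel K (?m x z)" by (intro sel_cong) auto
        ultimately show ?thesis using k1 by (simp add: f_def)
      qed
      have "(\<integral>\<^sup>+z. f (?m x z) * ennreal (exp (3 / 4 * frob (Hm M (?m x z) k 3))) \<partial>gprod ?J) =
          4 ^ card ?J * (\<integral>\<^sup>+z. f (?m x (\<lambda>j\<in>?J. 2 * z j)) \<partial>gprod ?J)"
        unfolding H3 frob_Hm by (rule nn_integral_gprod_tilt[OF finite_blk fm])
      then show "(\<integral>\<^sup>+z. f (?m x z) * ennreal (exp (3 / 4 * frob (Hm M (?m x z) k 3))) \<partial>gprod ?J) =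
          4 ^ (2 * M * M) * (\<integral>\<^sup>+z. f (?m x z) \<partial>gprod ?J)"
        unfolding inv card .
    qed
    also have "\<dots> = 4 ^ (2 * M * M) * (\<integral>\<^sup>+x. \<integral>\<^sup>+z. f (?m x z) \<partial>gprod ?J \<partial>N)"
    proof (rule nn_integral_cmult)
      interpret J: prob_space "gprod ?J" by (rule prob_space_PiM_cgauss)
      \<comment> \<open>\<open>merge\<close> ignores \<open>x\<close> on the block; restricting
        \<open>x\<close> first puts the pair into the domain of
        \<open>measurable_merge\<close>.\<close>
      have "(\<lambda>p. f (merge (idx M - ?J) ?J (restrict (fst p) (idx M - ?J), snd p))) \<in> borel_measurable (N \<Otimes>\<^sub>M gprod ?J)"
      proof (rule measurable_compose[OF _ f])
        have un: "idx M - ?J \<union> ?J = idx M" using sub by auto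
        have "(\<lambda>x. restrict x (idx M - ?J)) \<in> BN \<rightarrow>\<^sub>M bprod (idx M - ?J)"
          by (rule measurable_restrict_subset) auto
        then have r: "(\<lambda>x. restrict x (idx M - ?J)) \<in> N \<rightarrow>\<^sub>M bprod (idx M - ?J)"
          by (subst measurable_cong_sets[OF sets_PiM_cgauss refl])
        have "(\<lambda>p. (restrict (fst p) (idx M - ?J), snd p)) \<in> N \<Otimes>\<^sub>M gprod ?J \<rightarrow>\<^sub>M
            bprod (idx M - ?J) \<Otimes>\<^sub>M bprod ?J"
          by (intro measurable_Pair measurable_compose[OF measurable_fst r]
            measurable_compose[OF measurable_snd measurable_ident_sets[OF sets_PiM_cgauss]])
        from measurable_compose[OF this measurable_merge[of "idx M - ?J" ?J "\<lambda>_. borel", unfolded un]]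
        show "(\<lambda>p. merge (idx M - ?J) ?J (restrict (fst p) (idx M - ?J), snd p)) \<in> N \<Otimes>\<^sub>M gprod ?J \<rightarrow>\<^sub>M BN" .
      qed
      then have "(\<lambda>p. f (?m (fst p) (snd p))) \<in> borel_measurable (N \<Otimes>\<^sub>M gprod ?J)" by simp
      then show "(\<lambda>x. \<integral>\<^sup>+z. f (?m x z) \<partial>gprod ?J) \<in> borel_measurable N"
        using J.borel_measurable_nn_integral_fst[of "\<lambda>p. f (?m (fst p) (snd p))" N] by simp
    qed
    also have "(\<integral>\<^sup>+x. \<integral>\<^sup>+z. f (?m x z) \<partial>gprod ?J \<partial>N) = (\<integral>\<^sup>+x. f x \<partial>N)"
      by (rule nn_integral_gprod_resample[OF idx_nonempty[OF M] sub f, symmetric])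
    finally show ?thesis by (simp add: f_def)
  qed
  have "(\<integral>\<^sup>+x. ennreal (user_metric s x (sel K x)) * ennreal (exp (3 / 4 * frob (Hm M x (sel K x) 3))) \<partial>N) =
      (\<Sum>k = 1..K. \<integral>\<^sup>+x. indicator {k} (sel K x) * (ennreal (user_metric s x k) * ennreal (exp (3 / 4 * frob (Hm M x k 3)))) \<partial>N)"
  proof (rule nn_integral_at_sel[OF K])
    fix k :: nat assume k: "1 \<le> k"
    have [measurable]: "(\<lambda>x. user_metric s x k) \<in> borel_measurable BN" "(\<lambda>x. frob (Hm M x k 3)) \<in> borel_measurable BN"
      using measurable_metric[OF k] measurable_frob[OF k] by auto
    show "(\<lambda>x. ennreal (user_metric s x k) * ennreal (exp (3 / 4 * frob (Hm M x k 3)))) \<in> borel_measurable BN"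
      by measurable
  qed
  also have "\<dots> = 4 ^ (2 * M * M) * (\<Sum>k = 1..K. \<integral>\<^sup>+x. indicator {k} (sel K x) * ennreal (user_metric s x k) \<partial>N)"
    using step by (simp add: sum_distrib_left)
  also have "(\<Sum>k = 1..K. \<integral>\<^sup>+x. indicator {k} (sel K x) * ennreal (user_metric s x k) \<partial>N) =
      (\<integral>\<^sup>+x. ennreal (user_metric s x (sel K x)) \<partial>N)"
    by (rule nn_integral_at_sel[OF K, symmetric]) (auto intro: measurable_metric)
  finally show ?thesis .
qed

text \<open>As \<open>C\<close> does not depend on \<open>K\<close>, it remains to treat the metric
  alone, a minimum of variables that almost surely lie between 0 and \<open>M\<close>.\<close>

lemma nn_integral_loss_OIA2:
  assumes s: "s = OIA2"
  shows "(\<lambda>K. \<integral>\<^sup>+x. ennreal (loss x (sel K x)) \<partial>N) \<longlonglongrightarrow> 0"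
proof -
  define C where "C = ennreal (2 * P / ln 2) * 4 ^ (2 * M * M)"
  have bound: "(\<integral>\<^sup>+x. ennreal (loss x (sel K x)) \<partial>N) \<le> C * (\<integral>\<^sup>+x. ennreal (user_metric s x (sel K x)) \<partial>N)"
    if K: "1 \<le> K" for K
  proof -
    have "AE x in N. ennreal (loss x (sel K x)) \<le>
        ennreal (2 * P / ln 2) * (ennreal (user_metric s x (sel K x)) * ennreal (exp (3 / 4 * frob (Hm M x (sel K x) 3))))"
      using AE_det_gram_all
    proof eventually_elim
      fix x assume x: "\<forall>k\<ge>1. full_rank (Hm M x k 2) \<and>
        full_rank (Hm M x k 3)"
      define k where "k = sel K x"
      have "1 \<le> k" using sel_in[OF K, of x] by (simp add: k_def)
      then have det: "full_rank (Hm M x k 2)" "full_rank (Hm M x k 3)"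
        using x by auto
      let ?d = "user_metric s x k" and ?n = "frob (Hm M x k 3)"
      have d: "0 \<le> ?d" using user_metric_OIA2_bounds[OF det] s by simp
      have n: "?n \<le> 2 * exp (3 / 4 * ?n)"
        using exp_ge_add_one_self[of "3 / 4 * ?n"] frob_nonneg[of "Hm M x k 3"] by linarith
      have "loss x k \<le> P * (?d * ?n) / ln 2" using loss_le_chordal[OF det] s by simp
      also have "\<dots> \<le> P * (?d * (2 * exp (3 / 4 * ?n))) / ln 2"
        using d n P by (intro divide_right_mono mult_left_mono) auto
      also have "\<dots> = 2 * P / ln 2 * (?d * exp (3 / 4 * ?n))" by simp
      finally have "ennreal (loss x k) \<le> ennreal (2 * P / ln 2 * (?d * exp (3 / 4 * ?n)))" by (rule ennreal_leI)
      also have "\<dots> = ennreal (2 * P / ln 2) * ennreal (?d * exp (3 / 4 * ?n))"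
        using P by (intro ennreal_mult') simp
      also have "ennreal (?d * exp (3 / 4 * ?n)) = ennreal ?d * ennreal (exp (3 / 4 * ?n))"
        using d by (intro ennreal_mult')
      finally show "ennreal (loss x (sel K x)) \<le>
        ennreal (2 * P / ln 2) * (ennreal (user_metric s x (sel K x)) * ennreal (exp (3 / 4 * frob (Hm M x (sel K x) 3))))"
        by (simp only: k_def)
    qed
    then have "(\<integral>\<^sup>+x. ennreal (loss x (sel K x)) \<partial>N) \<le>
        (\<integral>\<^sup>+x. ennreal (2 * P / ln 2) * (ennreal (user_metric s x (sel K x)) * ennreal (exp (3 / 4 * frob (Hm M x (sel K x) 3)))) \<partial>N)"
      by (rule nn_integral_mono_AE)
    also have "\<dots> = ennreal (2 * P / ln 2) *
        (\<integral>\<^sup>+x. ennreal (user_metric s x (sel K x)) * ennreal (exp (3 / 4 * frob (Hm M x (sel K x) 3))) \<partial>N)"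
    proof (rule nn_integral_cmult)
      have [measurable]: "(\<lambda>x. user_metric s x (sel K x)) \<in> borel_measurable BN"
        "(\<lambda>x. frob (Hm M x (sel K x) 3)) \<in> borel_measurable BN"
        by (auto intro!: measurable_at_sel[OF K] measurable_metric measurable_frob)
      show "(\<lambda>x. ennreal (user_metric s x (sel K x)) * ennreal (exp (3 / 4 * frob (Hm M x (sel K x) 3)))) \<in> borel_measurable N"
        by measurable
    qed
    also have "\<dots> = C * (\<integral>\<^sup>+x. ennreal (user_metric s x (sel K x)) \<partial>N)"
      unfolding nn_integral_tilted_metric_sel[OF s K] C_def by (simp only: mult.assoc)
    finally show ?thesis .
  qed
  have "(\<lambda>K. \<integral>\<^sup>+x. ennreal (user_metric s x (sel K x)) \<partial>N) \<longlonglongrightarrow> 0"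
  proof (rule nn_integral_minimum_tendsto_0)
    show "(\<lambda>x. user_metric s x k) \<in> borel_measurable N" if "1 \<le> k" for k
      using measurable_metric[OF that] by (simp cong: measurable_cong_sets)
    show "sel K \<in> N \<rightarrow>\<^sub>M count_space {1..K}" if "1 \<le> K" for K
      using measurable_sel[OF that] by (simp cong: measurable_cong_sets)
    show "user_metric s x (sel K x) \<le> user_metric s x k" if "k \<in> {1..K}" for x K k
      using metric_sel_le[of K k x] that by auto
    have "AE x in N. ennreal (user_metric s x 1) \<le> ennreal (real M)"
      using AE_det_gram_all by eventually_elim (use user_metric_OIA2_bounds(2) s in \<open>auto intro!: ennreal_leI\<close>)
    then have "(\<integral>\<^sup>+x. ennreal (user_metric s x 1) \<partial>N) \<le> (\<integral>\<^sup>+x. ennreal (real M) \<partial>N)"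
      by (rule nn_integral_mono_AE)
    also have "\<dots> < \<infinity>" by (simp add: N.emeasure_space_1)
    finally show "(\<integral>\<^sup>+x. ennreal (user_metric s x 1) \<partial>N) < \<infinity>" .
    show "AE x in N. \<exists>k\<ge>1. user_metric s x k < \<epsilon>" if "0 < \<epsilon>" for \<epsilon>
      using AE_exists_small_chordal[OF that] s by simp
  qed
  moreover have "C < \<infinity>" by (simp add: C_def ennreal_mult_less_top power_less_top_ennreal)
  ultimately have "(\<lambda>K. C * (\<integral>\<^sup>+x. ennreal (user_metric s x (sel K x)) \<partial>N)) \<longlonglongrightarrow> C * 0"
    by (intro tendsto_mult_ennreal tendsto_const) auto
  then have lim: "(\<lambda>K. C * (\<integral>\<^sup>+x. ennreal (user_metric s x (sel K x)) \<partial>N)) \<longlonglongrightarrow> 0" by simp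
  show ?thesis
  proof (rule tendsto_sandwich[OF _ _ tendsto_const lim])
    show "\<forall>\<^sub>F K in sequentially. (\<integral>\<^sup>+x. ennreal (loss x (sel K x)) \<partial>N) \<le> C * (\<integral>\<^sup>+x. ennreal (user_metric s x (sel K x)) \<partial>N)"
      using eventually_ge_at_top[of 1] by eventually_elim (rule bound)
  qed simp
qed

lemma nn_integral_loss_tendsto_0:
  "(\<lambda>K. \<integral>\<^sup>+x. ennreal (loss x (sel K x)) \<partial>N) \<longlonglongrightarrow> 0"
  using nn_integral_loss_OIA1 nn_integral_loss_OIA2 by (cases s) auto

end

section \<open>The limit of the average rate\<close>

text \<open>The Leibniz formula has \<open>fact n\<close> terms; such a crude bound suffices because
  only its logarithm is used.\<close>

lemma cmod_det_le:
  fixes A :: "complex mat"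
  assumes A: "A \<in> carrier_mat n n" and b: "\<And>i j. i < n \<Longrightarrow> j < n \<Longrightarrow> cmod (A $$ (i, j)) \<le> b"
  shows "cmod (det A) \<le> fact n * b ^ n"
proof -
  have "cmod (det A) \<le> (\<Sum>p | p permutes {0..<n}. b ^ n)"
    unfolding det_def'[OF A]
  proof (rule sum_norm_le)
    fix p assume "p \<in> {p. p permutes {0..<n}}"
    then have p: "p permutes {0..<n}" by simp
    have "cmod (signof p * (\<Prod>i = 0..<n. A $$ (i, p i))) = (\<Prod>i = 0..<n. cmod (A $$ (i, p i)))"
      by (simp add: norm_mult prod_norm sign_def)
    also have "\<dots> \<le> (\<Prod>i = 0..<n. b)"
      using permutes_in_image[OF p] by (intro prod_mono) (auto intro!: b)
    finally show "cmod (signof p * (\<Prod>i = 0..<n. A $$ (i, p i))) \<le> b ^ n" by simp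
  qed
  also have "\<dots> = fact n * b ^ n"
    using card_permutations[of "{0..<n}" n] by simp
  finally show ?thesis .
qed

text \<open>The determinant grows at most polynomially in \<open>frob Z\<close>, so its logarithm
  grows at most linearly, which makes the capacity finite.\<close>

lemma rate_gain_le:
  assumes Z: "Z \<in> carrier_mat M M" and M: "1 \<le> M" and P: "0 < P"
  shows "rate_gain M P Z \<le> log 2 (fact M) + P * frob Z / ln 2"
proof -
  define c where "c = P / real M"
  have c: "0 < c" using P M by (simp add: c_def)
  let ?A = "1\<^sub>m M + complex_of_real c \<cdot>\<^sub>m (Z * mat_adjoint Z)"
  have dims: "dim_row Z = M" "dim_col Z = M" using Z by auto
  have row: "(\<Sum>l<M. (cmod (Z $$ (i, l)))\<^sup>2) \<le> frob Z" if "i < M" for i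
    unfolding frob_def dims using that
    by (intro member_le_sum[of i "{..<M}" "\<lambda>i. \<Sum>l<M. (cmod (Z $$ (i, l)))\<^sup>2"]) (auto intro: sum_nonneg)
  have entry: "cmod (?A $$ (i, j)) \<le> 1 + c * frob Z" if ij: "i < M" "j < M" for i j
  proof -
    have "cmod ((Z * mat_adjoint Z) $$ (i, j)) \<le> (\<Sum>l<M. cmod (Z $$ (i, l)) * cmod (Z $$ (j, l)))"
      using ij dims by (auto simp: scalar_prod_def atLeast0LessThan norm_mult intro!: sum_norm_le)
    also have "\<dots> \<le> (\<Sum>l<M. ((cmod (Z $$ (i, l)))\<^sup>2 + (cmod (Z $$ (j, l)))\<^sup>2) / 2)"
    proof (rule sum_mono)
      fix l
      have "0 \<le> (cmod (Z $$ (i, l)) - cmod (Z $$ (j, l)))\<^sup>2" by simp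
      then show "cmod (Z $$ (i, l)) * cmod (Z $$ (j, l)) \<le> ((cmod (Z $$ (i, l)))\<^sup>2 + (cmod (Z $$ (j, l)))\<^sup>2) / 2"
        by (simp add: power2_diff)
    qed
    also have "\<dots> = ((\<Sum>l<M. (cmod (Z $$ (i, l)))\<^sup>2) + (\<Sum>l<M. (cmod (Z $$ (j, l)))\<^sup>2)) / 2"
      by (simp add: sum.distrib flip: sum_divide_distrib)
    also have "\<dots> \<le> frob Z" using row[OF ij(1)] row[OF ij(2)] by simp
    finally have "c * cmod ((Z * mat_adjoint Z) $$ (i, j)) \<le> c * frob Z"
      using c by (intro mult_left_mono) auto
    moreover have "cmod (?A $$ (i, j)) \<le> cmod (1\<^sub>m M $$ (i, j)) + c * cmod ((Z * mat_adjoint Z) $$ (i, j))"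
      using ij dims c norm_triangle_ineq[of "1\<^sub>m M $$ (i, j)" "complex_of_real c * (Z * mat_adjoint Z) $$ (i, j)"]
      by (simp add: norm_mult del: index_mult_mat(1))
    moreover have "cmod (1\<^sub>m M $$ (i, j)) \<le> 1" using ij by simp
    ultimately show ?thesis by linarith
  qed
  have "cmod (det ?A) \<le> fact M * (1 + c * frob Z) ^ M"
    using dims by (intro cmod_det_le entry carrier_matI) auto
  then have upper: "Re (det ?A) \<le> fact M * (1 + c * frob Z) ^ M"
    using complex_Re_le_cmod[of "det ?A"] by linarith
  have "?A = add_diag (complex_of_real c \<cdot>\<^sub>m (Z * mat_adjoint Z)) (\<lambda>_. 1)"
    using dims by (intro eq_matI) (auto simp: add_diag_def)
  then have lower: "1 \<le> Re (det ?A)"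
    using psd_det_add_one_ge_1[OF psd_smult_gram[OF Z, of c]] c by simp
  have pos: "0 < 1 + c * frob Z" using c by (intro add_pos_nonneg) auto
  have "rate_gain M P Z = log 2 (Re (det ?A))" by (simp add: rate_gain_def log2_det_def c_def)
  also have "\<dots> \<le> log 2 (fact M * (1 + c * frob Z) ^ M)"
    using upper lower pos by (subst log_le_cancel_iff) auto
  also have "\<dots> = log 2 (fact M) + real M * log 2 (1 + c * frob Z)"
    using pos by (subst log_mult_pos) (auto simp: log_nat_power)
  also have "real M * log 2 (1 + c * frob Z) \<le> real M * (c * frob Z / ln 2)"
    using ln_add_one_self_le_self[of "c * frob Z"] c
    by (intro mult_left_mono) (auto simp: log_def divide_right_mono)
  also have "real M * (c * frob Z / ln 2) = P * frob Z / ln 2"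
    using M by (simp add: c_def)
  finally show ?thesis by simp
qed

context oia
begin

lemma capacity_finite: "capacity < \<infinity>"
proof -
  let ?I = "{..<M} \<times> {..<M}"
  interpret I: prob_space "gprod ?I" by (rule prob_space_PiM_cgauss)
  have frob: "frob (mat M M z) = (\<Sum>j\<in>?I. (cmod (z j))\<^sup>2)" for z
    by (simp add: frob_def sum.cartesian_product case_prod_beta')
  have [measurable]: "(\<lambda>z. \<Sum>j\<in>?I. (cmod (z j))\<^sup>2) \<in> borel_measurable (bprod ?I)"
  proof (rule borel_measurable_sum)
    fix j assume "j \<in> ?I"
    then have [measurable]: "(\<lambda>z. z j) \<in> borel_measurable (PiM ?I (\<lambda>_. borel :: complex measure))"
      by (rule measurable_component_singleton)
    show "(\<lambda>z :: nat \<times> nat \<Rightarrow> complex. (cmod (z j))\<^sup>2) \<in> borel_measurable (bprod ?I)" by measurable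
  qed
  have "ennreal (rate_gain M P (mat M M z)) \<le>
      ennreal (log 2 (fact M)) + ennreal (P / ln 2) * ennreal (\<Sum>j\<in>?I. (cmod (z j))\<^sup>2)" for z
  proof -
    have "ennreal (rate_gain M P (mat M M z)) \<le> ennreal (log 2 (fact M) + P / ln 2 * frob (mat M M z))"
      using rate_gain_le[of "mat M M z" M P] M P by (intro ennreal_leI) simp
    also have "\<dots> = ennreal (log 2 (fact M)) + ennreal (P / ln 2 * frob (mat M M z))"
      using P by (intro ennreal_plus) (auto simp: zero_le_log_cancel_iff fact_ge_1)
    also have "ennreal (P / ln 2 * frob (mat M M z)) = ennreal (P / ln 2) * ennreal (frob (mat M M z))"
      using P by (intro ennreal_mult') simp
    finally show ?thesis by (simp only: frob)
  qed
  then have "capacity \<le> (\<integral>\<^sup>+z. ennreal (log 2 (fact M)) + ennreal (P / ln 2) * ennreal (\<Sum>j\<in>?I. (cmod (z j))\<^sup>2) \<partial>gprod ?I)"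
    unfolding capacity_def by (intro nn_integral_mono)
  also have "\<dots> = ennreal (log 2 (fact M)) + ennreal (P / ln 2) * (\<integral>\<^sup>+z. ennreal (\<Sum>j\<in>?I. (cmod (z j))\<^sup>2) \<partial>gprod ?I)"
    by (subst nn_integral_add, simp, measurable) (simp add: nn_integral_cmult I.emeasure_space_1)
  also have "\<dots> < \<infinity>"
    using nn_integral_frob_gprod_finite[of ?I] by (simp add: ennreal_mult_less_top)
  finally show ?thesis .
qed

lemma integral_rate_gain_mat:
  "(\<integral>z. rate_gain M P (mat M M z) \<partial>gprod ({..<M} \<times> {..<M})) = enn2real capacity"
  unfolding capacity_def
  using measurable_rate_gain_mat P
  by (intro integral_eq_nn_integral) (auto intro!: rate_gain_nonneg cong: measurable_cong_sets)

lemma integral_rate_tendsto: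
  "(\<lambda>K. \<integral>x. rate x (sel K x) \<partial>N) \<longlonglongrightarrow> (\<integral>z. rate_gain M P (mat M M z) \<partial>gprod ({..<M} \<times> {..<M}))"
proof -
  define l where "l K = (\<integral>\<^sup>+x. ennreal (loss x (sel K x)) \<partial>N)" for K
  have l0: "l \<longlonglongrightarrow> 0" unfolding l_def by (rule nn_integral_loss_tendsto_0)
  have cap: "capacity = ennreal (enn2real capacity)"
    using capacity_finite by simp
  have bounds: "enn2real capacity - enn2real (l K) \<le> (\<integral>x. rate x (sel K x) \<partial>N)"
      "(\<integral>x. rate x (sel K x) \<partial>N) \<le> enn2real capacity"
    if K: "1 \<le> K" and fin: "l K < \<infinity>" for K
  proof -
    have meas [measurable]: "(\<lambda>x. gain x (sel K x)) \<in> borel_measurable N" "(\<lambda>x. loss x (sel K x)) \<in> borel_measurable N"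
      "(\<lambda>x. rate x (sel K x)) \<in> borel_measurable N"
      using measurable_at_sel[OF K, of gain] measurable_at_sel[OF K, of loss] measurable_at_sel[OF K, of rate]
      by (auto cong: measurable_cong_sets)
    have G: "integrable N (\<lambda>x. gain x (sel K x))"
      using capacity_finite nn_integral_gain_sel[OF K] gain_nonneg
      by (intro integrableI_nonneg) auto
    have L: "integrable N (\<lambda>x. loss x (sel K x))"
      using fin loss_nonneg by (intro integrableI_nonneg) (auto simp: l_def)
    \<comment> \<open>Both rate bounds together give \<open>|rate| \<le> gain + loss\<close>, so the
      rate is integrable.\<close>
    have R: "integrable N (\<lambda>x. rate x (sel K x))"
    proof (rule Bochner_Integration.integrable_bound)
      show "integrable N (\<lambda>x. gain x (sel K x) + loss x (sel K x))" using G L by simp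
      show "AE x in N. norm (rate x (sel K x)) \<le> norm (gain x (sel K x) + loss x (sel K x))"
      proof (rule AE_I2)
        fix x
        show "norm (rate x (sel K x)) \<le> norm (gain x (sel K x) + loss x (sel K x))"
          using rate_bounds[of x "sel K x"] gain_nonneg[of x "sel K x"] loss_nonneg[of x "sel K x"] by simp
      qed
    qed simp
    have iG: "(\<integral>x. gain x (sel K x) \<partial>N) = enn2real capacity"
      using gain_nonneg nn_integral_gain_sel[OF K] by (subst integral_eq_nn_integral) auto
    have iL: "(\<integral>x. loss x (sel K x) \<partial>N) = enn2real (l K)"
      unfolding l_def using loss_nonneg by (subst integral_eq_nn_integral) auto
    have "(\<integral>x. gain x (sel K x) - loss x (sel K x) \<partial>N) \<le> (\<integral>x. rate x (sel K x) \<partial>N)"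
      using G L R rate_bounds(2) by (intro integral_mono) auto
    then show "enn2real capacity - enn2real (l K) \<le> (\<integral>x. rate x (sel K x) \<partial>N)"
      using G L by (simp add: iG iL)
    have "(\<integral>x. rate x (sel K x) \<partial>N) \<le> (\<integral>x. gain x (sel K x) \<partial>N)"
      using G R rate_bounds(1) by (intro integral_mono) auto
    then show "(\<integral>x. rate x (sel K x) \<partial>N) \<le> enn2real capacity" by (simp add: iG)
  qed
  \<comment> \<open>Convergence to 0 makes \<open>l K\<close> finite from some \<open>K\<close> on,
    which is all that the sandwich asks for.\<close>
  have "\<forall>\<^sub>F K in sequentially. l K < \<infinity>"
    using order_tendstoD(2)[OF l0, of \<infinity>] by simp
  then have ev: "\<forall>\<^sub>F K in sequentially. 1 \<le> K \<and> l K < \<infinity>"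
    using eventually_ge_at_top[of "1 :: nat"] by eventually_elim simp
  have "(\<lambda>K. enn2real (l K)) \<longlonglongrightarrow> 0"
    using l0 by (intro tendsto_enn2real) simp_all
  from tendsto_diff[OF tendsto_const this, of "enn2real capacity"]
  have lower: "(\<lambda>K. enn2real capacity - enn2real (l K)) \<longlonglongrightarrow> enn2real capacity" by simp
  show ?thesis
    unfolding integral_rate_gain_mat
  proof (rule tendsto_sandwich[OF _ _ lower tendsto_const])
    show "\<forall>\<^sub>F K in sequentially. enn2real capacity - enn2real (l K) \<le> (\<integral>x. rate x (sel K x) \<partial>N)"
      using ev by eventually_elim (intro bounds; simp)
    show "\<forall>\<^sub>F K in sequentially. (\<integral>x. rate x (sel K x) \<partial>N) \<le> enn2real capacity"
      using ev by eventually_elim (intro bounds; simp)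
  qed
qed

end

lemma (in prob_space) distr_iid_complex_gaussian:
  assumes X: "iid_complex_gaussian X I" and I: "I \<noteq> {}"
  shows "distr M (bprod I) (\<lambda>\<omega>. \<lambda>i\<in>I. X i \<omega>) = gprod I"
    and "(\<lambda>\<omega>. \<lambda>i\<in>I. X i \<omega>) \<in> M \<rightarrow>\<^sub>M bprod I"
proof -
  have ind: "indep_vars (\<lambda>_. borel) X I" and g: "\<And>i. i \<in> I \<Longrightarrow> std_complex_gaussian (X i)"
    using X by (auto simp: iid_complex_gaussian_def)
  have meas: "X i \<in> borel_measurable M" if "i \<in> I" for i
    by (rule distr_std_complex_gaussian(2)[OF g[OF that]])
  have "distr M (bprod I) (\<lambda>\<omega>. \<lambda>i\<in>I. X i \<omega>) = PiM I (\<lambda>i. distr M borel (X i))"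
    using indep_vars_iff_distr_eq_PiM'[OF I, of X "\<lambda>_. borel"] meas ind by simp
  also have "\<dots> = gprod I"
    using distr_std_complex_gaussian(1)[OF g] by (intro PiM_cong) auto
  finally show "distr M (bprod I) (\<lambda>\<omega>. \<lambda>i\<in>I. X i \<omega>) = gprod I" .
  show "(\<lambda>\<omega>. \<lambda>i\<in>I. X i \<omega>) \<in> M \<rightarrow>\<^sub>M bprod I"
    using meas by (intro measurable_restrict) auto
qed

lemma selection_metric_cong:
  assumes "Hk 2 = Hk' 2" "Hk 3 = Hk' 3"
  shows "selection_metric s M P Hk = selection_metric s M P Hk'"
  using assms by (cases s) (simp_all add: interference_cov_def)

theorem theorem1:
  fixes M :: nat and P :: real and s :: oia_scheme
    and v :: "nat \<Rightarrow> complex mat \<Rightarrow> complex vec"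
    and \<Omega> :: "'a measure" and H :: "nat \<Rightarrow> nat \<Rightarrow> 'a \<Rightarrow> complex mat"
    and \<Omega>' :: "'b measure" and Hhat :: "'b \<Rightarrow> complex mat"
  assumes "M \<ge> 1" and "P > 0"
    and "eigenvector_choice (2 * M) v"
    and "prob_space \<Omega>"
    and "\<And>k i \<omega>. k \<ge> 1 \<Longrightarrow> i \<in> {1..3} \<Longrightarrow> \<omega> \<in> space \<Omega> \<Longrightarrow> H k i \<omega> \<in> carrier_mat (2 * M) M"
    and "prob_space.iid_complex_gaussian \<Omega> (\<lambda>(k, i, r, c) \<omega>. H k i \<omega> $$ (r, c))
           ({1..} \<times> {1..3} \<times> {..<2 * M} \<times> {..<M})"
    and "prob_space \<Omega>'"
    and "\<And>\<omega>. \<omega> \<in> space \<Omega>' \<Longrightarrow> Hhat \<omega> \<in> carrier_mat M M"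
    and "prob_space.iid_complex_gaussian \<Omega>' (\<lambda>(r, c) \<omega>. Hhat \<omega> $$ (r, c)) ({..<M} \<times> {..<M})"
  shows "(\<lambda>K. prob_space.average_rate \<Omega> s v M P H K) \<longlonglongrightarrow>
     prob_space.expectation \<Omega>' (\<lambda>\<omega>.
       log2_det (1\<^sub>m M + complex_of_real (P / real M) \<cdot>\<^sub>m (Hhat \<omega> * mat_adjoint (Hhat \<omega>))))"
proof -
  interpret oia M P s v using assms(1-3) by unfold_locales
  interpret \<Omega>: prob_space \<Omega> by fact
  interpret \<Omega>': prob_space \<Omega>' by fact
  \<comment> \<open>\<open>x \<omega>\<close> collects the channel entries of all users into a point
    of the product space; that the entries are i.i.d. Gaussian means that its law is
    \<open>N\<close>.\<close>
  define x where "x \<omega> = (\<lambda>j\<in>idx M. (\<lambda>(k, i, r, c). H k i \<omega> $$ (r, c)) j)" for \<omega>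
  define y where "y \<omega> = (\<lambda>j\<in>{..<M} \<times> {..<M}. (\<lambda>(r, c). Hhat \<omega> $$ (r, c)) j)" for \<omega>
  have iid: "\<Omega>.iid_complex_gaussian (\<lambda>j \<omega>. (\<lambda>(k, i, r, c). H k i \<omega> $$ (r, c)) j) (idx M)"
    using assms(6) by (simp add: idx_def case_prod_unfold)
  have iid': "\<Omega>'.iid_complex_gaussian (\<lambda>j \<omega>. (\<lambda>(r, c). Hhat \<omega> $$ (r, c)) j) ({..<M} \<times> {..<M})"
    using assms(9) by (simp add: case_prod_unfold)
  have ne: "{..<M} \<times> {..<M} \<noteq> {}" using assms(1) by (auto simp: lessThan_empty_iff)
  have x: "distr \<Omega> BN x = N" "x \<in> \<Omega> \<rightarrow>\<^sub>M BN"
    using \<Omega>.distr_iid_complex_gaussian[OF iid idx_nonempty[OF assms(1)]] by (simp_all add: x_def[abs_def])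
  have y: "distr \<Omega>' (bprod ({..<M} \<times> {..<M})) y = gprod ({..<M} \<times> {..<M})"
      "y \<in> \<Omega>' \<rightarrow>\<^sub>M bprod ({..<M} \<times> {..<M})"
    using \<Omega>'.distr_iid_complex_gaussian[OF iid' ne] by (simp_all add: y_def[abs_def])
  have Hx: "H k i \<omega> = Hm M (x \<omega>) k i" if "1 \<le> k" "i \<in> {1..3}" "\<omega> \<in> space \<Omega>" for k i \<omega>
    using assms(5)[OF that] that(1,2) by (intro eq_matI) (auto simp: Hm_def x_def idx_def)
  have avg: "\<Omega>.average_rate s v M P H K = (\<integral>x. rate x (sel K x) \<partial>N)" if K: "1 \<le> K" for K
  proof -
    have "\<Omega>.average_rate s v M P H K = (\<integral>\<omega>. rate (x \<omega>) (sel K (x \<omega>)) \<partial>\<Omega>)"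
      unfolding \<Omega>.average_rate_def Let_def
    proof (rule Bochner_Integration.integral_cong[OF refl])
      fix \<omega> assume \<omega>: "\<omega> \<in> space \<Omega>"
      have "selected_user s M P K (\<lambda>k i. H k i \<omega>) = sel K (x \<omega>)"
        unfolding sel_def using Hx \<omega> by (intro selected_user_cong selection_metric_cong) auto
      moreover have "1 \<le> sel K (x \<omega>)" using sel_in[OF K] by auto
      ultimately show "user_rate M P (postprocessing M v (\<lambda>i. H (selected_user s M P K (\<lambda>k i. H k i \<omega>)) i \<omega>))
          (\<lambda>i. H (selected_user s M P K (\<lambda>k i. H k i \<omega>)) i \<omega>) = rate (x \<omega>) (sel K (x \<omega>))"
        using Hx[OF _ _ \<omega>]
        by (simp add: rate_def F_def user_rate_def rate_plus_def rate_minus_def postprocessing_def interference_cov_def)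
    qed
    also have "\<dots> = (\<integral>x. rate x (sel K x) \<partial>distr \<Omega> BN x)"
      by (rule integral_distr[symmetric, OF x(2) measurable_at_sel[OF K measurable_rate]])
    finally show ?thesis by (simp only: x(1))
  qed
  have "\<Omega>'.expectation (\<lambda>\<omega>. log2_det (1\<^sub>m M + complex_of_real (P / real M) \<cdot>\<^sub>m (Hhat \<omega> * mat_adjoint (Hhat \<omega>)))) =
      (\<integral>\<omega>. rate_gain M P (mat M M (y \<omega>)) \<partial>\<Omega>')"
  proof (rule Bochner_Integration.integral_cong[OF refl])
    fix \<omega> assume "\<omega> \<in> space \<Omega>'"
    then have "Hhat \<omega> = mat M M (y \<omega>)" using assms(8) by (intro eq_matI) (auto simp: y_def)
    then show "log2_det (1\<^sub>m M + complex_of_real (P / real M) \<cdot>\<^sub>m (Hhat \<omega> * mat_adjoint (Hhat \<omega>))) =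
        rate_gain M P (mat M M (y \<omega>))" by (simp add: rate_gain_def)
  qed
  also have "\<dots> = (\<integral>z. rate_gain M P (mat M M z) \<partial>distr \<Omega>' (bprod ({..<M} \<times> {..<M})) y)"
    by (rule integral_distr[symmetric, OF y(2) measurable_rate_gain_mat])
  finally have cap: "\<Omega>'.expectation (\<lambda>\<omega>. log2_det (1\<^sub>m M + complex_of_real (P / real M) \<cdot>\<^sub>m (Hhat \<omega> * mat_adjoint (Hhat \<omega>)))) =
      (\<integral>z. rate_gain M P (mat M M z) \<partial>gprod ({..<M} \<times> {..<M}))"
    by (simp only: y(1))
  show ?thesis
    unfolding cap
  \<comment> \<open>For \<open>K = 0\<close> the selection is from the empty set, so equality is
    claimed only for \<open>K \<ge> 1\<close>.\<close>
  proof (rule Lim_transform_eventually[OF integral_rate_tendsto])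
    show "\<forall>\<^sub>F K in sequentially. (\<integral>x. rate x (sel K x) \<partial>N) = \<Omega>.average_rate s v M P H K"
      using eventually_ge_at_top[of 1] by eventually_elim (simp add: avg)
  qed
qed

end
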